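(* Let $X$ be a complex manifold of dimension $n$ satisfying Cond A, with a fixed frame $\omega=(\omega^1,\dots,\omega^n)$ as in Cond A. Let $\Omega \Subset X$ be a relatively compact domain of holomorphy, let $K \Subset \Omega$ be a compact subset, and let $f$ be a holomorphic function on $\Omega$. Assume that $$|f(a)| \leq \rho(a,\Omega), \quad \forall a \in K.$$ Then $$|f(a)| \leq \rho(a,\Omega), \quad \forall a \in \hat{K}_\Omega.$$ In particular, $$\rho(K,\Omega)=\rho(\hat{K}_\Omega,\Omega).$$
   Context: Cond A: $X$ is a connected complex manifold of dimension $n$ and there is a global holomorphic frame $\omega=(\omega^1,\dots,\omega^n)$ of the holomorphic cotangent bundle of $X$ over $X$ such that $d\omega^j=0$ for $1\le j\le n$. The scalar $\rho(a,\Omega)$: for $\rho>0$ write $\rho\,\mathrm{P}\Delta=\{\zeta=(\zeta^j)\in\mathbf{C}^n: |\zeta^j|<\rho,\ 1\le j\le n\}$. Let $\Omega\subset X$ be a subdomain and $a\in\Omega$. Near $a$ the map $\alpha(x)=\left(\int_a^x\omega^1,\dots,\int_a^x\omega^n\right)\in\mathbf{C}^n$ has a holomorphic inverse $\phi_{a,\rho_0}:\rho_0\mathrm{P}\Delta\to\Omega$ for small $\rho_0>0$, with $\phi_{a,\rho_0}(0)=a$. For $\rho\ge\rho_0$ let $\phi_{a,\rho}:\rho\,\mathrm{P}\Delta\to X$ denote the holomorphic extension of $\phi_{a,\rho_0}$, if it exists (equivalently, the unique holomorphic map with $\phi_{a,\rho}(0)=a$ and $\phi_{a,\rho}^*\omega^j=d\zeta^j$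 for all $j$). Then $$\rho(a,\Omega)=\sup\{\rho>0:\ \phi_{a,\rho}:\rho\,\mathrm{P}\Delta\to X \text{ exists and } \phi_{a,\rho}(\rho\,\mathrm{P}\Delta)\subset\Omega\}\in(0,\infty].$$ For $A\subset\Omega$ put $\rho(A,\Omega)=\inf\{\rho(a,\Omega):a\in A\}$. $\mathcal{O}(\Omega)$ is the set of holomorphic functions on $\Omega$. For compact $K\Subset\Omega$, $\hat{K}_\Omega=\{x\in\Omega: |g(x)|\le\max_K|g|,\ \forall g\in\mathcal{O}(\Omega)\}$. A relatively compact subdomain $\Omega\Subset X$ is a domain of holomorphy if there is no point $b\in\partial\Omega$ for which there exist a connected neighborhood $U$ of $b$ in $X$ and a non-empty open subset $V\subset U\cap\Omega$ such that for every $f\in\mathcal{O}(\Omega)$ there is $g\in\mathcal{O}(U)$ with $f|_V=g|_V$. *)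

theory Defs
  imports "HOL-Analysis.Analysis"
begin

section \<open>Holomorphic functions of several complex variables\<close>

text \<open>The dimension \<open>n\<close> is the cardinality of the index type \<open>'n\<close>, which replaces \<open>{1,\<dots>,n}\<close>.
  All predicates of the form \<open>hol_on\<close> below are meant for open sets.\<close>

definition hol_on :: "(complex^'n \<Rightarrow> complex) \<Rightarrow> (complex^'n) set \<Rightarrow> bool" where
  "hol_on f S \<longleftrightarrow>
    (\<forall>z\<in>S. \<exists>D. (f has_derivative D) (at z) \<and> (\<forall>c v. D (c *s v) = c * D v))"

definition hol_map_on :: "(complex^'n \<Rightarrow> complex^'m) \<Rightarrow> (complex^'n) set \<Rightarrow> bool" where
  "hol_map_on F S \<longleftrightarrow> (\<forall>j. hol_on (\<lambda>z. F z $ j) S)"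

definition cpartial :: "'n \<Rightarrow> (complex^'n \<Rightarrow> complex) \<Rightarrow> complex^'n \<Rightarrow> complex" where
  "cpartial k f z = deriv (\<lambda>t. f (z + axis k t)) 0"

definition polydisc :: "real \<Rightarrow> (complex^'n) set" where
  "polydisc \<rho> = {\<zeta>. \<forall>j. cmod (\<zeta> $ j) < \<rho>}"

section \<open>Complex manifolds\<close>

text \<open>The manifold \<open>X\<close> is the whole type \<open>'a\<close>; Hausdorffness and second countability are type class
  constraints on \<open>'a\<close> in the main statement.  A chart is a pair of an open set and a coordinate map
  which is only relevant on that set.\<close>

type_synonym ('a, 'n) chart = "'a set \<times> ('a \<Rightarrow> complex^'n)"

definition complex_atlas :: "('a::topological_space, 'n::finite) chart set \<Rightarrow> bool" where
  "complex_atlas A \<longleftrightarrow>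
    (\<Union>(U, \<phi>)\<in>A. U) = UNIV \<and>
    (\<forall>(U, \<phi>)\<in>A. open U \<and> open (\<phi> ` U) \<and> homeomorphism U (\<phi> ` U) \<phi> (inv_into U \<phi>)) \<and>
    (\<forall>(U, \<phi>)\<in>A. \<forall>(V, \<psi>)\<in>A. hol_map_on (\<lambda>z. \<psi> (inv_into U \<phi> z)) (\<phi> ` (U \<inter> V)))"

text \<open>\<open>\<O>(\<Omega>)\<close>, for open \<open>\<Omega>\<close>.  Its elements are total functions whose values outside \<open>\<Omega>\<close> are
  arbitrary.\<close>

definition hol_functions ::
    "('a::topological_space, 'n::finite) chart set \<Rightarrow> 'a set \<Rightarrow> ('a \<Rightarrow> complex) set" where
  "hol_functions A \<Omega> =
    {f. \<forall>(U, \<phi>)\<in>A. hol_on (\<lambda>z. f (inv_into U \<phi> z)) (\<phi> ` (U \<inter> \<Omega>))}"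

text \<open>Holomorphic maps from an open subset of \<open>\<complex>\<^sup>n\<close> into the manifold.\<close>

definition hol_into ::
    "('a::topological_space, 'n::finite) chart set \<Rightarrow> (complex^'n) set \<Rightarrow> (complex^'n \<Rightarrow> 'a) \<Rightarrow> bool" where
  "hol_into A S \<Phi> \<longleftrightarrow>
    continuous_on S \<Phi> \<and>
    (\<forall>(U, \<phi>)\<in>A. hol_map_on (\<lambda>\<zeta>. \<phi> (\<Phi> \<zeta>)) {\<zeta>\<in>S. \<Phi> \<zeta> \<in> U})"

section \<open>Holomorphic 1-forms\<close>

text \<open>A section of the holomorphic cotangent bundle is given by its coefficient vectors in all
  charts: in the chart \<open>c = (U, \<phi>)\<close> with coordinates \<open>z\<close> the form \<open>\<theta>\<close> is
  \<open>\<Sum>k. \<theta> c z $ k dz\<^sub>k\<close> on \<open>\<phi> ` U\<close>, and on overlaps the coefficients transform by the chain rule.\<close>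

type_synonym ('a, 'n) form = "('a, 'n) chart \<Rightarrow> complex^'n \<Rightarrow> complex^'n"

definition hol_form ::
    "('a::topological_space, 'n::finite) chart set \<Rightarrow> ('a, 'n) form \<Rightarrow> bool" where
  "hol_form A \<theta> \<longleftrightarrow>
    (\<forall>(U, \<phi>)\<in>A. hol_map_on (\<theta> (U, \<phi>)) (\<phi> ` U)) \<and>
    (\<forall>(U, \<phi>)\<in>A. \<forall>(V, \<psi>)\<in>A. \<forall>x\<in>U \<inter> V. \<forall>k.
      \<theta> (U, \<phi>) (\<phi> x) $ k =
        (\<Sum>l\<in>UNIV. \<theta> (V, \<psi>) (\<psi> x) $ l * cpartial k (\<lambda>z. \<psi> (inv_into U \<phi> z) $ l) (\<phi> x)))"

text \<open>For a holomorphic form,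
  \<open>d\<theta> = \<Sum>k<l. (\<partial>\<theta>\<^sub>l/\<partial>z\<^sub>k - \<partial>\<theta>\<^sub>k/\<partial>z\<^sub>l) dz\<^sub>k \<and> dz\<^sub>l\<close>.\<close>

definition ext_deriv :: "('a, 'n::finite) form \<Rightarrow> ('a, 'n) chart \<Rightarrow> complex^'n \<Rightarrow> 'n \<Rightarrow> 'n \<Rightarrow> complex" where
  "ext_deriv \<theta> c z k l = cpartial k (\<lambda>w. \<theta> c w $ l) z - cpartial l (\<lambda>w. \<theta> c w $ k) z"

definition closed_form ::
    "('a::topological_space, 'n::finite) chart set \<Rightarrow> ('a, 'n) form \<Rightarrow> bool" where
  "closed_form A \<theta> \<longleftrightarrow> (\<forall>(U, \<phi>)\<in>A. \<forall>z\<in>\<phi> ` U. \<forall>k l. ext_deriv \<theta> (U, \<phi>) z k l = 0)"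

text \<open>A frame of the cotangent bundle: holomorphic sections which form a basis of every fibre.\<close>

definition cotangent_frame ::
    "('a::topological_space, 'n::finite) chart set \<Rightarrow> ('n \<Rightarrow> ('a, 'n) form) \<Rightarrow> bool" where
  "cotangent_frame A \<omega> \<longleftrightarrow>
    (\<forall>j. hol_form A (\<omega> j)) \<and>
    (\<forall>(U, \<phi>)\<in>A. \<forall>z\<in>\<phi> ` U. \<forall>v. \<exists>!t :: complex^'n. v = (\<Sum>j\<in>UNIV. t $ j *s \<omega> j (U, \<phi>) z))"

definition cond_A ::
    "('a::topological_space, 'n::finite) chart set \<Rightarrow> ('n \<Rightarrow> ('a, 'n) form) \<Rightarrow> bool" where
  "cond_A A \<omega> \<longleftrightarrow>
    complex_atlas A \<and> connected (UNIV :: 'a set) \<and>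
    cotangent_frame A \<omega> \<and> (\<forall>j. closed_form A (\<omega> j))"

section \<open>The radius \<open>\<rho>(a, \<Omega>)\<close>\<close>

text \<open>Coefficient of \<open>d\<zeta>\<^sub>k\<close> in \<open>\<Phi>\<^sup>*\<theta>\<close> at \<open>\<zeta>\<close>, computed in a chart around \<open>\<Phi> \<zeta>\<close>.\<close>

definition pullback_coeff ::
    "('a, 'n::finite) form \<Rightarrow> (complex^'n \<Rightarrow> 'a) \<Rightarrow> ('a, 'n) chart \<Rightarrow> complex^'n \<Rightarrow> 'n \<Rightarrow> complex" where
  "pullback_coeff \<theta> \<Phi> c \<zeta> k =
    (\<Sum>l\<in>UNIV. \<theta> c (snd c (\<Phi> \<zeta>)) $ l * cpartial k (\<lambda>\<xi>. snd c (\<Phi> \<xi>) $ l) \<zeta>)"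

text \<open>\<open>\<Phi>\<close> is the map \<open>\<phi>\<^bsub>a,\<rho>\<^esub>\<close>: it is holomorphic on the polydisc, sends \<open>0\<close> to \<open>a\<close>, and satisfies
  \<open>\<Phi>\<^sup>*\<omega>\<^sup>j = d\<zeta>\<^sup>j\<close> for all \<open>j\<close>; it is determined by this on the polydisc.\<close>

definition is_phi ::
    "('a::topological_space, 'n::finite) chart set \<Rightarrow> ('n \<Rightarrow> ('a, 'n) form) \<Rightarrow> 'a \<Rightarrow> real \<Rightarrow>
      (complex^'n \<Rightarrow> 'a) \<Rightarrow> bool" where
  "is_phi A \<omega> a \<rho> \<Phi> \<longleftrightarrow>
    hol_into A (polydisc \<rho>) \<Phi> \<and> \<Phi> 0 = a \<and>
    (\<forall>(U, \<phi>)\<in>A. \<forall>\<zeta>\<in>polydisc \<rho>. \<Phi> \<zeta> \<in> U \<longrightarrow>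
      (\<forall>j k. pullback_coeff (\<omega> j) \<Phi> (U, \<phi>) \<zeta> k = (if j = k then 1 else 0)))"

definition rho ::
    "('a::topological_space, 'n::finite) chart set \<Rightarrow> ('n \<Rightarrow> ('a, 'n) form) \<Rightarrow> 'a \<Rightarrow> 'a set \<Rightarrow> ereal" where
  "rho A \<omega> a \<Omega> =
    Sup (ereal ` {\<rho>. \<rho> > 0 \<and> (\<exists>\<Phi>. is_phi A \<omega> a \<rho> \<Phi> \<and> \<Phi> ` polydisc \<rho> \<subseteq> \<Omega>)})"

definition rho_set ::
    "('a::topological_space, 'n::finite) chart set \<Rightarrow> ('n \<Rightarrow> ('a, 'n) form) \<Rightarrow> 'a set \<Rightarrow> 'a set \<Rightarrow> ereal" where
  "rho_set A \<omega> S \<Omega> = (INF a\<in>S. rho A \<omega> a \<Omega>)"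

section \<open>Holomorphic hulls and domains of holomorphy\<close>

text \<open>For compact nonempty \<open>K\<close> the supremum is the maximum of \<open>|g|\<close> on \<open>K\<close>.  It is taken in
  \<^typ>\<open>ereal\<close>, so that the hull of the empty set is empty.\<close>

definition hol_hull ::
    "('a::topological_space, 'n::finite) chart set \<Rightarrow> 'a set \<Rightarrow> 'a set \<Rightarrow> 'a set" where
  "hol_hull A \<Omega> K =
    {x\<in>\<Omega>. \<forall>g\<in>hol_functions A \<Omega>. ereal (cmod (g x)) \<le> (SUP y\<in>K. ereal (cmod (g y)))}"

definition relcompact_subdomain :: "'a::topological_space set \<Rightarrow> bool" where
  "relcompact_subdomain \<Omega> \<longleftrightarrow> open \<Omega> \<and> connected \<Omega> \<and> \<Omega> \<noteq> {} \<and> compact (closure \<Omega>)"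

definition domain_of_holomorphy ::
    "('a::topological_space, 'n::finite) chart set \<Rightarrow> 'a set \<Rightarrow> bool" where
  "domain_of_holomorphy A \<Omega> \<longleftrightarrow>
    \<not> (\<exists>b\<in>frontier \<Omega>. \<exists>U V.
        open U \<and> connected U \<and> b \<in> U \<and>
        open V \<and> V \<noteq> {} \<and> V \<subseteq> U \<inter> \<Omega> \<and>
        (\<forall>f\<in>hol_functions A \<Omega>. \<exists>g\<in>hol_functions A U. \<forall>x\<in>V. f x = g x))"

end

theory Submission
  imports Defs "HOL-Complex_Analysis.Cauchy_Integral_Formula"
begin

text \<open>
  For \<open>u \<in> \<O>(\<Omega>)\<close> and \<open>\<zeta> \<in> \<complex>\<^sup>n\<close> let \<open>P\<^sub>k(x, \<zeta>)\<close> be the \<open>k\<close>-th Taylor coefficient at \<open>s = 0\<close> of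
  \<open>s \<mapsto> u (\<phi>\<^sub>x (s \<zeta>))\<close>.  It is holomorphic in \<open>x \<in> \<Omega>\<close> and homogeneous of degree \<open>k\<close> in \<open>\<zeta>\<close>.  For \<open>t < 1\<close>
  the hypothesis on \<open>K\<close> and compactness bound \<open>u\<close> uniformly on the polydiscs of radius \<open>t |f x|\<close>
  around the points \<open>x \<in> K\<close>, so Cauchy's inequality bounds \<open>(t |f|)\<^sup>k |P\<^sub>k(\<cdot>, \<zeta>)|\<close> on \<open>K\<close>, uniformly in \<open>k\<close>
  and \<open>|\<zeta>| \<le> 1\<close>.  As \<open>f\<^sup>k P\<^sub>k(\<cdot>, \<zeta>) \<in> \<O>(\<Omega>)\<close>, the same bound holds at every point \<open>a\<close> of the hull, and
  \<open>\<Sum>\<^sub>k P\<^sub>k(a, \<cdot>)\<close> continues \<open>u \<circ> \<phi>\<^sub>a\<close> holomorphically to the polydisc of radius \<open>|f a|\<close>.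

  Suppose \<open>\<rho>(a, \<Omega>) < |f a|\<close>.  Since the closure of \<open>\<Omega>\<close> is compact, the maps \<open>\<phi>\<^sub>x\<close> exist with a uniform
  radius for \<open>x\<close> in it, and gluing them extends \<open>\<phi>\<^sub>a\<close> as a map into \<open>X\<close> beyond the radius
  \<open>\<rho>(a, \<Omega>)\<close>.  A point of minimal norm that leaves \<open>\<Omega>\<close> is mapped to the boundary of \<open>\<Omega>\<close>, and near that
  boundary point every \<open>u \<in> \<O>(\<Omega>)\<close> continues holomorphically, so \<open>\<Omega>\<close> is not a domain of holomorphy.
\<close>

section \<open>Calculus of holomorphic functions of several variables\<close>

lemma bounded_linear_axis: "bounded_linear (axis k :: complex \<Rightarrow> complex^'n::finite)"
  by (rule linear_conv_bounded_linear[THEN iffD1]) (auto intro!: linearI simp: axis_def vec_eq_iff)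

lemma axis_eq_scale: "axis k t = t *s (axis k 1 :: complex^'n::finite)"
  by (simp add: axis_def vec_eq_iff)

lemma bounded_linear_cscale: "bounded_linear (\<lambda>v::complex^'n::finite. c *s v)"
  by (rule linear_conv_bounded_linear[THEN iffD1]) (auto intro!: linearI simp: vec_eq_iff algebra_simps)

lemma bounded_linear_cscale_left: "bounded_linear (\<lambda>c::complex. c *s (v::complex^'n::finite))"
  by (rule linear_conv_bounded_linear[THEN iffD1]) (auto intro!: linearI simp: vec_eq_iff algebra_simps)

lemma norm_cscale: "norm (c *s (v::complex^'n::finite)) = cmod c * norm v"
  by (simp add: norm_vec_def L2_set_right_distrib norm_mult)

lemma continuous_on_cscale [continuous_intros]:
  fixes g :: "'b::topological_space \<Rightarrow> complex^'n::finite"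
  assumes "continuous_on S c" "continuous_on S g"
  shows "continuous_on S (\<lambda>x. c x *s g x)"
  using assms by (auto intro!: continuous_intros simp: vector_scalar_mult_def)

text \<open>A complex linear \<open>D\<close> is determined by its values on the vectors
  \<open>axis k 1\<close>, and there it equals the derivative along the coordinate line. This turns
  the existential in \<open>hol_on\<close> into an explicit formula with partial
  derivatives.\<close>

lemma has_derivative_clinear:
  fixes f :: "complex^'n::finite \<Rightarrow> complex"
  assumes "(f has_derivative D) (at z)" "\<And>c v. D (c *s v) = c * D v"
  shows "cpartial k f z = D (axis k 1)"
    and "D = (\<lambda>v. \<Sum>k\<in>UNIV. v $ k * cpartial k f z)"
proof -
  have ax: "cpartial k f z = D (axis k 1)" for k
  proof -
    have "((\<lambda>t. z + axis k t) has_derivative (axis k :: complex \<Rightarrow> _)) (at 0)"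
      by (auto intro!: derivative_eq_intros bounded_linear_imp_has_derivative bounded_linear_axis)
    moreover have "(f has_derivative D) (at (z + axis k 0))"
      using assms(1) by (simp add: axis_def vec_lambda_eta flip: zero_vec_def)
    ultimately have "((\<lambda>t. f (z + axis k t)) has_derivative (\<lambda>t. D (axis k t))) (at 0)"
      by (rule has_derivative_compose)
    moreover have "(\<lambda>t. D (axis k t)) = (*) (D (axis k 1))"
      by (subst axis_eq_scale) (simp add: assms(2) fun_eq_iff)
    ultimately show ?thesis
      unfolding cpartial_def by (intro DERIV_imp_deriv) (simp add: has_field_derivative_def)
  qed
  show "cpartial k f z = D (axis k 1)" by (rule ax)
  have lin: "linear D" using assms(1) by (rule has_derivative_linear)
  show "D = (\<lambda>v. \<Sum>k\<in>UNIV. v $ k * cpartial k f z)"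
  proof
    fix v
    have "D v = D (\<Sum>k\<in>UNIV. v $ k *s axis k 1)" by (simp add: basis_expansion)
    also have "\<dots> = (\<Sum>k\<in>UNIV. v $ k * cpartial k f z)"
      by (simp add: linear_sum[OF lin] assms(2) ax)
    finally show "D v = (\<Sum>k\<in>UNIV. v $ k * cpartial k f z)" .
  qed
qed

lemma hol_onD:
  fixes f :: "complex^'n::finite \<Rightarrow> complex"
  assumes "hol_on f S" "z \<in> S"
  shows "(f has_derivative (\<lambda>v. \<Sum>k\<in>UNIV. v $ k * cpartial k f z)) (at z)"
proof -
  obtain D where D: "(f has_derivative D) (at z)" "\<And>c v. D (c *s v) = c * D v"
    using assms unfolding hol_on_def by blast
  show ?thesis using D(1) by (subst (asm) has_derivative_clinear(2)[OF D])
qed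

lemma hol_onI:
  fixes f :: "complex^'n::finite \<Rightarrow> complex"
  assumes "\<And>z. z \<in> S \<Longrightarrow> (f has_derivative (\<lambda>v. \<Sum>k\<in>UNIV. v $ k * c k z)) (at z)"
  shows "hol_on f S"
  unfolding hol_on_def
proof (intro ballI exI conjI allI)
  show "z \<in> S \<Longrightarrow> (f has_derivative (\<lambda>v. \<Sum>k\<in>UNIV. v $ k * c k z)) (at z)" for z by (rule assms)
qed (simp add: sum_distrib_left mult.assoc)

lemma cpartial_eqI:
  fixes f :: "complex^'n::finite \<Rightarrow> complex"
  assumes "(f has_derivative (\<lambda>v. \<Sum>k\<in>UNIV. v $ k * c k)) (at z)"
  shows "cpartial k f z = c k"
proof -
  have "cpartial k f z = (\<Sum>i\<in>UNIV. axis k 1 $ i * c i)"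
    by (rule has_derivative_clinear(1)[OF assms]) (simp add: sum_distrib_left mult.assoc)
  also have "\<dots> = (\<Sum>i\<in>UNIV. if i = k then c i else 0)"
    by (intro sum.cong) (auto simp: axis_def)
  finally show ?thesis by simp
qed

lemma hol_on_imp_continuous_on: "hol_on f S \<Longrightarrow> continuous_on S (f :: complex^'n::finite \<Rightarrow> complex)"
  by (meson continuous_at_imp_continuous_on has_derivative_continuous hol_onD)

lemma hol_on_subset: "hol_on f T \<Longrightarrow> S \<subseteq> T \<Longrightarrow> hol_on f S"
  unfolding hol_on_def by blast

lemma hol_map_on_subset: "hol_map_on F T \<Longrightarrow> S \<subseteq> T \<Longrightarrow> hol_map_on F S"
  unfolding hol_map_on_def by (blast intro: hol_on_subset)

lemma hol_on_cong:
  assumes "open S" "\<And>z. z \<in> S \<Longrightarrow> f z = g z" "hol_on f S"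
  shows "hol_on g S"
  using assms has_derivative_transform_within_open[of f _ _ UNIV S g] unfolding hol_on_def by metis

lemma hol_on_local:
  assumes "\<And>z. z \<in> S \<Longrightarrow> \<exists>T. open T \<and> z \<in> T \<and> hol_on f (S \<inter> T)"
  shows "hol_on f S"
  using assms unfolding hol_on_def by (meson IntI)

lemma cpartial_cong:
  fixes f :: "complex^'n::finite \<Rightarrow> complex"
  assumes "open S" "z \<in> S" "\<And>w. w \<in> S \<Longrightarrow> f w = g w"
  shows "cpartial k f z = cpartial k g z"
proof -
  have "((\<lambda>t. z + axis k t) \<longlongrightarrow> z + axis k 0) (nhds 0)"
    by (intro tendsto_intros bounded_linear.tendsto[OF bounded_linear_axis] filterlim_ident)
  then have "eventually (\<lambda>t. z + axis k t \<in> S) (nhds 0)"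
    by (rule topological_tendstoD) (use assms in \<open>auto simp: axis_def vec_lambda_eta simp flip: zero_vec_def\<close>)
  then show ?thesis
    unfolding cpartial_def by (intro deriv_cong_ev) (auto elim!: eventually_mono simp: assms)
qed

section \<open>Sums, products and compositions of holomorphic functions\<close>

lemma hol_on_const [simp]: "hol_on (\<lambda>z. c) S"
  unfolding hol_on_def by (auto intro!: exI[of _ "\<lambda>v. 0"])

lemma hol_on_nth: "hol_on (\<lambda>z::complex^'n::finite. z $ k) S"
  unfolding hol_on_def
  by (auto intro!: exI[of _ "\<lambda>v. v $ k"] bounded_linear_imp_has_derivative bounded_linear_vec_nth)

lemma hol_on_add:
  assumes "hol_on f S" "hol_on g S" shows "hol_on (\<lambda>z. f z + g z) S"
  unfolding hol_on_def
proof
  fix z assume "z \<in> S"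
  with assms obtain D E where "(f has_derivative D) (at z)" "\<forall>c v. D (c *s v) = c * D v"
    "(g has_derivative E) (at z)" "\<forall>c v. E (c *s v) = c * E v" unfolding hol_on_def by metis
  then show "\<exists>D. ((\<lambda>z. f z + g z) has_derivative D) (at z) \<and> (\<forall>c v. D (c *s v) = c * D v)"
    by (intro exI[of _ "\<lambda>v. D v + E v"]) (auto intro!: derivative_intros simp: algebra_simps)
qed

lemma hol_on_mult:
  assumes "hol_on f S" "hol_on g S" shows "hol_on (\<lambda>z. f z * g z) S"
  unfolding hol_on_def
proof
  fix z assume "z \<in> S"
  with assms obtain D E where "(f has_derivative D) (at z)" "\<forall>c v. D (c *s v) = c * D v"
    "(g has_derivative E) (at z)" "\<forall>c v. E (c *s v) = c * E v" unfolding hol_on_def by metis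
  then show "\<exists>D. ((\<lambda>z. f z * g z) has_derivative D) (at z) \<and> (\<forall>c v. D (c *s v) = c * D v)"
    by (intro exI[of _ "\<lambda>v. f z * E v + D v * g z"] conjI has_derivative_mult) (auto simp: algebra_simps)
qed

lemma has_derivative_vec_componentwise:
  fixes F :: "'b::real_normed_vector \<Rightarrow> complex^'m::finite"
  assumes "\<And>l. ((\<lambda>z. F z $ l) has_derivative (\<lambda>v. D v $ l)) (at z)"
  shows "(F has_derivative D) (at z)"
proof -
  \<comment> \<open>Decomposing into coordinate embeddings reduces the claim to a finite sum of
    compositions with the bounded linear maps \<open>axis l\<close>.\<close>
  have eq: "G = (\<lambda>z. \<Sum>l\<in>UNIV. axis l (G z $ l))" for G :: "'b \<Rightarrow> complex^'m"
  proof (intro ext, subst vec_eq_iff, rule allI)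
    fix z i
    have "(\<Sum>l\<in>UNIV. axis l (G z $ l)) $ i = (\<Sum>l\<in>UNIV. if l = i then G z $ l else 0)"
      unfolding sum_component by (intro sum.cong) (auto simp: axis_def)
    then show "G z $ i = (\<Sum>l\<in>UNIV. axis l (G z $ l)) $ i" by simp
  qed
  show ?thesis
    by (subst eq[of F], subst eq[of D])
      (intro has_derivative_sum bounded_linear.has_derivative[OF bounded_linear_axis] assms)
qed

lemma hol_map_onD:
  fixes F :: "complex^'n::finite \<Rightarrow> complex^'m::finite"
  assumes "hol_map_on F S" "z \<in> S"
  shows "(F has_derivative (\<lambda>v. \<chi> l. \<Sum>k\<in>UNIV. v $ k * cpartial k (\<lambda>z. F z $ l) z)) (at z)"
  by (rule has_derivative_vec_componentwise) (use assms in \<open>auto simp: hol_map_on_def intro: hol_onD\<close>)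

text \<open>Both conclusions come from one formula for the derivative of the composite;
  interchanging the two finite sums brings it into the shape from which holomorphy and the partial
  derivatives are read off.\<close>

lemma
  fixes F :: "complex^'n::finite \<Rightarrow> complex^'m::finite" and f :: "complex^'m \<Rightarrow> complex"
  assumes "hol_map_on F S" "hol_on f T" "F ` S \<subseteq> T"
  shows hol_on_compose: "hol_on (\<lambda>z. f (F z)) S"
    and cpartial_chain: "z \<in> S \<Longrightarrow>
      cpartial k (\<lambda>z. f (F z)) z = (\<Sum>l\<in>UNIV. cpartial l f (F z) * cpartial k (\<lambda>z. F z $ l) z)"
proof -
  have D: "((\<lambda>z. f (F z)) has_derivative
      (\<lambda>v. \<Sum>k\<in>UNIV. v $ k * (\<Sum>l\<in>UNIV. cpartial l f (F z) * cpartial k (\<lambda>z. F z $ l) z))) (at z)"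
    if z: "z \<in> S" for z
  proof -
    have "((\<lambda>z. f (F z)) has_derivative
      (\<lambda>v. \<Sum>l\<in>UNIV. (\<chi> l. \<Sum>k\<in>UNIV. v $ k * cpartial k (\<lambda>z. F z $ l) z) $ l * cpartial l f (F z))) (at z)"
      by (rule has_derivative_compose[OF hol_map_onD[OF assms(1) z] hol_onD[OF assms(2)]])
        (use z assms(3) in auto)
    moreover have "(\<Sum>l\<in>UNIV. (\<chi> l. \<Sum>k\<in>UNIV. v $ k * cpartial k (\<lambda>z. F z $ l) z) $ l * cpartial l f (F z))
       = (\<Sum>k\<in>UNIV. v $ k * (\<Sum>l\<in>UNIV. cpartial l f (F z) * cpartial k (\<lambda>z. F z $ l) z))" for v
      unfolding sum_distrib_left sum_distrib_right vec_lambda_beta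
      by (subst sum.swap) (simp add: algebra_simps)
    ultimately show ?thesis by simp
  qed
  show "hol_on (\<lambda>z. f (F z)) S" by (rule hol_onI) (rule D)
  show "z \<in> S \<Longrightarrow>
      cpartial k (\<lambda>z. f (F z)) z = (\<Sum>l\<in>UNIV. cpartial l f (F z) * cpartial k (\<lambda>z. F z $ l) z)"
    by (rule cpartial_eqI) (rule D)
qed

lemma hol_on_affine: "hol_map_on (\<lambda>z::complex^'n::finite. c *s z + d) S"
  unfolding hol_map_on_def
  by (auto intro!: hol_on_add hol_on_mult hol_on_nth)

lemma hol_on_line_imp_holomorphic:
  fixes f :: "complex^'n::finite \<Rightarrow> complex"
  assumes "hol_on f S" "\<And>s. s \<in> T \<Longrightarrow> w + s *s v \<in> S"
  shows "(\<lambda>s. f (w + s *s v)) holomorphic_on T"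
  unfolding holomorphic_on_def field_differentiable_def
proof
  fix s assume "s \<in> T"
  then obtain D where D: "(f has_derivative D) (at (w + s *s v))" "\<forall>c v. D (c *s v) = c * D v"
    using assms unfolding hol_on_def by metis
  have "((\<lambda>s. w + s *s v) has_derivative (\<lambda>s. s *s v)) (at s within T)"
    by (auto intro!: derivative_eq_intros bounded_linear_imp_has_derivative bounded_linear_cscale_left)
  from has_derivative_compose[OF this D(1)] have "((\<lambda>s. f (w + s *s v)) has_derivative (\<lambda>s. s * D v)) (at s within T)"
    using D(2) by simp
  then have "((\<lambda>s. f (w + s *s v)) has_field_derivative D v) (at s within T)"
    unfolding has_field_derivative_def by (rule has_derivative_eq_rhs) (simp add: fun_eq_iff)
  then show "\<exists>f'. ((\<lambda>s. f (w + s *s v)) has_field_derivative f') (at s within T)" ..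
qed

section \<open>Cauchy integrals along a coordinate direction\<close>

text \<open>When Cauchy's formula is parametrised by the unit interval, the velocity of the circle
  is \<open>2 * pi * \<i>\<close> times the point itself, which cancels the constant and one power
  in the denominator. As a mean over a real interval, the coefficient is accessible to continuity
  and differentiation of parameter integrals.\<close>

lemma higher_deriv_circle_mean:
  assumes "g holomorphic_on ball 0 R" "0 < r" "r < R"
  shows "((\<lambda>t. g (circlepath 0 r t) / circlepath 0 r t ^ k) has_integral (deriv ^^ k) g 0 / fact k) {0..1}"
proof -
  have "g holomorphic_on cball 0 r" by (rule holomorphic_on_subset[OF assms(1)]) (use assms in auto)
  then have "((\<lambda>u. g u / (u - 0) ^ Suc k) has_contour_integral
      ((2 * pi * \<i>) / (fact k) * (deriv ^^ k) g 0)) (circlepath 0 r)"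
    by (intro Cauchy_has_contour_integral_higher_derivative_circlepath)
       (use assms in \<open>auto intro: holomorphic_on_imp_continuous_on holomorphic_on_subset\<close>)
  then have "((\<lambda>t. g (circlepath 0 r t) / circlepath 0 r t ^ Suc k
      * vector_derivative (circlepath 0 r) (at t within {0..1})) has_integral
      ((2 * pi * \<i>) / (fact k) * (deriv ^^ k) g 0)) {0..1}"
    by (simp add: has_contour_integral_def)
  from has_integral_mult_right[OF this, of "1 / (2 * pi * \<i>)"]
  have *: "((\<lambda>t. 1 / (2 * pi * \<i>) * (g (circlepath 0 r t) / circlepath 0 r t ^ Suc k
      * vector_derivative (circlepath 0 r) (at t within {0..1}))) has_integral
      ((deriv ^^ k) g 0 / fact k)) {0..1}"
    by simp
  show ?thesis
  proof (rule has_integral_eq[OF _ *])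
    fix t :: real assume t: "t \<in> {0..1}"
    have "circlepath 0 r t \<noteq> 0" using assms by (simp add: circlepath)
    moreover have "vector_derivative (circlepath 0 r) (at t within {0..1}) = 2 * pi * \<i> * circlepath 0 r t"
      using t by (subst vector_derivative_circlepath01) (auto simp: circlepath)
    ultimately show "1 / (2 * pi * \<i>) * (g (circlepath 0 r t) / circlepath 0 r t ^ Suc k
      * vector_derivative (circlepath 0 r) (at t within {0..1})) = g (circlepath 0 r t) / circlepath 0 r t ^ k"
      by (simp add: field_simps)
  qed
qed

lemma norm_circlepath_0: "cmod (circlepath 0 r t) = \<bar>r\<bar>"
  by (simp add: circlepath norm_mult)

lemma circlepath_0_neq_0: "r \<noteq> 0 \<Longrightarrow> circlepath 0 r t \<noteq> 0"
  by (simp add: circlepath)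

lemma continuous_on_circlepath [continuous_intros]:
  "continuous_on S t \<Longrightarrow> continuous_on S (\<lambda>x. circlepath z r (t x))"
  unfolding circlepath by (intro continuous_intros)

lemma cpartial_circle_mean:
  fixes f :: "complex^'n::finite \<Rightarrow> complex"
  assumes "hol_on f (ball z R)" "0 < r" "r < R"
  shows "((\<lambda>t. f (z + axis k (circlepath 0 r t)) / circlepath 0 r t) has_integral cpartial k f z) {0..1}"
proof -
  have "(\<lambda>s. f (z + s *s axis k 1)) holomorphic_on ball 0 R"
    by (rule hol_on_line_imp_holomorphic[OF assms(1)]) (auto simp: dist_norm norm_cscale)
  from higher_deriv_circle_mean[OF this assms(2,3), of 1]
  show ?thesis by (simp add: cpartial_def flip: axis_eq_scale)
qed

text \<open>\<open>hol_on\<close> only asks for differentiability at each point. The circle mean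
  writes a partial derivative as an integral of the continuous \<open>f\<close>, which depends
  continuously on the base point.\<close>

lemma continuous_on_cpartial:
  fixes f :: "complex^'n::finite \<Rightarrow> complex"
  assumes "hol_on f S" "open S"
  shows "continuous_on S (cpartial k f)"
proof (rule continuous_at_imp_continuous_on, rule ballI)
  fix z0 assume "z0 \<in> S"
  then obtain \<epsilon> where \<epsilon>: "\<epsilon> > 0" "ball z0 \<epsilon> \<subseteq> S" using assms(2) openE by blast
  \<comment> \<open>Strictly below \<open>\<epsilon> / 2\<close>, so that circles of this radius
    around points of \<open>ball z0 (\<epsilon>/2)\<close> stay in \<open>S\<close> and inside a
    slightly larger disc of holomorphy.\<close>
  define r where "r = \<epsilon> / 4"
  have sub: "ball z (\<epsilon>/2) \<subseteq> S" if "z \<in> ball z0 (\<epsilon>/2)" for z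
  proof
    fix w assume "w \<in> ball z (\<epsilon>/2)"
    then have "dist z0 w < \<epsilon>"
      using that dist_triangle[of z0 w z] by (simp add: dist_commute)
    then show "w \<in> S" using \<epsilon> by auto
  qed
  have in_S: "z + axis k (circlepath 0 r t) \<in> S" if "z \<in> ball z0 (\<epsilon>/2)" for z t
    by (rule subsetD[OF sub[OF that]]) (use \<epsilon> in \<open>subst axis_eq_scale, simp add: dist_norm norm_cscale norm_circlepath_0 r_def\<close>)
  have "continuous_on (ball z0 (\<epsilon>/2) \<times> cbox 0 1) (\<lambda>(z,t). f (z + axis k (circlepath 0 r t)) / circlepath 0 r t)"
    unfolding split_def
    by (intro continuous_intros continuous_on_compose2[OF hol_on_imp_continuous_on[OF assms(1)]]
        bounded_linear.continuous_on[OF bounded_linear_axis])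
      (use \<epsilon> in_S circlepath_0_neq_0[of r] in \<open>auto simp: r_def\<close>)+
  then have "continuous_on (ball z0 (\<epsilon>/2)) (\<lambda>z. integral (cbox 0 1) (\<lambda>t. f (z + axis k (circlepath 0 r t)) / circlepath 0 r t))"
    by (rule integral_continuous_on_param)
  moreover have "integral (cbox 0 1) (\<lambda>t. f (z + axis k (circlepath 0 r t)) / circlepath 0 r t) = cpartial k f z"
    if "z \<in> ball z0 (\<epsilon>/2)" for z
    unfolding interval_cbox[symmetric]
    by (rule integral_unique[OF cpartial_circle_mean[where R="\<epsilon>/2"]])
       (use sub[OF that] \<epsilon> hol_on_subset[OF assms(1)] in \<open>auto simp: r_def\<close>)
  ultimately have "continuous_on (ball z0 (\<epsilon>/2)) (cpartial k f)"
    by (subst (asm) continuous_on_cong[OF refl]) auto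
  then show "isCont (cpartial k f) z0"
    using \<epsilon> by (auto simp: continuous_on_eq_continuous_at)
qed

text \<open>Differentiation under the integral sign for an affine family of arguments. The form
  covers integrals over segments (\<open>c t = t\<close>) as well as circle means, in which the
  circle either scales \<open>z\<close> or moves it.\<close>

lemma
  fixes f :: "complex^'n::finite \<Rightarrow> complex" and c e :: "real \<Rightarrow> complex"
  assumes S: "open S" "hol_on f S" and W: "open W"
    and cont: "continuous_on {0..1} c" "continuous_on {0..1} d" "continuous_on {0..1} e"
    and sub: "\<And>z t. z \<in> W \<Longrightarrow> t \<in> {0..1} \<Longrightarrow> c t *s z + d t \<in> S"
  shows hol_on_integral: "hol_on (\<lambda>z. integral {0..1} (\<lambda>t. e t * f (c t *s z + d t))) W" (is ?A)
    and cpartial_integral: "z \<in> W \<Longrightarrow> cpartial k (\<lambda>z. integral {0..1} (\<lambda>t. e t * f (c t *s z + d t))) z =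
      integral {0..1} (\<lambda>t. e t * c t * cpartial k f (c t *s z + d t))" (is "_ \<Longrightarrow> ?B")
proof -
  define G where "G k z t = e t * c t * cpartial k f (c t *s z + d t)" for k z t
  \<comment> \<open>The candidate derivative as a bounded linear function of the increment, the form
    in which \<open>leibniz_rule\<close> expects it; its joint continuity is checked vector by
    vector.\<close>
  define L where "L z t = Blinfun (\<lambda>v. \<Sum>k\<in>UNIV. v $ k * G k z t)" for z t
  have L: "blinfun_apply (L z t) = (\<lambda>v. \<Sum>k\<in>UNIV. v $ k * G k z t)" for z t
    unfolding L_def by (intro bounded_linear_Blinfun_apply bounded_linear_sum bounded_linear_mult_left[THEN bounded_linear_compose] bounded_linear_vec_nth)
  have cont': "continuous_on (W \<times> {0..1}) (\<lambda>x. c (snd x))" "continuous_on (W \<times> {0..1}) (\<lambda>x. d (snd x))"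
    "continuous_on (W \<times> {0..1}) (\<lambda>x. e (snd x))"
    by (rule continuous_on_compose2[OF cont(1)] continuous_on_compose2[OF cont(2)] continuous_on_compose2[OF cont(3)];
        auto intro!: continuous_intros)+
  have contG: "continuous_on (W \<times> {0..1}) (\<lambda>(z, t). G k z t)" for k
    unfolding G_def split_def
    by (intro continuous_intros cont' continuous_on_compose2[OF continuous_on_cpartial[OF S(2,1)]])
      (use sub in auto)
  have contL: "continuous_on (W \<times> {0..1}) (\<lambda>(z, t). L z t)"
    by (intro continuous_on_blinfun_componentwise)
      (use contG in \<open>auto simp: L split_def intro!: continuous_intros\<close>)
  have contf: "continuous_on (W \<times> {0..1}) (\<lambda>(z, t). e t * f (c t *s z + d t))"
    unfolding split_def
    by (intro continuous_intros cont' continuous_on_compose2[OF hol_on_imp_continuous_on[OF S(2)]])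
      (use sub in auto)
  have slice: "continuous_on {0..1} (h z)" if "continuous_on (W \<times> {0..1}) (\<lambda>(z, t). h z t)" "z \<in> W"
    for h :: "complex^'n \<Rightarrow> real \<Rightarrow> 'c::topological_space" and z
  proof -
    have "continuous_on {0..1} (Pair z)" by (intro continuous_intros)
    from continuous_on_compose2[OF that(1) this] that(2) show ?thesis by auto
  qed
  have D: "((\<lambda>z. integral {0..1} (\<lambda>t. e t * f (c t *s z + d t))) has_derivative
     (\<lambda>v. \<Sum>k\<in>UNIV. v $ k * integral {0..1} (G k z0))) (at z0)" if "z0 \<in> W" for z0
  proof -
    obtain \<epsilon> where \<epsilon>: "\<epsilon> > 0" "ball z0 \<epsilon> \<subseteq> W" using W \<open>z0 \<in> W\<close> openE by blast
    have "((\<lambda>z. integral (cbox 0 1) (\<lambda>t. e t * f (c t *s z + d t))) has_derivative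
      integral (cbox 0 1) (L z0)) (at z0 within ball z0 \<epsilon>)"
    proof (rule leibniz_rule)
      fix z t assume z: "z \<in> ball z0 \<epsilon>" and t: "t \<in> cbox 0 (1::real)"
      have "((\<lambda>z. c t *s z + d t) has_derivative (\<lambda>v. c t *s v)) (at z)"
        by (auto intro!: derivative_eq_intros bounded_linear_imp_has_derivative bounded_linear_cscale)
      from has_derivative_compose[OF this hol_onD[OF S(2) sub[of z t]]]
      have "((\<lambda>z. f (c t *s z + d t)) has_derivative (\<lambda>v. \<Sum>k\<in>UNIV. c t * v $ k * cpartial k f (c t *s z + d t))) (at z)"
        using z t \<epsilon> by auto
      from has_derivative_mult_right[OF this, of "e t"]
      have "((\<lambda>z. e t * f (c t *s z + d t)) has_derivative (\<lambda>v. e t * (\<Sum>k\<in>UNIV. c t * v $ k * cpartial k f (c t *s z + d t)))) (at z)" .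
      then have "((\<lambda>z. e t * f (c t *s z + d t)) has_derivative L z t) (at z)"
        by (rule has_derivative_eq_rhs) (simp add: L G_def fun_eq_iff sum_distrib_left algebra_simps)
      then show "((\<lambda>z. e t * f (c t *s z + d t)) has_derivative L z t) (at z within ball z0 \<epsilon>)"
        by (rule has_derivative_at_withinI)
    next
      fix z assume z: "z \<in> ball z0 \<epsilon>"
      then show "(\<lambda>t. e t * f (c t *s z + d t)) integrable_on cbox 0 1"
        unfolding interval_cbox[symmetric]
        using slice[OF contf] \<epsilon> by (intro integrable_continuous_real) auto
    qed (use \<epsilon> in \<open>auto intro: continuous_on_subset[OF contL]\<close>)
    moreover have "blinfun_apply (integral {0..1} (L z0)) = (\<lambda>v. \<Sum>k\<in>UNIV. v $ k * integral {0..1} (G k z0))"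
    proof
      fix v
      have Li: "L z0 integrable_on {0..1}"
        using slice[OF contL that] by (intro integrable_continuous_real)
      have Gi: "G k z0 integrable_on {0..1}" for k
        using slice[OF contG that] by (intro integrable_continuous_real)
      have "blinfun_apply (integral {0..1} (L z0)) v = integral {0..1} (\<lambda>t. blinfun_apply (L z0 t) v)"
        using integral_linear[OF Li blinfun.bounded_linear_left[of v]] by (simp add: o_def)
      also have "\<dots> = (\<Sum>k\<in>UNIV. integral {0..1} (\<lambda>t. v $ k * G k z0 t))"
        unfolding L by (rule integral_sum) (auto intro!: integrable_on_mult_right Gi)
      finally show "blinfun_apply (integral {0..1} (L z0)) v = (\<Sum>k\<in>UNIV. v $ k * integral {0..1} (G k z0))"
        by simp
    qed
    moreover have "at z0 within ball z0 \<epsilon> = at z0" by (rule at_within_open) (use \<epsilon> in auto)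
    ultimately show ?thesis by (simp only: interval_cbox[symmetric])
  qed
  show ?A by (rule hol_onI) (rule D)
  show "z \<in> W \<Longrightarrow> ?B" using cpartial_eqI[OF D] by (simp add: G_def[abs_def])
qed

section \<open>Cauchy estimates and series with geometric majorants\<close>

lemma cpartial_bound:
  fixes f :: "complex^'n::finite \<Rightarrow> complex"
  assumes "hol_on f (ball z R)" "\<And>w. w \<in> ball z R \<Longrightarrow> cmod (f w) \<le> B" "0 < r" "r < R"
  shows "cmod (cpartial k f z) \<le> B / r"
proof -
  have hol: "(\<lambda>s. f (z + s *s axis k 1)) holomorphic_on ball 0 R"
    by (rule hol_on_line_imp_holomorphic[OF assms(1)]) (auto simp: dist_norm norm_cscale)
  have "cmod ((deriv ^^ 1) (\<lambda>s. f (z + s *s axis k 1)) 0) \<le> fact 1 * B / r ^ 1"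
  proof (rule Cauchy_inequality)
    show "(\<lambda>s. f (z + s *s axis k 1)) holomorphic_on ball 0 r"
      by (rule holomorphic_on_subset[OF hol]) (use assms in auto)
    show "continuous_on (cball 0 r) (\<lambda>s. f (z + s *s axis k 1))"
      by (rule holomorphic_on_imp_continuous_on[OF holomorphic_on_subset[OF hol]]) (use assms in auto)
    show "cmod (f (z + x *s axis k 1)) \<le> B" if "cmod (0 - x) = r" for x
      using that assms by (auto simp: dist_norm norm_cscale)
  qed (use assms in auto)
  then show ?thesis by (simp add: cpartial_def flip: axis_eq_scale)
qed

text \<open>The Cauchy estimate on balls of half the radius transfers the geometric majorant from
  the terms to their partial derivatives. The differentiated series then converges uniformly near
  \<open>z\<close>, so the sum may be differentiated term by term.\<close>

lemma hol_on_suminf: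
  fixes P :: "nat \<Rightarrow> complex^'n::finite \<Rightarrow> complex"
  assumes hol: "\<And>i. hol_on (P i) S"
    and bd: "\<And>z. z \<in> S \<Longrightarrow> \<exists>R>0. \<exists>M q. ball z R \<subseteq> S \<and> 0 \<le> q \<and> q < 1 \<and>
        (\<forall>w\<in>ball z R. \<forall>i. cmod (P i w) \<le> M * q ^ i)"
  shows "hol_on (\<lambda>z. \<Sum>i. P i z) S"
proof (rule hol_onI)
  fix z assume "z \<in> S"
  from bd[OF this] obtain R M q where R: "R > 0" "ball z R \<subseteq> S" and q: "0 \<le> q" "q < 1"
    and M: "\<And>w i. w \<in> ball z R \<Longrightarrow> cmod (P i w) \<le> M * q ^ i" by blast
  define B where "B = ball z (R/2)"
  define c where "c k w = (\<Sum>i. cpartial k (P i) w)" for k w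
  have sub: "ball w (R/2) \<subseteq> ball z R" if "w \<in> B" for w
  proof
    fix y assume "y \<in> ball w (R/2)"
    then show "y \<in> ball z R"
      using that dist_triangle[of z y w] by (simp add: B_def dist_commute)
  qed
  \<comment> \<open>A point of \<open>B\<close> has a ball of radius \<open>R/2\<close> inside
    \<open>ball z R\<close>; \<open>R/4\<close> is a radius strictly below that.\<close>
  have cb: "cmod (cpartial k (P i) w) \<le> M * q ^ i / (R/4)" if "w \<in> B" for k i w
    by (rule cpartial_bound[of _ w "R/2"])
       (use sub[OF that] R M hol_on_subset[OF hol] in auto)
  have summ: "summable (\<lambda>i. M * q ^ i / (R/4))"
    by (intro summable_divide summable_mult summable_geometric) (use q in auto)
  have ul: "uniform_limit B (\<lambda>n w. \<Sum>i<n. cpartial k (P i) w) (c k) sequentially" for k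
    unfolding c_def by (rule Weierstrass_m_test[OF cb summ])
  have "\<exists>g. \<forall>x\<in>B. (\<lambda>i. P i x) sums g x \<and> (g has_derivative (\<lambda>v. \<Sum>k\<in>UNIV. v $ k * c k x)) (at x within B)"
  proof (rule has_derivative_series)
    show "convex B" by (simp add: B_def)
    show "z \<in> B" using R by (simp add: B_def)
    show "(P n has_derivative (\<lambda>v. \<Sum>k\<in>UNIV. v $ k * cpartial k (P n) x)) (at x within B)" if "x \<in> B" for n x
    proof -
      have "x \<in> ball x (R/2)" using R by simp
      with sub[OF that] R have "x \<in> S" by blast
      then show ?thesis by (rule has_derivative_at_withinI[OF hol_onD[OF hol]])
    qed
    have "summable (\<lambda>i. P i z)"
      by (rule summable_comparison_test'[of "\<lambda>i. M * q ^ i" 0])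
        (use q M R in \<open>auto intro!: summable_mult summable_geometric\<close>)
    then show "(\<lambda>n. P n z) sums (\<Sum>n. P n z)" by (rule summable_sums)
    fix e :: real assume e: "e > 0"
    \<comment> \<open>The error of the linear form is at most the sum of the errors of its
      coefficients, so each coefficient gets an equal share of \<open>e\<close>.\<close>
    define e' where "e' = e / CARD('n)"
    have "e' > 0" using e by (simp add: e'_def)
    then have "\<forall>\<^sub>F n in sequentially. \<forall>k\<in>UNIV. \<forall>x\<in>B. dist (\<Sum>i<n. cpartial k (P i) x) (c k x) < e'"
      using ul unfolding uniform_limit_iff by (intro eventually_ball_finite) auto
    then show "\<forall>\<^sub>F n in sequentially. \<forall>x\<in>B. \<forall>h. norm ((\<Sum>i<n. \<Sum>k\<in>UNIV. h $ k * cpartial k (P i) x)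
        - (\<Sum>k\<in>UNIV. h $ k * c k x)) \<le> e * norm h"
    proof (eventually_elim, intro ballI allI)
      fix n x and h :: "complex^'n"
      assume *: "\<forall>k\<in>UNIV. \<forall>x\<in>B. dist (\<Sum>i<n. cpartial k (P i) x) (c k x) < e'" and x: "x \<in> B"
      have "(\<Sum>i<n. \<Sum>k\<in>UNIV. h $ k * cpartial k (P i) x) - (\<Sum>k\<in>UNIV. h $ k * c k x)
        = (\<Sum>k\<in>UNIV. h $ k * ((\<Sum>i<n. cpartial k (P i) x) - c k x))"
        by (subst sum.swap) (simp add: sum_distrib_left right_diff_distrib sum_subtractf)
      also have "cmod \<dots> \<le> (\<Sum>k\<in>(UNIV::'n set). norm h * e')"
      proof (intro sum_norm_le)
        fix k
        show "cmod (h $ k * ((\<Sum>i<n. cpartial k (P i) x) - c k x)) \<le> norm h * e'"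
          unfolding norm_mult using * x Finite_Cartesian_Product.norm_nth_le[of h k]
          by (intro mult_mono) (auto simp: dist_norm less_imp_le)
      qed
      also have "\<dots> = e * norm h" by (simp add: e'_def)
      finally show "norm ((\<Sum>i<n. \<Sum>k\<in>UNIV. h $ k * cpartial k (P i) x)
        - (\<Sum>k\<in>UNIV. h $ k * c k x)) \<le> e * norm h" .
    qed
  qed
  then obtain g where g: "\<And>x. x \<in> B \<Longrightarrow> (\<lambda>i. P i x) sums g x"
    "\<And>x. x \<in> B \<Longrightarrow> (g has_derivative (\<lambda>v. \<Sum>k\<in>UNIV. v $ k * c k x)) (at x within B)" by blast
  have z: "z \<in> B" "open B" using R by (auto simp: B_def)
  have "(g has_derivative (\<lambda>v. \<Sum>k\<in>UNIV. v $ k * c k z)) (at z)"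
    using g(2)[OF z(1)] by (simp only: at_within_open[OF z])
  then show "((\<lambda>z. \<Sum>i. P i z) has_derivative (\<lambda>v. \<Sum>k\<in>UNIV. v $ k * c k z)) (at z)"
    by (rule has_derivative_transform_within_open[OF _ z(2,1)]) (rule sums_unique[OF g(1)])
qed

section \<open>Primitives of closed forms and inverse functions\<close>

lemma cpartial_nth: "cpartial k (\<lambda>z::complex^'n::finite. z $ j) z = (if j = k then 1 else 0)"
proof -
  have "((\<lambda>z::complex^'n. z $ j) has_derivative (\<lambda>v. v $ j)) (at z)"
    by (intro bounded_linear_imp_has_derivative bounded_linear_vec_nth)
  from has_derivative_clinear(1)[OF this] show ?thesis by (simp add: axis_def)
qed

lemma of_real_cscale: "of_real t *s (v::complex^'n::finite) = t *\<^sub>R v"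
  by (simp add: vec_eq_iff) (simp add: scaleR_conv_of_real)

text \<open>The Poincare lemma on a ball: the integral of \<open>\<theta>\<close> over the segment
  from \<open>z0\<close> to \<open>z\<close> is a primitive.\<close>

lemma closed_form_primitive:
  fixes \<theta> :: "complex^'n::finite \<Rightarrow> complex^'n"
  assumes hol: "hol_map_on \<theta> (ball z0 R)"
    and closed: "\<And>z k l. z \<in> ball z0 R \<Longrightarrow> cpartial k (\<lambda>w. \<theta> w $ l) z = cpartial l (\<lambda>w. \<theta> w $ k) z"
  obtains h where "hol_on h (ball z0 R)" "h z0 = 0"
    "\<And>z k. z \<in> ball z0 R \<Longrightarrow> cpartial k h z = \<theta> z $ k"
proof -
  \<comment> \<open>The segment from \<open>z0\<close> to \<open>z\<close>, written with complex
    scalars to match the pattern \<open>c t *s z + d t\<close> of \<open>hol_on_integral\<close>;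
    the factor 1 in \<open>I\<close> is the weight \<open>e t\<close> there.\<close>
  define p where "p z t = of_real t *s z + of_real (1 - t) *s z0" for z and t :: real
  define I where "I l z = integral {0..1} (\<lambda>t. 1 * \<theta> (p z t) $ l)" for l z
  define h where "h z = (\<Sum>l\<in>UNIV. (z $ l - z0 $ l) * I l z)" for z
  have \<theta>: "hol_on (\<lambda>z. \<theta> z $ l) (ball z0 R)" for l using hol by (simp add: hol_map_on_def)
  have p_in: "p z t \<in> ball z0 R" if "z \<in> ball z0 R" "t \<in> {0..1}" for z t
  proof -
    have "z0 \<in> ball z0 R" using that(1) by (metis centre_in_ball mem_ball zero_le_dist dual_order.strict_trans2)
    then show ?thesis
      unfolding p_def of_real_cscale using convexD[OF convex_ball that(1) _, of z0 t "1-t"] that(2) by auto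
  qed
  have I: "hol_on (I l) (ball z0 R)"
    "z \<in> ball z0 R \<Longrightarrow> cpartial k (I l) z = integral {0..1} (\<lambda>t. 1 * of_real t * cpartial k (\<lambda>z. \<theta> z $ l) (p z t))"
    for l k z
    unfolding I_def[abs_def] p_def
    by (rule hol_on_integral[OF open_ball \<theta> open_ball, of complex_of_real "\<lambda>t. complex_of_real (1 - t) *s z0"]
          cpartial_integral[OF open_ball \<theta> open_ball, of complex_of_real "\<lambda>t. complex_of_real (1 - t) *s z0"];
        (intro continuous_intros | use p_in[unfolded p_def] in blast | assumption))+
  have D: "(h has_derivative (\<lambda>v. \<Sum>k\<in>UNIV. v $ k * \<theta> z $ k)) (at z)" if z: "z \<in> ball z0 R" for z
  proof -
    have 1: "(h has_derivative (\<lambda>v. \<Sum>l\<in>UNIV. (z $ l - z0 $ l) * (\<Sum>k\<in>UNIV. v $ k * cpartial k (I l) z) + v $ l * I l z)) (at z)"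
    proof -
      have "((\<lambda>z. z $ l - z0 $ l) has_derivative (\<lambda>v. v $ l)) (at z)" for l
        by (auto intro!: derivative_eq_intros bounded_linear_imp_has_derivative bounded_linear_vec_nth)
      then show ?thesis
        unfolding h_def[abs_def] by (intro has_derivative_sum has_derivative_mult hol_onD[OF I(1) z])
    qed
    \<comment> \<open>The left-hand side is what the product rule gives for the derivative of
      \<open>h\<close> in direction \<open>k\<close>. Once closedness has exchanged the indices
      \<open>k\<close> and \<open>l\<close>, its integrand is the \<open>t\<close>-derivative of
      \<open>t * \<theta> (p z t) $ k\<close>.\<close>
    have 2: "I k z + (\<Sum>l\<in>UNIV. (z $ l - z0 $ l) * cpartial k (I l) z) = \<theta> z $ k" for k
    proof -
      have contp: "continuous_on {0..1} (p z)" unfolding p_def by (intro continuous_intros)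
      have conth: "continuous_on {0..1} (\<lambda>t. g (p z t))" if "continuous_on (ball z0 R) g" for g :: "complex^'n \<Rightarrow> complex"
        by (rule continuous_on_compose2[OF that contp]) (use p_in z in auto)
      have int: "(\<lambda>t. of_real t * cpartial k (\<lambda>z. \<theta> z $ l) (p z t)) integrable_on {0..1}" for l
        by (intro integrable_continuous_real continuous_intros conth continuous_on_cpartial[OF \<theta>]) auto
      have "((\<lambda>t. \<theta> (p z t) $ k + of_real t * (\<Sum>l\<in>UNIV. (z $ l - z0 $ l) * cpartial l (\<lambda>z. \<theta> z $ k) (p z t)))
         has_integral (of_real 1 * \<theta> (p z 1) $ k - of_real 0 * \<theta> (p z 0) $ k)) {0..1}"
      proof (rule fundamental_theorem_of_calculus)
        fix t :: real assume t: "t \<in> {0..1}"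
        have "(p z has_derivative (\<lambda>s. s *\<^sub>R (z - z0))) (at t within {0..1})"
          unfolding p_def of_real_cscale
          by (auto intro!: derivative_eq_intros simp: fun_eq_iff algebra_simps)
        from has_derivative_compose[OF this hol_onD[OF \<theta> p_in[OF z t]]]
        have "((\<lambda>t. \<theta> (p z t) $ k) has_derivative
          (\<lambda>s. \<Sum>l\<in>UNIV. (s *\<^sub>R (z - z0)) $ l * cpartial l (\<lambda>z. \<theta> z $ k) (p z t))) (at t within {0..1})" .
        then have "((\<lambda>t. \<theta> (p z t) $ k) has_vector_derivative
          (\<Sum>l\<in>UNIV. (z $ l - z0 $ l) * cpartial l (\<lambda>z. \<theta> z $ k) (p z t))) (at t within {0..1})"
          unfolding has_vector_derivative_def
          by (rule has_derivative_eq_rhs) (simp add: fun_eq_iff scaleR_sum_right)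
        then show "((\<lambda>t. of_real t * \<theta> (p z t) $ k) has_vector_derivative
           (\<theta> (p z t) $ k + of_real t * (\<Sum>l\<in>UNIV. (z $ l - z0 $ l) * cpartial l (\<lambda>z. \<theta> z $ k) (p z t))))
           (at t within {0..1})"
          by (auto intro!: derivative_eq_intros simp: algebra_simps)
      qed simp
      then have "integral {0..1} (\<lambda>t. \<theta> (p z t) $ k + of_real t * (\<Sum>l\<in>UNIV. (z $ l - z0 $ l) * cpartial l (\<lambda>z. \<theta> z $ k) (p z t)))
        = \<theta> (p z 1) $ k" by (simp add: integral_unique)
      also have "p z 1 = z" by (simp add: p_def)
      finally have "\<theta> z $ k = integral {0..1} (\<lambda>t. \<theta> (p z t) $ k + of_real t * (\<Sum>l\<in>UNIV. (z $ l - z0 $ l) * cpartial l (\<lambda>z. \<theta> z $ k) (p z t)))" ..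
      also have "\<dots> = integral {0..1} (\<lambda>t. \<theta> (p z t) $ k + (\<Sum>l\<in>UNIV. (z $ l - z0 $ l) * (of_real t * cpartial k (\<lambda>z. \<theta> z $ l) (p z t))))"
        by (rule integral_cong) (simp add: sum_distrib_left algebra_simps closed[OF p_in[OF z], of _ k])
      also have "\<dots> = integral {0..1} (\<lambda>t. \<theta> (p z t) $ k) +
         (\<Sum>l\<in>UNIV. integral {0..1} (\<lambda>t. (z $ l - z0 $ l) * (of_real t * cpartial k (\<lambda>z. \<theta> z $ l) (p z t))))"
        using int conth[OF hol_on_imp_continuous_on[OF \<theta>]]
        by (simp only: integral_add integral_sum integrable_sum integrable_on_mult_right
            integrable_continuous_real finite)
      also have "\<dots> = I k z + (\<Sum>l\<in>UNIV. (z $ l - z0 $ l) * cpartial k (I l) z)"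
        by (simp add: I(2)[OF z]) (simp add: I_def)
      finally show ?thesis ..
    qed
    have "(\<Sum>l\<in>UNIV. (z $ l - z0 $ l) * (\<Sum>k\<in>UNIV. v $ k * cpartial k (I l) z) + v $ l * I l z)
       = (\<Sum>k\<in>UNIV. v $ k * \<theta> z $ k)" for v
    proof -
      have "(\<Sum>k\<in>UNIV. v $ k * \<theta> z $ k) = (\<Sum>k\<in>UNIV. v $ k * I k z) +
         (\<Sum>k\<in>UNIV. \<Sum>l\<in>UNIV. v $ k * ((z $ l - z0 $ l) * cpartial k (I l) z))"
        by (simp add: 2[symmetric] distrib_left sum.distrib sum_distrib_left)
      also have "\<dots> = (\<Sum>l\<in>UNIV. (z $ l - z0 $ l) * (\<Sum>k\<in>UNIV. v $ k * cpartial k (I l) z) + v $ l * I l z)"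
        by (subst sum.swap) (simp add: sum.distrib sum_distrib_left mult.left_commute)
      finally show ?thesis ..
    qed
    then show ?thesis using 1 by simp
  qed
  show ?thesis
  proof
    show "hol_on h (ball z0 R)" by (rule hol_onI) (rule D)
    show "h z0 = 0" by (simp add: h_def)
    show "cpartial k h z = \<theta> z $ k" if "z \<in> ball z0 R" for k z by (rule cpartial_eqI[OF D[OF that]])
  qed
qed

text \<open>The real inverse function theorem provides \<open>G\<close>, whose derivative is the
  inverse of a complex linear bijection and hence complex linear. The assumption \<open>inj\<close>
  says that the complex Jacobian at \<open>z0\<close> has trivial kernel.\<close>

lemma hol_inverse_function:
  fixes F :: "complex^'n::finite \<Rightarrow> complex^'n"
  assumes S: "open S" "z0 \<in> S" and hol: "hol_map_on F S"
    and inj: "\<And>v. (\<And>j. (\<Sum>l\<in>UNIV. v $ l * cpartial l (\<lambda>z. F z $ j) z0) = 0) \<Longrightarrow> v = 0"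
  obtains U V G where "open U" "z0 \<in> U" "U \<subseteq> S" "open V" "F z0 \<in> V" "homeomorphism U V F G" "hol_map_on G V"
proof -
  define J where "J z v = (\<chi> j. \<Sum>l\<in>UNIV. v $ l * cpartial l (\<lambda>z. F z $ j) z)" for z v
  have linJ: "linear (J z)" for z
    by (rule linearI) (auto simp: J_def vec_eq_iff sum.distrib scaleR_sum_right algebra_simps)
  then have J: "bounded_linear (J z)" for z by (simp add: linear_conv_bounded_linear)
  have Jc: "J z (c *s v) = c *s J z v" for z c v
    by (simp add: J_def vec_eq_iff sum_distrib_left mult.assoc)
  have "inj (J z0)"
    unfolding linear_injective_0[OF linJ]
  proof (intro allI impI, rule inj)
    fix x j assume "J z0 x = 0"
    then have "J z0 x $ j = 0" by simp
    then show "(\<Sum>l\<in>UNIV. x $ l * cpartial l (\<lambda>z. F z $ j) z0) = 0" by (simp add: J_def)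
  qed
  \<comment> \<open>A linear left inverse of the injective Jacobian, which the inverse function
    theorem takes as input.\<close>
  then obtain K where K: "linear K" "\<And>x. K (J z0 x) = x"
    using linear_injective_isomorphism[OF linJ] by blast
  then have bK: "bounded_linear K" by (simp add: linear_conv_bounded_linear)
  have "continuous_on S (\<lambda>z. Blinfun (J z))"
  proof (rule continuous_on_blinfun_componentwise)
    fix i :: "complex^'n"
    have "continuous_on S (\<lambda>z. J z i)"
      unfolding J_def using hol S(1)
      by (intro continuous_intros continuous_on_cpartial) (auto simp: hol_map_on_def)
    then show "continuous_on S (\<lambda>z. blinfun_apply (Blinfun (J z)) i)"
      by (simp add: bounded_linear_Blinfun_apply J)
  qed
  moreover have "(F has_derivative blinfun_apply (Blinfun (J z))) (at z)" if "z \<in> S" for z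
    unfolding bounded_linear_Blinfun_apply[OF J] J_def by (rule hol_map_onD[OF hol that])
  moreover have "Blinfun K o\<^sub>L Blinfun (J z0) = id_blinfun"
    by (rule blinfun_eqI) (simp add: bounded_linear_Blinfun_apply J bK K)
  ultimately obtain U V G G' where G: "open U" "U \<subseteq> S" "z0 \<in> U" "open V" "F z0 \<in> V" "homeomorphism U V F G"
    and G': "\<And>y. y \<in> V \<Longrightarrow> (G has_derivative G' y) (at y)"
    "\<And>y. y \<in> V \<Longrightarrow> G' y = inv (blinfun_apply (Blinfun (J (G y))))"
    "\<And>y. y \<in> V \<Longrightarrow> bij (blinfun_apply (Blinfun (J (G y))))"
    using inverse_function_theorem[OF S(1) _ _ S(2), of F "\<lambda>z. Blinfun (J z)" "Blinfun K"] by metis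
  have "hol_map_on G V"
    unfolding hol_map_on_def hol_on_def
  proof (intro allI ballI exI conjI)
    fix j y c v assume y: "y \<in> V"
    show "((\<lambda>y. G y $ j) has_derivative (\<lambda>v. G' y v $ j)) (at y)"
      by (rule bounded_linear.has_derivative[OF bounded_linear_vec_nth G'(1)[OF y]])
    have bij: "bij (J (G y))" and inv: "G' y = inv (J (G y))"
      using G'(2,3)[OF y] by (simp_all add: bounded_linear_Blinfun_apply J)
    have "G' y (c *s v) = c *s G' y v"
      unfolding inv using bij
      by (intro inv_f_eq) (auto simp: bij_is_inj Jc surj_f_inv_f[OF bij_is_surj])
    then show "G' y (c *s v) $ j = c * G' y v $ j" by simp
  qed
  with G show ?thesis using that by blast
qed

section \<open>Polydiscs\<close>

text \<open>The norm whose open balls around 0 are the polydiscs; radii of polydiscs can then be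
  handled by the triangle inequality and homogeneity.\<close>

definition supnorm :: "complex^'n::finite \<Rightarrow> real" where
  "supnorm z = Max (range (\<lambda>j. cmod (z $ j)))"

lemma supnorm_less_iff: "supnorm z < r \<longleftrightarrow> (\<forall>j. cmod (z $ j) < r)"
  by (simp add: supnorm_def)

lemma supnorm_le_iff: "supnorm z \<le> r \<longleftrightarrow> (\<forall>j. cmod (z $ j) \<le> r)"
  by (simp add: supnorm_def)

lemma polydisc_iff: "z \<in> polydisc r \<longleftrightarrow> supnorm z < r"
  by (simp add: polydisc_def supnorm_less_iff)

lemma nth_le_supnorm: "cmod (z $ j) \<le> supnorm z"
  using supnorm_le_iff by blast

lemma supnorm_nonneg: "0 \<le> supnorm z"
  using norm_ge_zero nth_le_supnorm by (rule order_trans)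

lemma supnorm_le_norm: "supnorm z \<le> norm z"
  by (simp add: supnorm_le_iff Finite_Cartesian_Product.norm_nth_le)

lemma norm_le_supnorm: "norm (z :: complex^'n::finite) \<le> CARD('n) * supnorm z"
proof -
  have "norm z \<le> (\<Sum>j\<in>UNIV. cmod (z $ j))" unfolding norm_vec_def by (rule L2_set_le_sum) simp
  also have "\<dots> \<le> CARD('n) * supnorm z" by (rule sum_bounded_above[of UNIV, simplified]) (rule nth_le_supnorm)
  finally show ?thesis .
qed

lemma supnorm_triangle: "supnorm (z + w) \<le> supnorm z + supnorm w"
  by (auto simp: supnorm_le_iff intro: order_trans[OF norm_triangle_ineq] add_mono nth_le_supnorm)

lemma supnorm_minus: "supnorm (- z) = supnorm z"
  by (simp add: supnorm_def)

lemma supnorm_0 [simp]: "supnorm 0 = 0"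
  by (simp add: supnorm_def)

lemma supnorm_cscale: "supnorm (c *s z) = cmod c * supnorm z"
proof (rule antisym)
  show "supnorm (c *s z) \<le> cmod c * supnorm z"
    by (simp add: supnorm_le_iff norm_mult mult_left_mono nth_le_supnorm)
  have "supnorm z \<in> range (\<lambda>j. cmod (z $ j))"
    unfolding supnorm_def by (rule Max_in) auto
  then obtain j where "supnorm z = cmod (z $ j)" by blast
  then show "cmod c * supnorm z \<le> supnorm (c *s z)"
    using nth_le_supnorm[of "c *s z" j] by (simp add: norm_mult)
qed

lemma supnorm_scaleR: "supnorm (t *\<^sub>R z) = \<bar>t\<bar> * supnorm z"
  by (simp only: of_real_cscale[symmetric] supnorm_cscale norm_of_real)

lemma supnorm_eq_0: "supnorm z = 0 \<longleftrightarrow> z = 0"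
  using norm_le_supnorm[of z] by auto

lemma continuous_on_supnorm [continuous_intros]:
  fixes g :: "'b::topological_space \<Rightarrow> complex^'n::finite"
  assumes "continuous_on S g"
  shows "continuous_on S (\<lambda>x. supnorm (g x))"
proof -
  have "\<bar>supnorm z - supnorm w\<bar> \<le> norm (z - w)" for z w :: "complex^'n"
    using supnorm_triangle[of "z - w" w] supnorm_triangle[of "w - z" z]
      supnorm_le_norm[of "z - w"] supnorm_le_norm[of "w - z"] by (simp add: norm_minus_commute)
  then have "1-lipschitz_on UNIV (supnorm :: complex^'n \<Rightarrow> real)"
    by (intro lipschitz_onI) (auto simp: dist_norm)
  then show ?thesis
    using assms lipschitz_on_continuous_on continuous_on_compose2 by blast
qed

lemma open_polydisc: "open (polydisc r :: (complex^'n::finite) set)"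
proof -
  have "open {z::complex^'n. supnorm z < r}" by (intro open_Collect_less continuous_intros)
  moreover have "polydisc r = {z::complex^'n. supnorm z < r}" by (auto simp: polydisc_iff)
  ultimately show ?thesis by simp
qed

lemma convex_polydisc: "convex (polydisc r :: (complex^'n::finite) set)"
proof (rule convexI)
  fix z w :: "complex^'n" and u v :: real
  assume "z \<in> polydisc r" "w \<in> polydisc r" "0 \<le> u" "0 \<le> v" "u + v = 1"
  moreover have "supnorm (u *\<^sub>R z + v *\<^sub>R w) \<le> u * supnorm z + v * supnorm w" if "0 \<le> u" "0 \<le> v"
    using supnorm_triangle[of "u *\<^sub>R z" "v *\<^sub>R w"] that by (simp flip: of_real_cscale add: supnorm_cscale)
  moreover have "u * supnorm z + v * supnorm w < r" if "supnorm z < r" "supnorm w < r" "0 \<le> u" "0 \<le> v" "u + v = 1"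
    using convex_bound_lt[OF that] by simp
  ultimately show "u *\<^sub>R z + v *\<^sub>R w \<in> polydisc r" by (auto simp: polydisc_iff)
qed

lemma zero_in_polydisc: "0 < r \<Longrightarrow> 0 \<in> polydisc r"
  by (simp add: polydisc_iff)

lemma compact_supnorm_le: "compact {z :: complex^'n::finite. supnorm z \<le> r}"
  unfolding compact_eq_bounded_closed
proof
  show "bounded {z :: complex^'n. supnorm z \<le> r}"
    unfolding bounded_iff
  proof (intro exI ballI)
    fix z :: "complex^'n" assume "z \<in> {z. supnorm z \<le> r}"
    then show "norm z \<le> CARD('n) * r"
      by (intro order_trans[OF norm_le_supnorm]) (simp add: mult_left_mono)
  qed
  show "closed {z :: complex^'n. supnorm z \<le> r}"
    by (intro closed_Collect_le continuous_intros)
qed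

lemma open_contains_polydisc:
  assumes "open S" "(0 :: complex^'n::finite) \<in> S"
  obtains r where "r > 0" "polydisc r \<subseteq> S"
proof -
  obtain e where e: "e > 0" "ball 0 e \<subseteq> S" using assms openE by blast
  have "polydisc (e / CARD('n)) \<subseteq> ball (0 :: complex^'n) e"
  proof
    fix z :: "complex^'n" assume "z \<in> polydisc (e / CARD('n))"
    then show "z \<in> ball 0 e" using norm_le_supnorm[of z]
      by (simp add: polydisc_iff field_simps)
  qed
  then show ?thesis using e by (intro that[of "e / CARD('n)"]) auto
qed

section \<open>Holomorphic functions on a manifold\<close>

lemma atlas_chart:
  fixes A :: "('a::topological_space, 'n::finite) chart set"
  assumes "complex_atlas A" "(U, \<phi>) \<in> A"
  shows "open U" "open (\<phi> ` U)" "continuous_on U \<phi>" "continuous_on (\<phi> ` U) (inv_into U \<phi>)"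
    "\<And>x. x \<in> U \<Longrightarrow> inv_into U \<phi> (\<phi> x) = x"
    "\<And>V. open V \<Longrightarrow> open (\<phi> ` (U \<inter> V))"
proof -
  have *: "open U" "open (\<phi> ` U)" "homeomorphism U (\<phi> ` U) \<phi> (inv_into U \<phi>)"
    using assms unfolding complex_atlas_def by blast+
  then show "open U" "open (\<phi> ` U)" "continuous_on U \<phi>" "continuous_on (\<phi> ` U) (inv_into U \<phi>)"
    "\<And>x. x \<in> U \<Longrightarrow> inv_into U \<phi> (\<phi> x) = x"
    by (auto simp: homeomorphism_def)
  fix V :: "'a set" assume "open V"
  have "openin (top_of_set U) (U \<inter> V)" using \<open>open V\<close> by (auto simp: openin_open)
  then have "openin (top_of_set (\<phi> ` U)) (\<phi> ` (U \<inter> V))"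
    by (rule homeomorphism_imp_open_map[OF *(3)])
  then show "open (\<phi> ` (U \<inter> V))" using *(2) by (simp add: openin_open_eq)
qed

lemma atlas_transition:
  assumes "complex_atlas A" "(U, \<phi>) \<in> A" "(V, \<psi>) \<in> A"
  shows "hol_map_on (\<lambda>z. \<psi> (inv_into U \<phi> z)) (\<phi> ` (U \<inter> V))"
  using assms unfolding complex_atlas_def by blast

lemma atlas_cover:
  assumes "complex_atlas A"
  obtains U \<phi> where "(U, \<phi>) \<in> A" "x \<in> U"
proof -
  have "x \<in> (\<Union>(U, \<phi>)\<in>A. U)" using assms unfolding complex_atlas_def by simp
  then show ?thesis using that by auto
qed

lemma hol_functionsD:
  "f \<in> hol_functions A S \<Longrightarrow> (U, \<phi>) \<in> A \<Longrightarrow> hol_on (\<lambda>z. f (inv_into U \<phi> z)) (\<phi> ` (U \<inter> S))"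
  unfolding hol_functions_def by blast

lemma hol_functions_mult:
  "f \<in> hol_functions A S \<Longrightarrow> g \<in> hol_functions A S \<Longrightarrow> (\<lambda>x. f x * g x) \<in> hol_functions A S"
  unfolding hol_functions_def by (auto intro!: hol_on_mult)

lemma hol_functions_const: "(\<lambda>x. c) \<in> hol_functions A S"
  unfolding hol_functions_def by auto

lemma hol_functions_power:
  "f \<in> hol_functions A S \<Longrightarrow> (\<lambda>x. f x ^ k) \<in> hol_functions A S"
  by (induction k) (auto intro: hol_functions_mult hol_functions_const)

lemma hol_functions_subset:
  "f \<in> hol_functions A S \<Longrightarrow> T \<subseteq> S \<Longrightarrow> f \<in> hol_functions A T"
  unfolding hol_functions_def by (fast intro: hol_on_subset)

text \<open>Transports functions constructed on a polydisc to the manifold; \<open>\<alpha>\<close>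
  will be the local coordinates obtained by integrating the frame.\<close>

lemma hol_functions_compose:
  assumes "complex_atlas A" "\<And>j. (\<lambda>x. \<alpha> x $ j) \<in> hol_functions A S" "hol_on G W" "\<alpha> ` S \<subseteq> W"
  shows "(\<lambda>x. G (\<alpha> x)) \<in> hol_functions A S"
  unfolding hol_functions_def
proof (intro CollectI ballI, clarify)
  fix U \<phi> assume c: "(U, \<phi>) \<in> A"
  show "hol_on (\<lambda>z. G (\<alpha> (inv_into U \<phi> z))) (\<phi> ` (U \<inter> S))"
  proof (rule hol_on_compose[OF _ assms(3)])
    show "hol_map_on (\<lambda>z. \<alpha> (inv_into U \<phi> z)) (\<phi> ` (U \<inter> S))"
      unfolding hol_map_on_def using hol_functionsD[OF assms(2) c] by blast
    show "(\<lambda>z. \<alpha> (inv_into U \<phi> z)) ` \<phi> ` (U \<inter> S) \<subseteq> W"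
      using assms(4) atlas_chart(5)[OF assms(1) c] by auto
  qed
qed

lemma hol_functions_local:
  assumes "complex_atlas A" "open S"
    and "\<And>x. x \<in> S \<Longrightarrow> \<exists>N v. open N \<and> x \<in> N \<and> v \<in> hol_functions A N \<and> (\<forall>y\<in>N \<inter> S. u y = v y)"
  shows "u \<in> hol_functions A S"
  unfolding hol_functions_def
proof (intro CollectI ballI, clarify, rule hol_on_local)
  fix U \<phi> z assume c: "(U, \<phi>) \<in> A" and "z \<in> \<phi> ` (U \<inter> S)"
  then obtain x where x: "x \<in> U" "x \<in> S" "z = \<phi> x" by blast
  obtain N v where N: "open N" "x \<in> N" and v: "v \<in> hol_functions A N" "\<forall>y\<in>N \<inter> S. u y = v y"
    using assms(3)[OF x(2)] by blast
  have op: "open (\<phi> ` (U \<inter> (N \<inter> S)))"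
    by (intro atlas_chart(6)[OF assms(1) c] open_Int N assms)
  note inv = atlas_chart(5)[OF assms(1) c]
  have "hol_on (\<lambda>z. u (inv_into U \<phi> z)) (\<phi> ` (U \<inter> (N \<inter> S)))"
  proof (rule hol_on_cong[OF op])
    show "hol_on (\<lambda>z. v (inv_into U \<phi> z)) (\<phi> ` (U \<inter> (N \<inter> S)))"
      by (rule hol_on_subset[OF hol_functionsD[OF v(1) c]]) auto
  qed (use v(2) inv in auto)
  then show "\<exists>T. open T \<and> z \<in> T \<and> hol_on (\<lambda>z. u (inv_into U \<phi> z)) (\<phi> ` (U \<inter> S) \<inter> T)"
    using op x N by (intro exI[of _ "\<phi> ` (U \<inter> (N \<inter> S))"]) (auto elim!: hol_on_subset)
qed

lemma hol_functions_imp_continuous_on: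
  fixes A :: "('a::t2_space, 'n::finite) chart set"
  assumes "complex_atlas A" "open S" "f \<in> hol_functions A S"
  shows "continuous_on S f"
proof (rule continuous_at_imp_continuous_on, rule ballI)
  fix x assume x: "x \<in> S"
  obtain U \<phi> where c: "(U, \<phi>) \<in> A" "x \<in> U" using atlas_cover[OF assms(1)] by blast
  note ch = atlas_chart[OF assms(1) c(1)]
  have "continuous_on (U \<inter> S) (\<lambda>x. f (inv_into U \<phi> (\<phi> x)))"
    by (rule continuous_on_compose2[OF hol_on_imp_continuous_on[OF hol_functionsD[OF assms(3) c(1)]]])
      (use continuous_on_subset[OF ch(3)] in auto)
  then have "continuous_on (U \<inter> S) f"
    by (rule continuous_on_eq) (simp add: ch(5))
  then show "isCont f x"
    using x c ch(1) assms(2) by (simp add: continuous_on_eq_continuous_at open_Int)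
qed

text \<open>Continuity of \<open>\<Phi>\<close> makes preimages of charts open, and on each of them
  the composite factors through the chart, where the chain rule applies.\<close>

lemma hol_into_compose:
  assumes "complex_atlas A" "hol_into A S \<Phi>" "u \<in> hol_functions A \<Omega>" "open S" "open \<Omega>"
  shows "hol_on (\<lambda>\<zeta>. u (\<Phi> \<zeta>)) {\<zeta>\<in>S. \<Phi> \<zeta> \<in> \<Omega>}"
proof (rule hol_on_local)
  fix \<zeta> assume \<zeta>: "\<zeta> \<in> {\<zeta>\<in>S. \<Phi> \<zeta> \<in> \<Omega>}"
  obtain U \<phi> where c: "(U, \<phi>) \<in> A" "\<Phi> \<zeta> \<in> U" using atlas_cover[OF assms(1)] by blast
  note ch = atlas_chart[OF assms(1) c(1)]
  have cont: "continuous_on S \<Phi>" and hol: "hol_map_on (\<lambda>\<zeta>. \<phi> (\<Phi> \<zeta>)) {\<zeta>\<in>S. \<Phi> \<zeta> \<in> U}"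
    using assms(2) c(1) unfolding hol_into_def by blast+
  define T where "T = S \<inter> \<Phi> -` (U \<inter> \<Omega>)"
  have T: "open T" unfolding T_def by (intro continuous_open_preimage cont assms ch open_Int)
  have "hol_on (\<lambda>\<zeta>. u (inv_into U \<phi> (\<phi> (\<Phi> \<zeta>)))) T"
    by (rule hol_on_compose[OF _ hol_functionsD[OF assms(3) c(1)]])
      (use hol in \<open>auto simp: T_def hol_map_on_def elim!: hol_on_subset\<close>)
  then have "hol_on (\<lambda>\<zeta>. u (\<Phi> \<zeta>)) T"
    by (rule hol_on_cong[OF T, rotated]) (simp add: T_def ch(5))
  then show "\<exists>T. open T \<and> \<zeta> \<in> T \<and> hol_on (\<lambda>\<zeta>. u (\<Phi> \<zeta>)) ({\<zeta>\<in>S. \<Phi> \<zeta> \<in> \<Omega>} \<inter> T)"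
    using T \<zeta> c by (intro exI[of _ T]) (auto simp: T_def elim!: hol_on_subset)
qed

section \<open>Maps with \<open>\<Phi>\<^sup>*\<omega>\<^sup>j = d\<zeta>\<^sup>j\<close>\<close>

text \<open>The condition of \<^const>\<open>is_phi\<close> on arbitrary sets instead of centred polydiscs, so that it can be
  translated and glued.\<close>

definition developing ::
    "('a::topological_space, 'n::finite) chart set \<Rightarrow> ('n \<Rightarrow> ('a, 'n) form) \<Rightarrow> (complex^'n) set \<Rightarrow>
      (complex^'n \<Rightarrow> 'a) \<Rightarrow> bool" where
  "developing A \<omega> S \<Phi> \<longleftrightarrow> hol_into A S \<Phi> \<and>
    (\<forall>(U, \<phi>)\<in>A. \<forall>\<zeta>\<in>S. \<Phi> \<zeta> \<in> U \<longrightarrow>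
      (\<forall>j k. pullback_coeff (\<omega> j) \<Phi> (U, \<phi>) \<zeta> k = (if j = k then 1 else 0)))"

lemma is_phi_iff_developing: "is_phi A \<omega> a \<rho> \<Phi> \<longleftrightarrow> developing A \<omega> (polydisc \<rho>) \<Phi> \<and> \<Phi> 0 = a"
  unfolding is_phi_def developing_def by blast

locale closed_coframe =
  fixes A :: "('a::t2_space, 'n::finite) chart set" and \<omega> :: "'n \<Rightarrow> ('a, 'n) form"
  assumes cond_A: "cond_A A \<omega>"
begin

lemma atlas: "complex_atlas A"
  using cond_A by (simp add: cond_A_def)

text \<open>Here \<open>\<alpha>\<close> is the map \<open>y \<mapsto> (\<integral>\<^sub>x\<^sup>y \<omega>\<^sup>1, \<dots>, \<integral>\<^sub>x\<^sup>y \<omega>\<^sup>n)\<close>.\<close>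

lemma local_coordinates:
  assumes "open G" "x \<in> G"
  obtains r0 N \<alpha> \<Phi> where "0 < r0"
    "\<And>r. 0 < r \<Longrightarrow> r \<le> r0 \<Longrightarrow> open (N r) \<and> x \<in> N r \<and> N r \<subseteq> G \<and> homeomorphism (N r) (polydisc r) \<alpha> \<Phi>"
    "\<Phi> 0 = x" "developing A \<omega> (polydisc r0) \<Phi>"
    "\<And>j. (\<lambda>y. \<alpha> y $ j) \<in> hol_functions A (N r0)"
    "\<And>S \<Psi> \<zeta>. open S \<Longrightarrow> developing A \<omega> S \<Psi> \<Longrightarrow> \<zeta> \<in> S \<Longrightarrow> \<Psi> \<zeta> \<in> N r0 \<Longrightarrow>
      ((\<lambda>\<xi>. \<alpha> (\<Psi> \<xi>)) has_derivative (\<lambda>v. v)) (at \<zeta>)"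
proof -
  obtain U0 \<phi>0 where c: "(U0, \<phi>0) \<in> A" "x \<in> U0" using atlas_cover[OF atlas] by blast
  note ch = atlas_chart[OF atlas c(1)]
  define z0 where "z0 = \<phi>0 x"
  have "z0 \<in> \<phi>0 ` (U0 \<inter> G)" using c assms by (auto simp: z0_def)
  then obtain R where R: "R > 0" "ball z0 R \<subseteq> \<phi>0 ` (U0 \<inter> G)"
    using ch(6)[OF assms(1)] openE by blast
  have form: "hol_form A (\<omega> j)" "closed_form A (\<omega> j)" for j
    using cond_A by (auto simp: cond_A_def cotangent_frame_def)
  \<comment> \<open>Closedness yields primitives \<open>h j\<close> of the frame in one chart;
    together they form \<open>F\<close>, the chart expression of \<open>\<alpha>\<close>.\<close>
  have "\<exists>h. hol_on h (ball z0 R) \<and> h z0 = 0 \<and> (\<forall>z\<in>ball z0 R. \<forall>k. cpartial k h z = \<omega> j (U0, \<phi>0) z $ k)" for j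
  proof -
    have "hol_map_on (\<omega> j (U0, \<phi>0)) (\<phi>0 ` U0)" using form(1)[of j] c(1) by (auto simp: hol_form_def)
    then have 1: "hol_map_on (\<omega> j (U0, \<phi>0)) (ball z0 R)"
      using R(2) unfolding hol_map_on_def by (blast intro: hol_on_subset)
    have 2: "cpartial k (\<lambda>w. \<omega> j (U0, \<phi>0) w $ l) z = cpartial l (\<lambda>w. \<omega> j (U0, \<phi>0) w $ k) z"
      if "z \<in> ball z0 R" for z k l
    proof -
      have "z \<in> \<phi>0 ` U0" using that R(2) by blast
      then have "ext_deriv (\<omega> j) (U0, \<phi>0) z k l = 0"
        using form(2)[of j] c(1) by (auto simp: closed_form_def)
      then show ?thesis by (simp add: ext_deriv_def)
    qed
    show ?thesis by (rule closed_form_primitive[OF 1 2]) blast+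
  qed
  then obtain h where h: "\<And>j. hol_on (h j) (ball z0 R)" "\<And>j. h j z0 = 0"
    "\<And>j k z. z \<in> ball z0 R \<Longrightarrow> cpartial k (h j) z = \<omega> j (U0, \<phi>0) z $ k" by metis
  define F where "F z = (\<chi> j. h j z)" for z
  have F: "hol_map_on F (ball z0 R)" using h(1) by (simp add: hol_map_on_def F_def)
  have z0: "z0 \<in> ball z0 R" using R by simp
  have "v = 0" if v: "\<And>j. (\<Sum>l\<in>UNIV. v $ l * cpartial l (\<lambda>z. F z $ j) z0) = 0" for v
  proof -
    have "v $ i = 0" for i
    proof -
      have "z0 \<in> \<phi>0 ` U0" using c by (auto simp: z0_def)
      \<comment> \<open>The frame spans the fibre, so the covector that reads off coordinate
        \<open>i\<close> is a combination of the \<open>\<omega> j\<close>, each of which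
        annihilates \<open>v\<close>.\<close>
      then obtain t :: "complex^'n" where t: "axis i 1 = (\<Sum>j\<in>UNIV. t $ j *s \<omega> j (U0, \<phi>0) z0)"
        using cond_A c(1) unfolding cond_A_def cotangent_frame_def by (fast dest: ex1_implies_ex)
      have "v $ i = (\<Sum>l\<in>UNIV. if l = i then v $ l else 0)" by simp
      also have "\<dots> = (\<Sum>l\<in>UNIV. v $ l * axis i 1 $ l)" by (intro sum.cong) (auto simp: axis_def)
      also have "\<dots> = (\<Sum>l\<in>UNIV. \<Sum>j\<in>UNIV. t $ j * (v $ l * \<omega> j (U0, \<phi>0) z0 $ l))"
        unfolding t by (simp add: sum_distrib_left mult.left_commute)
      also have "\<dots> = (\<Sum>j\<in>UNIV. t $ j * (\<Sum>l\<in>UNIV. v $ l * \<omega> j (U0, \<phi>0) z0 $ l))"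
        by (subst sum.swap) (simp add: sum_distrib_left)
      also have "\<dots> = 0"
        using v by (simp add: F_def h(3)[OF z0])
      finally show ?thesis .
    qed
    then show "v = 0" by (simp add: vec_eq_iff)
  qed
  then obtain U V \<beta> where U: "open U" "z0 \<in> U" "U \<subseteq> ball z0 R" and V: "open V" "F z0 \<in> V"
    and hom: "homeomorphism U V F \<beta>" and \<beta>: "hol_map_on \<beta> V"
    using hol_inverse_function[OF open_ball z0 F] by metis
  have F0: "F z0 = 0" by (simp add: F_def h(2) vec_eq_iff)
  obtain r0 where r0: "r0 > 0" "polydisc r0 \<subseteq> V"
    using open_contains_polydisc[OF V(1)] V(2) F0 by metis
  \<comment> \<open>All \<open>N r\<close> share the same \<open>\<alpha>\<close> and
    \<open>\<Phi>\<close>, so a neighbourhood can later be shrunk without changing the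
    coordinates.\<close>
  define N where "N r = U0 \<inter> \<phi>0 -` (U \<inter> F -` polydisc r)" for r
  define \<alpha> where "\<alpha> y = F (\<phi>0 y)" for y
  define \<Phi> where "\<Phi> \<zeta> = inv_into U0 \<phi>0 (\<beta> \<zeta>)" for \<zeta>
  have U0: "U \<subseteq> \<phi>0 ` (U0 \<inter> G)" using U(3) R(2) by blast
  have \<beta>U: "\<beta> \<zeta> \<in> U" "F (\<beta> \<zeta>) = \<zeta>" if "\<zeta> \<in> V" for \<zeta>
    using hom that by (auto simp: homeomorphism_def)
  have \<Phi>U: "\<Phi> \<zeta> \<in> U0" "\<Phi> \<zeta> \<in> G" "\<phi>0 (\<Phi> \<zeta>) = \<beta> \<zeta>" if \<zeta>: "\<zeta> \<in> V" for \<zeta>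
  proof -
    obtain y where "y \<in> U0" "y \<in> G" "\<beta> \<zeta> = \<phi>0 y" using \<beta>U(1)[OF \<zeta>] U0 by blast
    then show "\<Phi> \<zeta> \<in> U0" "\<Phi> \<zeta> \<in> G" "\<phi>0 (\<Phi> \<zeta>) = \<beta> \<zeta>" by (simp_all add: \<Phi>_def ch(5))
  qed
  have contF: "continuous_on U F" and cont\<beta>: "continuous_on V \<beta>"
    using hom by (auto simp: homeomorphism_def)
  have cont\<Phi>: "continuous_on V \<Phi>"
    unfolding \<Phi>_def by (rule continuous_on_compose2[OF ch(4) cont\<beta>]) (use \<beta>U(1) U0 in blast)
  have N: "open (N r)" for r
    unfolding N_def
    by (intro continuous_open_preimage ch continuous_open_preimage[OF contF] U open_polydisc)
  show ?thesis
  proof (rule that[of r0 N \<alpha> \<Phi>])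
    show "0 < r0" by fact
    show \<Phi>0: "\<Phi> 0 = x"
    proof -
      have "\<beta> 0 = z0" using hom U(2) F0 by (metis homeomorphism_apply1)
      then show ?thesis by (simp add: \<Phi>_def z0_def ch(5) c)
    qed
    show "open (N r) \<and> x \<in> N r \<and> N r \<subseteq> G \<and> homeomorphism (N r) (polydisc r) \<alpha> \<Phi>"
      if r: "0 < r" "r \<le> r0" for r
    proof (intro conjI)
      show "open (N r)" by (rule N)
      show "x \<in> N r" using c U(2) F0 r by (simp add: N_def z0_def[symmetric] zero_in_polydisc)
      show "N r \<subseteq> G"
      proof
        fix y assume "y \<in> N r"
        then have "y \<in> U0" "\<phi>0 y \<in> \<phi>0 ` (U0 \<inter> G)" using U0 by (auto simp: N_def)
        then show "y \<in> G" using ch(5) by (metis IntE imageE)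
      qed
      have rV: "polydisc r \<subseteq> V" using r0(2) r(2) by (force simp: polydisc_iff)
      show "homeomorphism (N r) (polydisc r) \<alpha> \<Phi>"
      proof (rule homeomorphismI)
        show "continuous_on (N r) \<alpha>"
          unfolding \<alpha>_def by (rule continuous_on_compose2[OF contF continuous_on_subset[OF ch(3)]]) (auto simp: N_def)
        show "continuous_on (polydisc r) \<Phi>" by (rule continuous_on_subset[OF cont\<Phi> rV])
        show "\<alpha> ` N r \<subseteq> polydisc r" by (auto simp: \<alpha>_def N_def)
        show "\<Phi> ` polydisc r \<subseteq> N r" using rV \<beta>U \<Phi>U by (auto simp: N_def subset_iff)
        show "\<Phi> (\<alpha> y) = y" if "y \<in> N r" for y
          using that homeomorphism_apply1[OF hom] by (auto simp: N_def \<Phi>_def \<alpha>_def ch(5))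
        show "\<alpha> (\<Phi> \<zeta>) = \<zeta>" if "\<zeta> \<in> polydisc r" for \<zeta>
          using that rV \<beta>U \<Phi>U by (auto simp: \<alpha>_def)
      qed
    qed
    have NU: "N r0 \<subseteq> U0" "\<And>y. y \<in> N r0 \<Longrightarrow> \<phi>0 y \<in> ball z0 R"
      using U(3) by (auto simp: N_def)
    show "(\<lambda>y. \<alpha> y $ j) \<in> hol_functions A (N r0)" for j
      unfolding hol_functions_def \<alpha>_def
    proof (intro CollectI ballI, clarify)
      fix W \<eta> assume W: "(W, \<eta>) \<in> A"
      note chW = atlas_chart[OF atlas W]
      show "hol_on (\<lambda>z. F (\<phi>0 (inv_into W \<eta> z)) $ j) (\<eta> ` (W \<inter> N r0))"
      proof (rule hol_on_compose[of "\<lambda>z. \<phi>0 (inv_into W \<eta> z)" _ "\<lambda>z. F z $ j" "ball z0 R"])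
        show "hol_map_on (\<lambda>z. \<phi>0 (inv_into W \<eta> z)) (\<eta> ` (W \<inter> N r0))"
          by (rule hol_map_on_subset[OF atlas_transition[OF atlas W c(1)]]) (use NU(1) in blast)
        show "hol_on (\<lambda>z. F z $ j) (ball z0 R)" using F by (simp add: hol_map_on_def)
        show "(\<lambda>z. \<phi>0 (inv_into W \<eta> z)) ` \<eta> ` (W \<inter> N r0) \<subseteq> ball z0 R"
          using NU(2) chW(5) by auto
      qed
    qed
    \<comment> \<open>In a chart \<open>W\<close>, the chain rule and the transformation law of the
      form lead back to the chart \<open>U0\<close>, where \<open>\<omega> j\<close> is the
      differential of \<open>F $ j\<close>. As \<open>F\<close> inverts \<open>\<beta>\<close>, the
      pullback is the differential of the coordinate \<open>\<zeta> $ j\<close>.\<close>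
    show "developing A \<omega> (polydisc r0) \<Phi>"
      unfolding developing_def hol_into_def
    proof (intro conjI ballI; clarify?)
      show "continuous_on (polydisc r0) \<Phi>" by (rule continuous_on_subset[OF cont\<Phi> r0(2)])
    next
      fix W \<eta> assume W: "(W, \<eta>) \<in> A"
      define S where "S = {\<zeta> \<in> polydisc r0. \<Phi> \<zeta> \<in> W}"
      have SV: "S \<subseteq> V" using r0(2) by (auto simp: S_def)
      have \<beta>S: "hol_map_on \<beta> S" using \<beta> SV unfolding hol_map_on_def by (blast intro: hol_on_subset)
      have im: "\<beta> ` S \<subseteq> \<phi>0 ` (U0 \<inter> W)"
        using SV \<Phi>U(1,3) unfolding S_def by (force simp: image_iff)
      have tr: "hol_on (\<lambda>z. \<eta> (inv_into U0 \<phi>0 z) $ l) (\<phi>0 ` (U0 \<inter> W))" for l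
        using atlas_transition[OF atlas c(1) W] by (simp add: hol_map_on_def)
      show "hol_map_on (\<lambda>\<zeta>. \<eta> (\<Phi> \<zeta>)) {\<zeta> \<in> polydisc r0. \<Phi> \<zeta> \<in> W}"
        unfolding hol_map_on_def \<Phi>_def S_def[symmetric, unfolded \<Phi>_def]
        by (intro allI hol_on_compose[OF \<beta>S tr im])
      fix \<zeta> j k assume "\<zeta> \<in> polydisc r0" "\<Phi> \<zeta> \<in> W"
      then have \<zeta>: "\<zeta> \<in> S" "\<zeta> \<in> V" using SV by (auto simp: S_def)
      have x: "\<Phi> \<zeta> \<in> U0 \<inter> W" using \<zeta> \<Phi>U by (auto simp: S_def)
      have "pullback_coeff (\<omega> j) \<Phi> (W, \<eta>) \<zeta> k =
        (\<Sum>l\<in>UNIV. \<omega> j (W, \<eta>) (\<eta> (\<Phi> \<zeta>)) $ l *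
          (\<Sum>m\<in>UNIV. cpartial m (\<lambda>z. \<eta> (inv_into U0 \<phi>0 z) $ l) (\<beta> \<zeta>) * cpartial k (\<lambda>\<zeta>. \<beta> \<zeta> $ m) \<zeta>))"
        unfolding pullback_coeff_def snd_conv
        by (intro sum.cong refl arg_cong2[where f = "(*)"])
           (use cpartial_chain[OF \<beta>S tr im \<zeta>(1)] in \<open>simp add: \<Phi>_def\<close>)
      also have "\<dots> = (\<Sum>m\<in>UNIV. (\<Sum>l\<in>UNIV. \<omega> j (W, \<eta>) (\<eta> (\<Phi> \<zeta>)) $ l *
          cpartial m (\<lambda>z. \<eta> (inv_into U0 \<phi>0 z) $ l) (\<phi>0 (\<Phi> \<zeta>))) * cpartial k (\<lambda>\<zeta>. \<beta> \<zeta> $ m) \<zeta>)"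
        unfolding sum_distrib_left sum_distrib_right
        by (subst sum.swap) (simp add: \<Phi>U(3)[OF \<zeta>(2)] mult.assoc)
      also have "\<dots> = (\<Sum>m\<in>UNIV. \<omega> j (U0, \<phi>0) (\<phi>0 (\<Phi> \<zeta>)) $ m * cpartial k (\<lambda>\<zeta>. \<beta> \<zeta> $ m) \<zeta>)"
      proof -
        have "\<forall>k. \<omega> j (U0, \<phi>0) (\<phi>0 (\<Phi> \<zeta>)) $ k =
          (\<Sum>l\<in>UNIV. \<omega> j (W, \<eta>) (\<eta> (\<Phi> \<zeta>)) $ l * cpartial k (\<lambda>z. \<eta> (inv_into U0 \<phi>0 z) $ l) (\<phi>0 (\<Phi> \<zeta>)))"
          using form(1)[of j] c(1) W x unfolding hol_form_def by fast
        then show ?thesis by simp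
      qed
      also have "\<dots> = (\<Sum>m\<in>UNIV. cpartial m (\<lambda>z. F z $ j) (\<beta> \<zeta>) * cpartial k (\<lambda>\<zeta>. \<beta> \<zeta> $ m) \<zeta>)"
        using h(3) U(3) \<beta>U(1)[OF \<zeta>(2)] by (simp add: F_def \<Phi>U(3)[OF \<zeta>(2)] subset_iff)
      also have "\<dots> = cpartial k (\<lambda>\<zeta>. F (\<beta> \<zeta>) $ j) \<zeta>"
        by (rule cpartial_chain[OF \<beta>S, symmetric, of _ "ball z0 R"])
          (use F U(3) \<beta>U(1) SV \<zeta>(1) in \<open>auto simp: hol_map_on_def simp del: mem_ball\<close>)
      also have "\<dots> = cpartial k (\<lambda>\<zeta>. \<zeta> $ j) \<zeta>"
        by (rule cpartial_cong[OF V(1) \<zeta>(2)]) (simp add: \<beta>U)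
      finally show "pullback_coeff (\<omega> j) \<Phi> (W, \<eta>) \<zeta> k = (if j = k then 1 else 0)"
        by (simp add: cpartial_nth)
    qed
    \<comment> \<open>The components of \<open>\<alpha>\<close> are primitives of the
      \<open>\<omega> j\<close>, so the derivative of \<open>\<alpha> \<circ> \<Psi>\<close>
      consists of the pullback coefficients, which form the identity matrix.\<close>
    fix S \<Psi> \<zeta> assume S: "open S" "developing A \<omega> S \<Psi>" "\<zeta> \<in> S" "\<Psi> \<zeta> \<in> N r0"
    define T where "T = S \<inter> \<Psi> -` N r0"
    have cont: "continuous_on S \<Psi>" using S(2) by (simp add: developing_def hol_into_def)
    have T: "open T" "\<zeta> \<in> T"
      unfolding T_def using S continuous_open_preimage[OF cont S(1) N] by auto
    have holT: "hol_map_on (\<lambda>\<xi>. \<phi>0 (\<Psi> \<xi>)) T"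
    proof -
      have "hol_map_on (\<lambda>\<xi>. \<phi>0 (\<Psi> \<xi>)) {\<xi>\<in>S. \<Psi> \<xi> \<in> U0}"
        using S(2) c(1) unfolding developing_def hol_into_def by fast
      then show ?thesis
        by (rule hol_map_on_subset) (use NU(1) in \<open>auto simp: T_def\<close>)
    qed
    have imT: "(\<lambda>\<xi>. \<phi>0 (\<Psi> \<xi>)) ` T \<subseteq> ball z0 R" using NU(2) by (auto simp: T_def simp del: mem_ball)
    have Fj: "hol_on (\<lambda>z. F z $ j) (ball z0 R)" for j using F by (simp add: hol_map_on_def)
    have part: "cpartial k (\<lambda>\<xi>. F (\<phi>0 (\<Psi> \<xi>)) $ j) \<zeta> = (if j = k then 1 else 0)" for j k
    proof -
      have "cpartial k (\<lambda>\<xi>. F (\<phi>0 (\<Psi> \<xi>)) $ j) \<zeta>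
        = (\<Sum>l\<in>UNIV. cpartial l (\<lambda>z. F z $ j) (\<phi>0 (\<Psi> \<zeta>)) * cpartial k (\<lambda>\<xi>. \<phi>0 (\<Psi> \<xi>) $ l) \<zeta>)"
        by (rule cpartial_chain[OF holT Fj imT T(2)])
      also have "\<dots> = pullback_coeff (\<omega> j) \<Psi> (U0, \<phi>0) \<zeta> k"
        using h(3)[OF NU(2)[OF S(4)]] by (simp add: pullback_coeff_def F_def)
      also have "\<dots> = (if j = k then 1 else 0)"
        using S(2,3,4) c(1) NU(1) unfolding developing_def by fast
      finally show ?thesis .
    qed
    show "((\<lambda>\<xi>. \<alpha> (\<Psi> \<xi>)) has_derivative (\<lambda>v. v)) (at \<zeta>)"
      unfolding \<alpha>_def
    proof (rule has_derivative_vec_componentwise)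
      fix j
      have "((\<lambda>\<xi>. F (\<phi>0 (\<Psi> \<xi>)) $ j) has_derivative
        (\<lambda>v. \<Sum>k\<in>UNIV. v $ k * cpartial k (\<lambda>\<xi>. F (\<phi>0 (\<Psi> \<xi>)) $ j) \<zeta>)) (at \<zeta>)"
        by (rule hol_onD[OF hol_on_compose[OF holT Fj imT] T(2)])
      then show "((\<lambda>\<xi>. F (\<phi>0 (\<Psi> \<xi>)) $ j) has_derivative (\<lambda>v. v $ j)) (at \<zeta>)"
        by (simp add: part if_distrib[of "\<lambda>x. _ * x"] cong: if_cong)
    qed
  qed
qed

section \<open>Restriction, gluing, translation and uniqueness of developing maps\<close>

lemma developing_continuous_on: "developing A \<omega> S \<Phi> \<Longrightarrow> continuous_on S \<Phi>"
  by (simp add: developing_def hol_into_def)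

lemma developing_subset: "developing A \<omega> S \<Phi> \<Longrightarrow> T \<subseteq> S \<Longrightarrow> developing A \<omega> T \<Phi>"
  unfolding developing_def hol_into_def
  by (auto elim: continuous_on_subset simp: subset_iff elim!: hol_map_on_subset)

text \<open>Each condition involves only the germ of the map at a point, so a map may be glued from
  developing pieces.\<close>

lemma developing_local:
  assumes "\<And>\<zeta>. \<zeta> \<in> S \<Longrightarrow> \<exists>T \<Psi>. open T \<and> \<zeta> \<in> T \<and> developing A \<omega> T \<Psi> \<and> (\<forall>\<xi>\<in>T. \<Phi> \<xi> = \<Psi> \<xi>)"
  shows "developing A \<omega> S \<Phi>"
proof -
  have chart: "hol_map_on (\<lambda>\<zeta>. \<phi> (\<Phi> \<zeta>)) {\<zeta>\<in>S. \<Phi> \<zeta> \<in> U}" if c: "(U, \<phi>) \<in> A" for U \<phi>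
    unfolding hol_map_on_def
  proof (intro allI hol_on_local)
    fix j \<zeta> assume "\<zeta> \<in> {\<zeta>\<in>S. \<Phi> \<zeta> \<in> U}"
    then obtain T \<Psi> where T: "open T" "\<zeta> \<in> T" "developing A \<omega> T \<Psi>" "\<And>\<xi>. \<xi> \<in> T \<Longrightarrow> \<Phi> \<xi> = \<Psi> \<xi>"
      and U: "\<Phi> \<zeta> \<in> U" using assms[of \<zeta>] by auto
    have op: "open (T \<inter> \<Psi> -` U)"
      by (rule continuous_open_preimage[OF developing_continuous_on[OF T(3)] T(1) atlas_chart(1)[OF atlas c]])
    have "hol_map_on (\<lambda>\<zeta>. \<phi> (\<Psi> \<zeta>)) {\<zeta>\<in>T. \<Psi> \<zeta> \<in> U}"
      using T(3) c unfolding developing_def hol_into_def by fast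
    then have "hol_on (\<lambda>\<zeta>. \<phi> (\<Psi> \<zeta>) $ j) (T \<inter> \<Psi> -` U)"
      unfolding hol_map_on_def by (auto elim!: hol_on_subset dest!: spec[of _ j])
    then have "hol_on (\<lambda>\<zeta>. \<phi> (\<Phi> \<zeta>) $ j) (T \<inter> \<Psi> -` U)"
      by (rule hol_on_cong[OF op, rotated]) (simp add: T(4))
    then show "\<exists>T. open T \<and> \<zeta> \<in> T \<and> hol_on (\<lambda>\<zeta>. \<phi> (\<Phi> \<zeta>) $ j) ({\<zeta> \<in> S. \<Phi> \<zeta> \<in> U} \<inter> T)"
      using op T U by (intro exI[of _ "T \<inter> \<Psi> -` U"]) (auto elim!: hol_on_subset)
  qed
  have pull: "pullback_coeff (\<omega> j) \<Phi> (U, \<phi>) \<zeta> k = (if j = k then 1 else 0)"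
    if c: "(U, \<phi>) \<in> A" and \<zeta>: "\<zeta> \<in> S" "\<Phi> \<zeta> \<in> U" for U \<phi> \<zeta> j k
  proof -
    obtain T \<Psi> where T: "open T" "\<zeta> \<in> T" "developing A \<omega> T \<Psi>" "\<And>\<xi>. \<xi> \<in> T \<Longrightarrow> \<Phi> \<xi> = \<Psi> \<xi>"
      using assms[OF \<zeta>(1)] by auto
    have "cpartial k (\<lambda>\<xi>. \<phi> (\<Phi> \<xi>) $ l) \<zeta> = cpartial k (\<lambda>\<xi>. \<phi> (\<Psi> \<xi>) $ l) \<zeta>" for l
      by (rule cpartial_cong[OF T(1,2)]) (simp add: T(4))
    then have "pullback_coeff (\<omega> j) \<Phi> (U, \<phi>) \<zeta> k = pullback_coeff (\<omega> j) \<Psi> (U, \<phi>) \<zeta> k"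
      using T(2,4) by (simp add: pullback_coeff_def)
    also have "\<dots> = (if j = k then 1 else 0)"
      using T(2,3,4) c \<zeta>(2) unfolding developing_def by fastforce
    finally show ?thesis .
  qed
  have cont: "continuous_on S \<Phi>"
  proof (rule continuous_at_imp_continuous_on, rule ballI)
    fix \<zeta> assume "\<zeta> \<in> S"
    then obtain T \<Psi> where T: "open T" "\<zeta> \<in> T" "developing A \<omega> T \<Psi>" "\<And>\<xi>. \<xi> \<in> T \<Longrightarrow> \<Phi> \<xi> = \<Psi> \<xi>"
      using assms[of \<zeta>] by auto
    have "continuous_on T \<Phi>" by (rule continuous_on_eq[OF developing_continuous_on[OF T(3)]]) (simp add: T(4))
    then show "isCont \<Phi> \<zeta>" using T(1,2) by (simp add: continuous_on_eq_continuous_at)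
  qed
  show ?thesis
    unfolding developing_def hol_into_def using cont chart pull by blast
qed

text \<open>The differentials of the coordinates are invariant under translations. Recentring a map
  at another point of its domain rests on this.\<close>

lemma developing_translate:
  assumes "developing A \<omega> S \<Phi>"
  shows "developing A \<omega> {\<zeta>. \<zeta> + c \<in> S} (\<lambda>\<zeta>. \<Phi> (\<zeta> + c))"
  unfolding developing_def hol_into_def
proof (intro conjI ballI; clarify?)
  show "continuous_on {\<zeta>. \<zeta> + c \<in> S} (\<lambda>\<zeta>. \<Phi> (\<zeta> + c))"
    by (rule continuous_on_compose2[OF developing_continuous_on[OF assms]]) (auto intro!: continuous_intros)
next
  fix U \<phi> assume ch: "(U, \<phi>) \<in> A"
  have hol: "hol_on (\<lambda>\<zeta>. \<phi> (\<Phi> \<zeta>) $ j) {\<zeta>\<in>S. \<Phi> \<zeta> \<in> U}" for j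
    using assms ch unfolding developing_def hol_into_def hol_map_on_def by fast
  show "hol_map_on (\<lambda>\<zeta>. \<phi> (\<Phi> (\<zeta> + c))) {\<zeta> \<in> {\<zeta>. \<zeta> + c \<in> S}. \<Phi> (\<zeta> + c) \<in> U}"
    unfolding hol_map_on_def
    by (intro allI hol_on_compose[OF hol_on_affine[of 1 c, simplified] hol]) auto
  fix \<zeta> j k assume \<zeta>: "\<zeta> + c \<in> S" "\<Phi> (\<zeta> + c) \<in> U"
  have "cpartial k (\<lambda>\<xi>. \<phi> (\<Phi> (\<xi> + c)) $ l) \<zeta> = cpartial k (\<lambda>\<xi>. \<phi> (\<Phi> \<xi>) $ l) (\<zeta> + c)" for l
    by (simp add: cpartial_def algebra_simps)
  then have "pullback_coeff (\<omega> j) (\<lambda>\<zeta>. \<Phi> (\<zeta> + c)) (U, \<phi>) \<zeta> k = pullback_coeff (\<omega> j) \<Phi> (U, \<phi>) (\<zeta> + c) k"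
    by (simp add: pullback_coeff_def)
  also have "\<dots> = (if j = k then 1 else 0)"
    using assms ch \<zeta> unfolding developing_def by fast
  finally show "pullback_coeff (\<omega> j) (\<lambda>\<zeta>. \<Phi> (\<zeta> + c)) (U, \<phi>) \<zeta> k = (if j = k then 1 else 0)" .
qed

text \<open>A connectedness argument. Near a point of agreement both maps have the same derivative
  in local coordinates and hence coincide; the set of disagreement is open because the manifold is
  Hausdorff.\<close>

lemma developing_unique:
  assumes S: "open S" "connected S" and dev: "developing A \<omega> S \<Phi>" "developing A \<omega> S \<Psi>"
    and base: "c \<in> S" "\<Phi> c = \<Psi> c" and "\<zeta> \<in> S"
  shows "\<Phi> \<zeta> = \<Psi> \<zeta>"
proof -
  note cont = dev[THEN developing_continuous_on]
  define E where "E = {\<zeta>\<in>S. \<Phi> \<zeta> = \<Psi> \<zeta>}"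
  define D where "D = {\<zeta>\<in>S. \<Phi> \<zeta> \<noteq> \<Psi> \<zeta>}"
  have "open E"
  proof (subst open_subopen, rule ballI)
    fix \<zeta> assume \<zeta>: "\<zeta> \<in> E"
    obtain r0 N \<alpha> \<Theta> where r0: "0 < r0"
      and N: "\<And>r. 0 < r \<Longrightarrow> r \<le> r0 \<Longrightarrow> open (N r) \<and> \<Phi> \<zeta> \<in> N r \<and> N r \<subseteq> UNIV \<and> homeomorphism (N r) (polydisc r) \<alpha> \<Theta>"
      and D: "\<And>S \<Psi>' \<zeta>'. open S \<Longrightarrow> developing A \<omega> S \<Psi>' \<Longrightarrow> \<zeta>' \<in> S \<Longrightarrow> \<Psi>' \<zeta>' \<in> N r0 \<Longrightarrow>
        ((\<lambda>\<xi>. \<alpha> (\<Psi>' \<xi>)) has_derivative (\<lambda>v. v)) (at \<zeta>')"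
      by (rule local_coordinates[OF open_UNIV UNIV_I, of "\<Phi> \<zeta>"]) blast
    have N0: "open (N r0)" "\<Phi> \<zeta> \<in> N r0" "homeomorphism (N r0) (polydisc r0) \<alpha> \<Theta>" using N[OF r0] by auto
    have "open ((S \<inter> \<Phi> -` N r0) \<inter> (S \<inter> \<Psi> -` N r0))"
      by (intro open_Int continuous_open_preimage cont S N0)
    moreover have "\<zeta> \<in> (S \<inter> \<Phi> -` N r0) \<inter> (S \<inter> \<Psi> -` N r0)" using \<zeta> N0 by (auto simp: E_def)
    ultimately obtain e where e: "e > 0" "ball \<zeta> e \<subseteq> (S \<inter> \<Phi> -` N r0) \<inter> (S \<inter> \<Psi> -` N r0)"
      using openE by blast
    have "\<exists>k. \<forall>\<xi>\<in>ball \<zeta> e. \<alpha> (\<Phi> \<xi>) - \<alpha> (\<Psi> \<xi>) = k"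
    proof (rule has_derivative_zero_constant)
      fix \<xi> assume "\<xi> \<in> ball \<zeta> e"
      then have "\<xi> \<in> S" "\<Phi> \<xi> \<in> N r0" "\<Psi> \<xi> \<in> N r0" using e by auto
      then have "((\<lambda>\<xi>. \<alpha> (\<Phi> \<xi>) - \<alpha> (\<Psi> \<xi>)) has_derivative (\<lambda>v. v - v)) (at \<xi>)"
        by (intro has_derivative_diff D[OF S(1)] dev)
      then show "((\<lambda>\<xi>. \<alpha> (\<Phi> \<xi>) - \<alpha> (\<Psi> \<xi>)) has_derivative (\<lambda>h. 0)) (at \<xi> within ball \<zeta> e)"
        by (auto intro: has_derivative_at_withinI)
    qed simp
    then obtain k where k: "\<And>\<xi>. \<xi> \<in> ball \<zeta> e \<Longrightarrow> \<alpha> (\<Phi> \<xi>) - \<alpha> (\<Psi> \<xi>) = k" by blast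
    have "k = 0" using k[of \<zeta>] e \<zeta> by (simp add: E_def)
    have "ball \<zeta> e \<subseteq> E"
    proof
      fix \<xi> assume \<xi>: "\<xi> \<in> ball \<zeta> e"
      then have "\<xi> \<in> S" "\<Phi> \<xi> \<in> N r0" "\<Psi> \<xi> \<in> N r0" using e by auto
      moreover have "\<alpha> (\<Phi> \<xi>) = \<alpha> (\<Psi> \<xi>)" using k[OF \<xi>] \<open>k = 0\<close> by simp
      ultimately show "\<xi> \<in> E" unfolding E_def using N0(3) by (metis (mono_tags, lifting) homeomorphism_apply1 mem_Collect_eq)
    qed
    then show "\<exists>T. open T \<and> \<zeta> \<in> T \<and> T \<subseteq> E" using e by (intro exI[of _ "ball \<zeta> e"]) auto
  qed
  moreover have "open D"
  proof (subst open_subopen, rule ballI)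
    fix \<zeta> assume \<zeta>: "\<zeta> \<in> D"
    then obtain U V where UV: "open U" "open V" "\<Phi> \<zeta> \<in> U" "\<Psi> \<zeta> \<in> V" "U \<inter> V = {}"
      using hausdorff[of "\<Phi> \<zeta>" "\<Psi> \<zeta>"] by (auto simp: D_def)
    have "open ((S \<inter> \<Phi> -` U) \<inter> (S \<inter> \<Psi> -` V))"
      by (intro open_Int continuous_open_preimage cont S UV)
    then show "\<exists>T. open T \<and> \<zeta> \<in> T \<and> T \<subseteq> D"
      using UV \<zeta> by (intro exI[of _ "(S \<inter> \<Phi> -` U) \<inter> (S \<inter> \<Psi> -` V)"]) (auto simp: D_def)
  qed
  ultimately have "E \<inter> S = {} \<or> D \<inter> S = {}"
    using S(2) by (intro connectedD) (auto simp: E_def D_def)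
  then show ?thesis using base \<open>\<zeta> \<in> S\<close> by (auto simp: E_def D_def)
qed

section \<open>Existence with a uniform radius, and continuation to larger polydiscs\<close>

text \<open>One radius serves all centres in a neighbourhood: the map around \<open>x\<close> is
  recentred at \<open>y\<close>, and half of its radius is given up for the shift.\<close>

lemma local_phi:
  assumes "open G" "x \<in> G"
  obtains r N where "0 < r" "open N" "x \<in> N"
    "\<And>y. y \<in> N \<Longrightarrow> \<exists>\<Phi>. is_phi A \<omega> y r \<Phi> \<and> \<Phi> ` polydisc r \<subseteq> G"
proof -
  obtain r0 N \<alpha> \<Phi> where r0: "0 < r0"
    and N: "\<And>r. 0 < r \<Longrightarrow> r \<le> r0 \<Longrightarrow> open (N r) \<and> x \<in> N r \<and> N r \<subseteq> G \<and> homeomorphism (N r) (polydisc r) \<alpha> \<Phi>"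
    and \<Phi>: "developing A \<omega> (polydisc r0) \<Phi>"
    by (rule local_coordinates[OF assms]) blast
  have Nh: "open (N (r0/2))" "x \<in> N (r0/2)" "homeomorphism (N (r0/2)) (polydisc (r0/2)) \<alpha> \<Phi>"
    using N[of "r0/2"] r0 by auto
  have N0: "N r0 \<subseteq> G" "homeomorphism (N r0) (polydisc r0) \<alpha> \<Phi>" using N[of r0] r0 by auto
  show ?thesis
  proof (rule that[of "r0/2" "N (r0/2)"])
    fix y assume "y \<in> N (r0/2)"
    then have \<eta>: "\<alpha> y \<in> polydisc (r0/2)" "\<Phi> (\<alpha> y) = y"
      using Nh(3) by (auto simp: homeomorphism_def)
    have sub: "polydisc (r0/2) \<subseteq> {\<zeta>. \<zeta> + \<alpha> y \<in> polydisc r0}"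
    proof
      fix \<zeta> :: "complex^'n" assume "\<zeta> \<in> polydisc (r0/2)"
      then show "\<zeta> \<in> {\<zeta>. \<zeta> + \<alpha> y \<in> polydisc r0}"
        using \<eta>(1) supnorm_triangle[of \<zeta> "\<alpha> y"] by (simp add: polydisc_iff)
    qed
    have "developing A \<omega> (polydisc (r0/2)) (\<lambda>\<zeta>. \<Phi> (\<zeta> + \<alpha> y))"
      by (rule developing_subset[OF developing_translate[OF \<Phi>] sub])
    moreover have "(\<lambda>\<zeta>. \<Phi> (\<zeta> + \<alpha> y)) ` polydisc (r0/2) \<subseteq> G"
      using sub N0 by (force simp: homeomorphism_def)
    ultimately show "\<exists>\<Phi>. is_phi A \<omega> y (r0/2) \<Phi> \<and> \<Phi> ` polydisc (r0/2) \<subseteq> G"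
      unfolding is_phi_iff_developing using \<eta> by (intro exI[of _ "\<lambda>\<zeta>. \<Phi> (\<zeta> + \<alpha> y)"]) auto
  qed (use r0 Nh in auto)
qed

lemma is_phi_mono: "is_phi A \<omega> a r \<Phi> \<Longrightarrow> r' \<le> r \<Longrightarrow> is_phi A \<omega> a r' \<Phi>"
  unfolding is_phi_iff_developing by (auto elim!: developing_subset simp: polydisc_iff)

lemma uniform_phi:
  assumes "compact C"
  obtains r where "0 < r" "\<And>x. x \<in> C \<Longrightarrow> \<exists>\<Phi>. is_phi A \<omega> x r \<Phi>"
proof -
  have "\<exists>r N. 0 < r \<and> open N \<and> x \<in> N \<and> (\<forall>y\<in>N. \<exists>\<Phi>. is_phi A \<omega> y r \<Phi>)" for x
  proof (rule local_phi[OF open_UNIV UNIV_I, of x])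
    fix r N assume "0 < r" "open N" "x \<in> N" "\<And>y. y \<in> N \<Longrightarrow> \<exists>\<Phi>. is_phi A \<omega> y r \<Phi> \<and> \<Phi> ` polydisc r \<subseteq> UNIV"
    then show ?thesis by (intro exI[of _ r] exI[of _ N]) auto
  qed
  then obtain r N where *: "\<And>x. 0 < r x" "\<And>x. open (N x)" "\<And>x. x \<in> N x"
    "\<And>x y. y \<in> N x \<Longrightarrow> \<exists>\<Phi>. is_phi A \<omega> y (r x) \<Phi>" by metis
  have "C \<subseteq> (\<Union>x\<in>C. N x)" using *(3) by blast
  then obtain D where D: "finite D" "C \<subseteq> (\<Union>x\<in>D. N x)"
    by (rule compactE_image[OF assms *(2)])
  \<comment> \<open>Inserting 1 keeps the minimum meaningful when the finite cover is empty.\<close>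
  define r' where "r' = Min (insert 1 (r ` D))"
  show ?thesis
  proof (rule that[of r'])
    show "0 < r'" using D(1) *(1) by (simp add: r'_def)
    fix y assume "y \<in> C"
    then obtain x where x: "x \<in> D" "y \<in> N x" using D by blast
    have "r' \<le> r x" unfolding r'_def using D(1) x(1) by (intro Min_le) auto
    then show "\<exists>\<Phi>. is_phi A \<omega> y r' \<Phi>" using *(4)[OF x(2)] is_phi_mono by blast
  qed
qed

lemma open_shifted_polydisc: "open {\<zeta> :: complex^'n. \<zeta> - c \<in> polydisc r}"
proof -
  have "open ((\<lambda>\<zeta>. \<zeta> - c) -` polydisc r :: (complex^'n) set)"
    by (rule continuous_open_vimage[OF open_polydisc]) (intro continuous_intros)
  then show ?thesis by (simp add: vimage_def)
qed

lemma convex_shifted_polydisc: "convex {\<zeta> :: complex^'n. \<zeta> - c \<in> polydisc r}"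
proof -
  have "{\<zeta>. \<zeta> - c \<in> polydisc r} = (+) c ` polydisc r"
    by (auto simp: image_iff intro!: bexI[of _ "_ - c"])
  then show ?thesis by (simp add: convex_translation convex_polydisc)
qed

text \<open>The maps around the points of the image are recentred in the domain and glued. Since
  \<open>r\<close> is the same for all these points, the radius grows by a fixed amount, which is
  what allows a step past the supremum in \<open>rho\<close>.\<close>

lemma phi_extend:
  assumes \<Phi>: "is_phi A \<omega> a R \<Phi>" and "0 < R" "0 < r"
    and ext: "\<And>x. x \<in> \<Phi> ` polydisc R \<Longrightarrow> \<exists>\<Psi>. is_phi A \<omega> x r \<Psi>"
  obtains \<Phi>' where "is_phi A \<omega> a (R + r) \<Phi>'"
proof -
  define Ph where "Ph x = (SOME \<Psi>. is_phi A \<omega> x r \<Psi>)" for x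
  have Ph: "is_phi A \<omega> x r (Ph x)" if "x \<in> \<Phi> ` polydisc R" for x
    unfolding Ph_def using ext[OF that] by (rule someI_ex)
  define Q where "Q c = {\<zeta> :: complex^'n. \<zeta> - c \<in> polydisc r}" for c
  have Q: "open (Q c)" "convex (Q c)" "c \<in> Q c" for c
    using assms(3) by (simp_all add: Q_def open_shifted_polydisc convex_shifted_polydisc zero_in_polydisc)
  have dev: "developing A \<omega> (Q c) (\<lambda>\<zeta>. Ph (\<Phi> c) (\<zeta> - c))" if "c \<in> polydisc R" for c
    using developing_translate[of "polydisc r" "Ph (\<Phi> c)" "- c"] Ph[of "\<Phi> c"] that
    by (simp add: Q_def is_phi_iff_developing)
  have Ph0: "Ph (\<Phi> c) 0 = \<Phi> c" if "c \<in> polydisc R" for c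
    using Ph[of "\<Phi> c"] that by (simp add: is_phi_def)
  have dev\<Phi>: "developing A \<omega> (polydisc R) \<Phi>" "\<Phi> 0 = a" using \<Phi> by (auto simp: is_phi_iff_developing)
  have agree1: "\<Phi> \<zeta> = Ph (\<Phi> c) (\<zeta> - c)" if "c \<in> polydisc R" "\<zeta> \<in> polydisc R" "\<zeta> \<in> Q c" for c \<zeta>
    by (rule developing_unique[of "polydisc R \<inter> Q c" \<Phi> "\<lambda>\<zeta>. Ph (\<Phi> c) (\<zeta> - c)" c])
      (use that Q Ph0 in \<open>auto intro!: open_Int open_polydisc convex_connected convex_Int convex_polydisc
         developing_subset[OF dev] developing_subset[OF dev\<Phi>(1)]\<close>)
  \<comment> \<open>At the point \<open>d\<close> both pieces equal \<open>\<Phi> d\<close>, the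
    second one by \<open>agree1\<close>; uniqueness on the convex overlap does the rest.\<close>
  have agree2: "Ph (\<Phi> d) (\<zeta> - d) = Ph (\<Phi> c) (\<zeta> - c)"
    if "c \<in> polydisc R" "d \<in> polydisc R" "d \<in> Q c" "\<zeta> \<in> Q c" "\<zeta> \<in> Q d" for c d \<zeta>
    by (rule developing_unique[of "Q d \<inter> Q c" "\<lambda>\<zeta>. Ph (\<Phi> d) (\<zeta> - d)" "\<lambda>\<zeta>. Ph (\<Phi> c) (\<zeta> - c)" d])
      (use that Q Ph0 agree1[of c d, symmetric] in \<open>auto intro!: open_Int convex_connected convex_Int
         developing_subset[OF dev]\<close>)
  \<comment> \<open>Shrinking by \<open>s\<close> assigns to each \<open>\<zeta>\<close> a centre on
    its own ray. This ratio puts the centre into \<open>polydisc R\<close> and leaves an offset of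
    norm less than \<open>r\<close>.\<close>
  define s where "s = R / (R + r)"
  have s: "0 < s" "s < 1" "s * (R + r) = R" "(1 - s) * (R + r) = r" using assms(2,3) by (auto simp: s_def field_simps)
  have s_in: "s *\<^sub>R \<zeta> \<in> polydisc R" "\<zeta> \<in> Q (s *\<^sub>R \<zeta>)" if "\<zeta> \<in> polydisc (R + r)" for \<zeta> :: "complex^'n"
  proof -
    have "supnorm (s *\<^sub>R \<zeta>) = s * supnorm \<zeta>" "supnorm ((1 - s) *\<^sub>R \<zeta>) = (1 - s) * supnorm \<zeta>"
      using s by (simp_all add: supnorm_scaleR)
    moreover have "s * supnorm \<zeta> < s * (R + r)" "(1 - s) * supnorm \<zeta> < (1 - s) * (R + r)"
      by (intro mult_strict_left_mono; use that s(1,2) in \<open>simp add: polydisc_iff\<close>)+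
    ultimately show "s *\<^sub>R \<zeta> \<in> polydisc R" "\<zeta> \<in> Q (s *\<^sub>R \<zeta>)"
      using s by (simp_all add: polydisc_iff Q_def scaleR_diff_left)
  qed
  define \<Phi>' where "\<Phi>' \<zeta> = Ph (\<Phi> (s *\<^sub>R \<zeta>)) (\<zeta> - s *\<^sub>R \<zeta>)" for \<zeta>
  have "developing A \<omega> (polydisc (R + r)) \<Phi>'"
  proof (rule developing_local)
    fix \<zeta>0 :: "complex^'n" assume \<zeta>0: "\<zeta>0 \<in> polydisc (R + r)"
    define c where "c = s *\<^sub>R \<zeta>0"
    \<comment> \<open>For \<open>\<xi> \<in> T\<close> the moving centre
      \<open>s *\<^sub>R \<xi>\<close> lies in \<open>Q c\<close>, so \<open>agree2\<close> replaces
      it by the fixed centre \<open>c\<close>.\<close>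
    define T where "T = polydisc (R + r) \<inter> (Q c \<inter> (\<lambda>\<zeta>. s *\<^sub>R \<zeta>) -` Q c)"
    have "open T" unfolding T_def
      by (intro open_Int Q open_polydisc continuous_open_vimage) (intro continuous_intros)
    moreover have "\<zeta>0 \<in> T" using s_in[OF \<zeta>0] \<zeta>0 Q(3) by (simp add: T_def c_def)
    moreover have "developing A \<omega> T (\<lambda>\<zeta>. Ph (\<Phi> c) (\<zeta> - c))"
      by (rule developing_subset[OF dev]) (use s_in[OF \<zeta>0] in \<open>auto simp: T_def c_def\<close>)
    moreover have "\<Phi>' \<xi> = Ph (\<Phi> c) (\<xi> - c)" if "\<xi> \<in> T" for \<xi>
      unfolding \<Phi>'_def by (rule agree2) (use that s_in[of \<xi>] s_in[OF \<zeta>0] in \<open>auto simp: T_def c_def\<close>)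
    ultimately show "\<exists>T \<Psi>. open T \<and> \<zeta>0 \<in> T \<and> developing A \<omega> T \<Psi> \<and> (\<forall>\<xi>\<in>T. \<Phi>' \<xi> = \<Psi> \<xi>)" by blast
  qed
  moreover have "\<Phi>' 0 = a" using Ph0[of 0] dev\<Phi> assms(2) by (simp add: \<Phi>'_def zero_in_polydisc)
  ultimately show ?thesis using that by (simp add: is_phi_iff_developing)
qed

section \<open>The supremum defining the radius, and recentring of the maps
  \<open>\<phi>\<close>\<close>

lemma le_rho: "is_phi A \<omega> a r \<Phi> \<Longrightarrow> 0 < r \<Longrightarrow> \<Phi> ` polydisc r \<subseteq> \<Omega> \<Longrightarrow> ereal r \<le> rho A \<omega> a \<Omega>"
  unfolding rho_def by (rule Sup_upper) auto

lemma less_rhoD: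
  assumes "ereal t < rho A \<omega> a \<Omega>"
  obtains r \<Phi> where "t < r" "0 < r" "is_phi A \<omega> a r \<Phi>" "\<Phi> ` polydisc r \<subseteq> \<Omega>"
  using assms unfolding rho_def less_Sup_iff by auto

lemma rho_pos:
  assumes "open \<Omega>" "a \<in> \<Omega>"
  shows "0 < rho A \<omega> a \<Omega>"
proof -
  obtain r \<Phi> where "0 < r" "is_phi A \<omega> a r \<Phi>" "\<Phi> ` polydisc r \<subseteq> \<Omega>"
    using local_phi[OF assms] by metis
  then have "ereal 0 < ereal r" "ereal r \<le> rho A \<omega> a \<Omega>" by (auto intro: le_rho)
  then show ?thesis unfolding zero_ereal_def by (rule less_le_trans)
qed

lemma phi_exists:
  assumes "open G" "x \<in> G"
  obtains r \<Phi> where "0 < r" "is_phi A \<omega> x r \<Phi>" "\<Phi> ` polydisc r \<subseteq> G"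
proof (rule local_phi[OF assms])
  fix r N assume *: "0 < r" "x \<in> N" "\<And>y. y \<in> N \<Longrightarrow> \<exists>\<Phi>. is_phi A \<omega> y r \<Phi> \<and> \<Phi> ` polydisc r \<subseteq> G"
  then show ?thesis using that by metis
qed

lemma phi_agree:
  assumes "is_phi A \<omega> x r \<Phi>" "is_phi A \<omega> x r' \<Psi>" "supnorm \<zeta> < r" "supnorm \<zeta> < r'"
  shows "\<Phi> \<zeta> = \<Psi> \<zeta>"
proof (rule developing_unique[of "polydisc r \<inter> polydisc r'" \<Phi> \<Psi> 0])
  have "0 < r" "0 < r'" using assms(3,4) supnorm_nonneg[of \<zeta>] by auto
  then show "0 \<in> polydisc r \<inter> polydisc r'" by (simp add: zero_in_polydisc)
qed (use assms in \<open>auto simp: is_phi_iff_developing polydisc_iff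
    intro!: open_Int open_polydisc convex_connected convex_Int convex_polydisc elim: developing_subset\<close>)

text \<open>Moving the centre to \<open>\<Phi> \<eta>\<close> costs at most the norm of
  \<open>\<eta>\<close> in the radius.\<close>

lemma phi_translate:
  assumes "is_phi A \<omega> x r \<Phi>" "supnorm \<eta> \<le> r - r'"
  shows "is_phi A \<omega> (\<Phi> \<eta>) r' (\<lambda>\<zeta>. \<Phi> (\<zeta> + \<eta>))" "(\<lambda>\<zeta>. \<Phi> (\<zeta> + \<eta>)) ` polydisc r' \<subseteq> \<Phi> ` polydisc r"
proof -
  have sub: "polydisc r' \<subseteq> {\<zeta>. \<zeta> + \<eta> \<in> polydisc r}"
  proof
    fix \<zeta> :: "complex^'n" assume "\<zeta> \<in> polydisc r'"
    then show "\<zeta> \<in> {\<zeta>. \<zeta> + \<eta> \<in> polydisc r}"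
      using assms(2) supnorm_triangle[of \<zeta> \<eta>] by (simp add: polydisc_iff)
  qed
  then show "(\<lambda>\<zeta>. \<Phi> (\<zeta> + \<eta>)) ` polydisc r' \<subseteq> \<Phi> ` polydisc r" by blast
  show "is_phi A \<omega> (\<Phi> \<eta>) r' (\<lambda>\<zeta>. \<Phi> (\<zeta> + \<eta>))"
    using developing_subset[OF developing_translate sub] assms(1)
    by (simp add: is_phi_iff_developing)
qed

lemma hol_on_phi:
  assumes "open \<Omega>" "u \<in> hol_functions A \<Omega>" "is_phi A \<omega> x r \<Phi>" "\<Phi> ` polydisc r \<subseteq> \<Omega>"
  shows "hol_on (\<lambda>\<zeta>. u (\<Phi> \<zeta>)) (polydisc r)"
proof -
  have "hol_on (\<lambda>\<zeta>. u (\<Phi> \<zeta>)) {\<zeta>\<in>polydisc r. \<Phi> \<zeta> \<in> \<Omega>}"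
    by (rule hol_into_compose[OF atlas _ assms(2) open_polydisc assms(1)])
      (use assms(3) in \<open>simp add: is_phi_def\<close>)
  moreover have "{\<zeta>\<in>polydisc r. \<Phi> \<zeta> \<in> \<Omega>} = polydisc r" using assms(4) by blast
  ultimately show ?thesis by simp
qed

section \<open>Taylor coefficients along complex lines\<close>

text \<open>An arbitrary choice of \<open>\<phi>\<^sub>x\<close> on some polydisc whose size is left
  open. Only its germ at 0 is determined, which suffices for derivatives at 0.\<close>

definition germ :: "'a \<Rightarrow> complex^'n \<Rightarrow> 'a" where
  "germ x = (SOME \<Phi>. \<exists>r>0. is_phi A \<omega> x r \<Phi>)"

text \<open>The sum over all multi-indices of degree \<open>k\<close> of the Taylor expansion of \<open>u \<circ> \<phi>\<^sub>x\<close>, evaluated at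
  \<open>\<zeta>\<close>; working along the line through \<open>\<zeta>\<close> reduces Cauchy's estimates to one variable.\<close>

definition taylor :: "('a \<Rightarrow> complex) \<Rightarrow> nat \<Rightarrow> complex^'n \<Rightarrow> 'a \<Rightarrow> complex" where
  "taylor u k \<zeta> x = (deriv ^^ k) (\<lambda>s. u (germ x (s *s \<zeta>))) 0 / fact k"

lemma germ_phi: "\<exists>r>0. is_phi A \<omega> x r (germ x)"
proof -
  obtain r \<Phi> where "0 < r" "is_phi A \<omega> x r \<Phi>"
    by (rule phi_exists[OF open_UNIV UNIV_I])
  then have "\<exists>\<Phi>. \<exists>r>0. is_phi A \<omega> x r \<Phi>" by blast
  then show ?thesis unfolding germ_def by (rule someI_ex)
qed

text \<open>Any two choices agree near 0 by uniqueness, so \<open>germ\<close> may be replaced by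
  whichever map is at hand.\<close>

lemma taylor_eq:
  assumes "is_phi A \<omega> x r \<Phi>" "0 < r"
  shows "taylor u k \<zeta> x = (deriv ^^ k) (\<lambda>s. u (\<Phi> (s *s \<zeta>))) 0 / fact k"
proof -
  obtain r' where r': "r' > 0" "is_phi A \<omega> x r' (germ x)" using germ_phi by blast
  define T where "T = {s. supnorm (s *s \<zeta>) < min r r'}"
  have "open T" unfolding T_def by (intro open_Collect_less continuous_intros)
  moreover have "0 \<in> T" using assms(2) r' by (simp add: T_def)
  moreover have "u (germ x (s *s \<zeta>)) = u (\<Phi> (s *s \<zeta>))" if "s \<in> T" for s
    using phi_agree[OF r'(2) assms(1)] that by (simp add: T_def)
  ultimately have "eventually (\<lambda>s. u (germ x (s *s \<zeta>)) = u (\<Phi> (s *s \<zeta>))) (nhds 0)"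
    by (auto simp: eventually_nhds)
  then show ?thesis unfolding taylor_def by (intro arg_cong2[where f="(/)"] higher_deriv_cong_ev refl)
qed

lemma holomorphic_phi_line:
  assumes "open \<Omega>" "u \<in> hol_functions A \<Omega>" "is_phi A \<omega> x r \<Phi>" "\<Phi> ` polydisc r \<subseteq> \<Omega>"
    and "\<And>s. s \<in> T \<Longrightarrow> cmod s * supnorm \<zeta> < r"
  shows "(\<lambda>s. u (\<Phi> (s *s \<zeta>))) holomorphic_on T"
  using hol_on_line_imp_holomorphic[OF hol_on_phi[OF assms(1-4)], of T 0 \<zeta>] assms(5)
  by (simp add: polydisc_iff supnorm_cscale)

text \<open>Near a given point, recentring yields
  \<open>\<phi>\<^sub>y (s \<zeta>) = \<Phi> (\<alpha> y + s \<zeta>)\<close> with one fixed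
  \<open>\<Phi>\<close>. The coefficient is then a circle mean in which the coordinate
  \<open>\<alpha> y\<close> is a holomorphic parameter.\<close>

lemma taylor_hol_functions:
  assumes \<Omega>: "open \<Omega>" and u: "u \<in> hol_functions A \<Omega>"
  shows "taylor u k \<zeta> \<in> hol_functions A \<Omega>"
proof (rule hol_functions_local[OF atlas \<Omega>])
  fix x assume "x \<in> \<Omega>"
  obtain r N \<alpha> \<Phi> where r: "0 < r"
    and N: "\<And>r'. 0 < r' \<Longrightarrow> r' \<le> r \<Longrightarrow> open (N r') \<and> x \<in> N r' \<and> N r' \<subseteq> \<Omega> \<and> homeomorphism (N r') (polydisc r') \<alpha> \<Phi>"
    and \<Phi>: "\<Phi> 0 = x" "developing A \<omega> (polydisc r) \<Phi>"
    and \<alpha>: "\<And>j. (\<lambda>y. \<alpha> y $ j) \<in> hol_functions A (N r)"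
    by (rule local_coordinates[OF \<Omega> \<open>x \<in> \<Omega>\<close>]) blast
  have N0: "N r \<subseteq> \<Omega>" "homeomorphism (N r) (polydisc r) \<alpha> \<Phi>" using N[of r] r by auto
  have Nh: "open (N (r/2))" "x \<in> N (r/2)" "homeomorphism (N (r/2)) (polydisc (r/2)) \<alpha> \<Phi>" using N[of "r/2"] r by auto
  have sub: "N (r/2) \<subseteq> N r"
  proof -
    have "\<Phi> ` polydisc (r/2) \<subseteq> \<Phi> ` polydisc r" using r by (intro image_mono) (auto simp: polydisc_iff)
    then show ?thesis using N0 Nh by (simp add: homeomorphism_def)
  qed
  have phi: "is_phi A \<omega> x r \<Phi>" using \<Phi> by (simp add: is_phi_iff_developing)
  have im: "\<Phi> ` polydisc r \<subseteq> \<Omega>" using N0 by (auto simp: homeomorphism_def)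
  \<comment> \<open>Half of \<open>r\<close> is reserved for the centre \<open>\<alpha> y\<close>,
    the other half for the circle, even at twice its radius; the added 1 avoids division by zero
    when \<open>\<zeta> = 0\<close>.\<close>
  define \<epsilon> where "\<epsilon> = r / (4 * (supnorm \<zeta> + 1))"
  have \<epsilon>: "\<epsilon> > 0" "2 * \<epsilon> * supnorm \<zeta> < r/2"
    using r supnorm_nonneg[of \<zeta>] by (auto simp: \<epsilon>_def field_simps add_pos_nonneg)
  define G where "G \<eta> = integral {0..1} (\<lambda>t. (1 / circlepath 0 \<epsilon> t ^ k) * u (\<Phi> (1 *s \<eta> + circlepath 0 \<epsilon> t *s \<zeta>)))" for \<eta>
  have small: "supnorm (circlepath 0 \<epsilon> t *s \<zeta>) < r/2" for t
  proof -
    have "0 \<le> \<epsilon> * supnorm \<zeta>" using \<epsilon> supnorm_nonneg[of \<zeta>] by simp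
    then show ?thesis using \<epsilon> by (simp add: supnorm_cscale norm_circlepath_0)
  qed
  have "hol_on G (polydisc (r/2))"
    unfolding G_def
  proof (rule hol_on_integral[OF open_polydisc hol_on_phi[OF \<Omega> u phi im] open_polydisc])
    fix \<eta> :: "complex^'n" and t :: real assume "\<eta> \<in> polydisc (r/2)"
    then show "1 *s \<eta> + circlepath 0 \<epsilon> t *s \<zeta> \<in> polydisc r"
      using small[of t] supnorm_triangle[of \<eta> "circlepath 0 \<epsilon> t *s \<zeta>"] by (simp add: polydisc_iff)
  qed (use \<epsilon> circlepath_0_neq_0[of \<epsilon>] in \<open>auto intro!: continuous_intros\<close>)
  then have "(\<lambda>y. G (\<alpha> y)) \<in> hol_functions A (N (r/2))"
    by (rule hol_functions_compose[OF atlas hol_functions_subset[OF \<alpha> sub]])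
      (use Nh in \<open>auto simp: homeomorphism_def\<close>)
  moreover have "taylor u k \<zeta> y = G (\<alpha> y)" if "y \<in> N (r/2)" for y
  proof -
    have \<eta>: "supnorm (\<alpha> y) \<le> r - r/2" "\<Phi> (\<alpha> y) = y"
      using Nh(3) that by (auto simp: homeomorphism_def polydisc_iff dest!: equalityD1 intro!: less_imp_le)
    note tr = phi_translate[OF phi \<eta>(1), unfolded \<eta>(2)]
    have "(\<lambda>s. u (\<Phi> (s *s \<zeta> + \<alpha> y))) holomorphic_on ball 0 (2 * \<epsilon>)"
    proof (rule holomorphic_phi_line[OF \<Omega> u tr(1)])
      show "(\<lambda>\<zeta>. \<Phi> (\<zeta> + \<alpha> y)) ` polydisc (r/2) \<subseteq> \<Omega>" using tr(2) im by blast
      fix s :: complex assume "s \<in> ball 0 (2 * \<epsilon>)"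
      then have "cmod s * supnorm \<zeta> \<le> 2 * \<epsilon> * supnorm \<zeta>"
        by (intro mult_right_mono supnorm_nonneg) auto
      then show "cmod s * supnorm \<zeta> < r / 2" using \<epsilon> by simp
    qed
    from higher_deriv_circle_mean[OF this, of \<epsilon> k] \<epsilon>(1)
    have "((\<lambda>t. u (\<Phi> (circlepath 0 \<epsilon> t *s \<zeta> + \<alpha> y)) / circlepath 0 \<epsilon> t ^ k) has_integral taylor u k \<zeta> y) {0..1}"
      using taylor_eq[OF tr(1)] r by simp
    then show ?thesis by (simp add: G_def integral_unique add.commute)
  qed
  ultimately show "\<exists>N v. open N \<and> x \<in> N \<and> v \<in> hol_functions A N \<and> (\<forall>y\<in>N \<inter> \<Omega>. taylor u k \<zeta> y = v y)"
    using Nh by blast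
qed

text \<open>Scaling \<open>\<zeta>\<close> by \<open>c\<close> rescales the line parameter, and each
  of the \<open>k\<close> derivatives contributes a factor \<open>c\<close>.\<close>

lemma taylor_homogeneous:
  assumes "open \<Omega>" "u \<in> hol_functions A \<Omega>" "x \<in> \<Omega>"
  shows "taylor u k (c *s \<zeta>) x = c ^ k * taylor u k \<zeta> x"
proof -
  obtain r \<Phi> where r: "0 < r" and \<Phi>: "is_phi A \<omega> x r \<Phi>" "\<Phi> ` polydisc r \<subseteq> \<Omega>"
    by (rule phi_exists[OF assms(1,3)])
  define T where "T = {s. supnorm (s *s \<zeta>) < r}"
  define S where "S = {s. supnorm (s *s (c *s \<zeta>)) < r}"
  have T: "open T" "open S" unfolding T_def S_def by (intro open_Collect_less continuous_intros)+
  have hol: "(\<lambda>s. u (\<Phi> (s *s \<zeta>))) holomorphic_on T"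
    by (rule holomorphic_phi_line[OF assms(1,2) \<Phi>]) (simp add: T_def supnorm_cscale)
  have "(deriv ^^ k) (\<lambda>s. (\<lambda>s. u (\<Phi> (s *s \<zeta>))) (c * s)) 0 = c ^ k * (deriv ^^ k) (\<lambda>s. u (\<Phi> (s *s \<zeta>))) (c * 0)"
    by (rule higher_deriv_compose_linear[OF hol T(2,1)])
      (use r in \<open>auto simp: S_def T_def supnorm_cscale norm_mult mult_ac\<close>)
  then show ?thesis
    by (simp add: taylor_eq[OF \<Phi>(1) r] vector_smult_assoc mult.commute[of _ c])
qed

text \<open>Near 0 the coefficient is a circle mean of \<open>u \<circ> \<Phi>\<close> and therefore
  holomorphic; homogeneity carries this to all vectors.\<close>

lemma hol_on_taylor:
  assumes \<Omega>: "open \<Omega>" and u: "u \<in> hol_functions A \<Omega>" and x: "x \<in> \<Omega>"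
  shows "hol_on (\<lambda>\<zeta>. taylor u k \<zeta> x) UNIV"
proof -
  obtain r \<Phi> where r: "0 < r" and \<Phi>: "is_phi A \<omega> x r \<Phi>" "\<Phi> ` polydisc r \<subseteq> \<Omega>"
    by (rule phi_exists[OF \<Omega> x])
  define G where "G \<zeta> = integral {0..1} (\<lambda>t. (1 / circlepath 0 (1/2) t ^ k) * u (\<Phi> (circlepath 0 (1/2) t *s \<zeta> + 0)))" for \<zeta>
  have "hol_on G (polydisc r)"
    unfolding G_def
  proof (rule hol_on_integral[OF open_polydisc hol_on_phi[OF \<Omega> u \<Phi>] open_polydisc])
    fix \<zeta> :: "complex^'n" and t :: real assume "\<zeta> \<in> polydisc r"
    then show "circlepath 0 (1/2) t *s \<zeta> + 0 \<in> polydisc r"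
      using supnorm_nonneg[of \<zeta>] by (simp add: polydisc_iff supnorm_cscale norm_circlepath_0)
  qed (use circlepath_0_neq_0[of "1/2"] in \<open>auto intro!: continuous_intros\<close>)
  moreover have "G \<zeta> = taylor u k \<zeta> x" if "\<zeta> \<in> polydisc r" for \<zeta>
  proof -
    have "(\<lambda>s. u (\<Phi> (s *s \<zeta>))) holomorphic_on ball 0 1"
    proof (rule holomorphic_phi_line[OF \<Omega> u \<Phi>])
      fix s :: complex assume "s \<in> ball 0 1"
      then have "cmod s * supnorm \<zeta> \<le> 1 * supnorm \<zeta>"
        by (intro mult_right_mono supnorm_nonneg) auto
      then show "cmod s * supnorm \<zeta> < r" using that by (simp add: polydisc_iff)
    qed
    from higher_deriv_circle_mean[OF this, of "1/2" k]
    show ?thesis by (simp add: taylor_eq[OF \<Phi>(1) r] G_def integral_unique)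
  qed
  ultimately have near: "hol_on (\<lambda>\<zeta>. taylor u k \<zeta> x) (polydisc r)"
    by (rule hol_on_cong[OF open_polydisc, rotated])
  show ?thesis
  proof (rule hol_on_local)
    fix z :: "complex^'n"
    \<comment> \<open>A positive factor that brings \<open>z\<close> into the polydisc where
      holomorphy is already known.\<close>
    define d where "d = r / (supnorm z + 1)"
    define c where "c = complex_of_real d"
    have nz: "supnorm z + 1 > 0" using supnorm_nonneg[of z] by simp
    then have "d > 0" "d * supnorm z < r" using r by (auto simp: d_def field_simps)
    then have c: "c \<noteq> 0" "c *s z \<in> polydisc r"
      by (auto simp: c_def polydisc_iff supnorm_cscale)
    define T where "T = {\<zeta> :: complex^'n. c *s \<zeta> \<in> polydisc r}"
    have "open T" unfolding T_def polydisc_iff by (intro open_Collect_less continuous_intros)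
    have "hol_on (\<lambda>\<zeta>. (1 / c ^ k) * taylor u k (c *s \<zeta> + 0) x) T"
      by (intro hol_on_mult hol_on_const hol_on_compose[OF hol_on_affine near]) (auto simp: T_def)
    moreover have "(1 / c ^ k) * taylor u k (c *s \<zeta> + 0) x = taylor u k \<zeta> x" for \<zeta>
      using c by (simp add: taylor_homogeneous[OF \<Omega> u x])
    ultimately have "hol_on (\<lambda>\<zeta>. taylor u k \<zeta> x) T" by simp
    then show "\<exists>T. open T \<and> z \<in> T \<and> hol_on (\<lambda>\<zeta>. taylor u k \<zeta> x) (UNIV \<inter> T)"
      using \<open>open T\<close> c by (intro exI[of _ T]) (auto simp: T_def)
  qed
qed

section \<open>Convergence of the homogeneous expansion and Cauchy estimates\<close>

text \<open>Along the line through \<open>\<zeta>\<close> the composite is holomorphic on a disc of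
  radius greater than 1, and the claim is its power series evaluated at
  \<open>s = 1\<close>.\<close>

lemma taylor_sums:
  assumes "open \<Omega>" "u \<in> hol_functions A \<Omega>" "is_phi A \<omega> x r \<Phi>" "\<Phi> ` polydisc r \<subseteq> \<Omega>" "supnorm \<zeta> < r"
  shows "(\<lambda>k. taylor u k \<zeta> x) sums u (\<Phi> \<zeta>)"
proof -
  \<comment> \<open>For \<open>\<zeta> = 0\<close> the composite is constant along the line, and 2
    stands for any radius above 1.\<close>
  define R where "R = (if supnorm \<zeta> = 0 then 2 else r / supnorm \<zeta>)"
  have r: "0 < r" using assms(5) supnorm_nonneg[of \<zeta>] by simp
  have R: "R > 1" using assms(5) supnorm_nonneg[of \<zeta>] by (auto simp: R_def)
  have "(\<lambda>s. u (\<Phi> (s *s \<zeta>))) holomorphic_on ball 0 R"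
    by (rule holomorphic_phi_line[OF assms(1-4)])
      (use r supnorm_nonneg[of \<zeta>] in \<open>auto simp: R_def field_simps split: if_splits\<close>)
  from holomorphic_power_series[OF this, of 1] R
  show ?thesis by (simp add: taylor_eq[OF assms(3) r])
qed

text \<open>Cauchy's inequality on the circle of radius \<open>s\<close>: as
  \<open>supnorm \<zeta> \<le> 1\<close>, the points \<open>w *s \<zeta>\<close> over this circle
  have norm at most \<open>s\<close>.\<close>

lemma taylor_bound:
  assumes "open \<Omega>" "u \<in> hol_functions A \<Omega>" "is_phi A \<omega> x r \<Phi>" "\<Phi> ` polydisc r \<subseteq> \<Omega>"
    and s: "0 \<le> s" "s < r" and M: "\<And>\<xi>. supnorm \<xi> \<le> s \<Longrightarrow> cmod (u (\<Phi> \<xi>)) \<le> M" and \<zeta>: "supnorm \<zeta> \<le> 1"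
  shows "s ^ k * cmod (taylor u k \<zeta> x) \<le> M"
proof -
  have r: "0 < r" using s by simp
  have M0: "cmod (u (\<Phi> 0)) \<le> M" by (rule M) (use s in simp)
  have le: "cmod w * supnorm \<zeta> \<le> cmod w" for w using \<zeta> by (simp add: mult_left_le)
  have hol: "(\<lambda>s. u (\<Phi> (s *s \<zeta>))) holomorphic_on ball 0 r"
    by (rule holomorphic_phi_line[OF assms(1-4)]) (use le in \<open>auto intro: le_less_trans\<close>)
  \<comment> \<open>The radius \<open>s = 0\<close> occurs at zeros of \<open>f\<close>. There
    \<open>0 ^ 0 = 1\<close> turns the case \<open>k = 0\<close> into the bound for \<open>u\<close>
    at the centre, and for \<open>k > 0\<close> the left-hand side vanishes.\<close>
  consider "s = 0" "k = 0" | "s = 0" "k > 0" | "s > 0" using s by force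
  then show ?thesis
  proof cases
    case 1
    then show ?thesis using M0 by (simp add: taylor_eq[OF assms(3) r])
  next
    case 2
    then show ?thesis using order_trans[OF norm_ge_zero M0] by (simp add: zero_power)
  next
    case 3
    have "cmod ((deriv ^^ k) (\<lambda>s. u (\<Phi> (s *s \<zeta>))) 0) \<le> fact k * M / s ^ k"
    proof (rule Cauchy_inequality)
      show "(\<lambda>s. u (\<Phi> (s *s \<zeta>))) holomorphic_on ball 0 s"
        by (rule holomorphic_on_subset[OF hol]) (use s in auto)
      show "continuous_on (cball 0 s) (\<lambda>s. u (\<Phi> (s *s \<zeta>)))"
        by (rule holomorphic_on_imp_continuous_on[OF holomorphic_on_subset[OF hol]]) (use s in auto)
      show "cmod (u (\<Phi> (w *s \<zeta>))) \<le> M" if "cmod (0 - w) = s" for w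
        by (rule M) (use le[of w] that in \<open>simp add: supnorm_cscale\<close>)
    qed fact
    then show ?thesis
      using 3 by (simp add: taylor_eq[OF assms(3) r] norm_divide field_simps)
  qed
qed

section \<open>The radius on the holomorphic hull\<close>

text \<open>As \<open>t < 1\<close>, the radius \<open>t * cmod (f x)\<close> lies strictly below
  \<open>rho\<close>, which leaves room to move the centre: a single map around \<open>x\<close> and
  a single bound \<open>M\<close> serve all nearby \<open>y\<close>.\<close>

lemma uniform_bound_near:
  assumes \<Omega>: "open \<Omega>" and f: "f \<in> hol_functions A \<Omega>" and u: "u \<in> hol_functions A \<Omega>"
    and x: "x \<in> \<Omega>" "ereal (cmod (f x)) \<le> rho A \<omega> x \<Omega>" and t: "0 \<le> t" "t < 1"
  obtains N M where "open N" "x \<in> N"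
    "\<And>y. y \<in> N \<Longrightarrow> \<exists>r \<Phi>. t * cmod (f y) < r \<and> is_phi A \<omega> y r \<Phi> \<and> \<Phi> ` polydisc r \<subseteq> \<Omega> \<and>
      (\<forall>\<xi>. supnorm \<xi> \<le> t * cmod (f y) \<longrightarrow> cmod (u (\<Phi> \<xi>)) \<le> M)"
proof -
  \<comment> \<open>At a zero of \<open>f\<close> strictness comes from the positivity of
    \<open>rho\<close>, elsewhere from \<open>t < 1\<close>.\<close>
  have "ereal (t * cmod (f x)) < rho A \<omega> x \<Omega>"
  proof (cases "f x = 0")
    case True
    then show ?thesis using rho_pos[OF \<Omega> x(1)] by (simp add: zero_ereal_def)
  next
    case False
    then have "ereal (t * cmod (f x)) < ereal (cmod (f x))" using t by simp
    then show ?thesis using x(2) by (rule less_le_trans)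
  qed
  then obtain r \<Phi> where r: "t * cmod (f x) < r" "0 < r" and \<Phi>: "is_phi A \<omega> x r \<Phi>" "\<Phi> ` polydisc r \<subseteq> \<Omega>"
    by (rule less_rhoD)
  \<comment> \<open>\<open>r1\<close> will bound \<open>t * cmod (f y)\<close> for \<open>y\<close>
    near \<open>x\<close>, the gap between \<open>r1\<close> and \<open>r2\<close> absorbs the shift
    of the centre, and \<open>r2 < r\<close> keeps the closed polydisc of radius \<open>r2\<close>
    inside the domain of \<open>\<Phi>\<close>.\<close>
  obtain r1 where r1: "t * cmod (f x) < r1" "r1 < r" using r(1) dense by blast
  obtain r2 where r2: "r1 < r2" "r2 < r" using r1(2) dense by blast
  have "0 < r1" using r1(1) t(1) by (meson le_less_trans mult_nonneg_nonneg norm_ge_zero)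
  obtain r0 N \<alpha> \<Theta> where r0: "0 < r0"
    and N: "\<And>r'. 0 < r' \<Longrightarrow> r' \<le> r0 \<Longrightarrow> open (N r') \<and> x \<in> N r' \<and> N r' \<subseteq> \<Omega> \<and> homeomorphism (N r') (polydisc r') \<alpha> \<Theta>"
    and "\<Theta> 0 = x" "developing A \<omega> (polydisc r0) \<Theta>"
    by (rule local_coordinates[OF \<Omega> x(1)]) blast
  then have \<Theta>: "is_phi A \<omega> x r0 \<Theta>" by (simp add: is_phi_iff_developing)
  define \<delta> where "\<delta> = min r0 (r2 - r1)"
  have \<delta>: "0 < \<delta>" "\<delta> \<le> r0" "\<delta> \<le> r2 - r1" using r0 r2 by (auto simp: \<delta>_def)
  note N\<delta> = N[OF \<delta>(1,2)]
  have "continuous_on {\<xi>. supnorm \<xi> \<le> r2} (\<lambda>\<xi>. u (\<Phi> \<xi>))"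
    by (rule continuous_on_subset[OF hol_on_imp_continuous_on[OF hol_on_phi[OF \<Omega> u \<Phi>]]])
      (use r2 in \<open>auto simp: polydisc_iff\<close>)
  then have "compact ((\<lambda>\<xi>. u (\<Phi> \<xi>)) ` {\<xi>. supnorm \<xi> \<le> r2})"
    by (intro compact_continuous_image compact_supnorm_le)
  from compact_imp_bounded[OF this]
  have "\<exists>M. \<forall>\<xi>. supnorm \<xi> \<le> r2 \<longrightarrow> cmod (u (\<Phi> \<xi>)) \<le> M" by (simp add: bounded_iff)
  then obtain M where M: "\<And>\<xi>. supnorm \<xi> \<le> r2 \<Longrightarrow> cmod (u (\<Phi> \<xi>)) \<le> M" by blast
  have "open (N \<delta> \<inter> f -` {z. t * cmod z < r1})"
  proof (rule continuous_open_preimage)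
    show "continuous_on (N \<delta>) f"
      using hol_functions_imp_continuous_on[OF atlas \<Omega> f] N\<delta> by (blast intro: continuous_on_subset)
    show "open (N \<delta>)" using N\<delta> by blast
    show "open {z. t * cmod z < r1}" by (intro open_Collect_less continuous_intros)
  qed
  moreover have "x \<in> N \<delta> \<inter> f -` {z. t * cmod z < r1}" using N\<delta> r1 by auto
  moreover have "\<exists>r \<Phi>. t * cmod (f y) < r \<and> is_phi A \<omega> y r \<Phi> \<and> \<Phi> ` polydisc r \<subseteq> \<Omega> \<and>
      (\<forall>\<xi>. supnorm \<xi> \<le> t * cmod (f y) \<longrightarrow> cmod (u (\<Phi> \<xi>)) \<le> M)" if y: "y \<in> N \<delta> \<inter> f -` {z. t * cmod z < r1}" for y
  proof -
    define \<eta> where "\<eta> = \<alpha> y"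
    have \<eta>: "supnorm \<eta> < \<delta>" "\<Theta> \<eta> = y"
      using N\<delta> y unfolding \<eta>_def by (auto simp: homeomorphism_def polydisc_iff set_eq_iff image_iff)
    have "\<Phi> \<eta> = y"
      using phi_agree[OF \<Phi>(1) \<Theta>, of \<eta>] \<eta> \<delta> r2 \<open>0 < r1\<close> by simp
    moreover have "supnorm \<eta> \<le> r - (r - \<delta>)" using \<eta> by simp
    note tr = phi_translate[OF \<Phi>(1) this]
    moreover have "cmod (u (\<Phi> (\<xi> + \<eta>))) \<le> M" if "supnorm \<xi> \<le> t * cmod (f y)" for \<xi>
      by (rule M) (use that y \<eta> \<delta> supnorm_triangle[of \<xi> \<eta>] in auto)
    moreover have "t * cmod (f y) < r - \<delta>" using y \<delta> r2 by auto
    ultimately show ?thesis using \<Phi>(2) by (intro exI[of _ "r - \<delta>"] exI[of _ "\<lambda>\<zeta>. \<Phi> (\<zeta> + \<eta>)"]) auto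
  qed
  ultimately show ?thesis by (rule that)
qed

text \<open>The step from \<open>K\<close> to its hull: the products of \<open>f ^ k\<close> with
  the Taylor coefficients belong to \<open>hol_functions A \<Omega>\<close>, so bounds on
  \<open>K\<close> pass to \<open>a\<close>. The essential point is that \<open>M\<close> is
  independent of \<open>k\<close> and \<open>\<zeta>\<close>.\<close>

lemma taylor_bound_hull:
  assumes \<Omega>: "open \<Omega>" and f: "f \<in> hol_functions A \<Omega>" and u: "u \<in> hol_functions A \<Omega>"
    and K: "compact K" "K \<subseteq> \<Omega>" and le: "\<And>x. x \<in> K \<Longrightarrow> ereal (cmod (f x)) \<le> rho A \<omega> x \<Omega>"
    and a: "a \<in> hol_hull A \<Omega> K" and t: "0 < t" "t < 1"
  obtains M where "\<And>k \<zeta>. supnorm \<zeta> \<le> 1 \<Longrightarrow> (t * cmod (f a)) ^ k * cmod (taylor u k \<zeta> a) \<le> M"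
proof -
  define P where "P M y \<longleftrightarrow> (\<exists>r \<Phi>. t * cmod (f y) < r \<and> is_phi A \<omega> y r \<Phi> \<and> \<Phi> ` polydisc r \<subseteq> \<Omega> \<and>
      (\<forall>\<xi>. supnorm \<xi> \<le> t * cmod (f y) \<longrightarrow> cmod (u (\<Phi> \<xi>)) \<le> M))" for M y
  have "\<exists>N M. open N \<and> x \<in> N \<and> (\<forall>y\<in>N. P M y)" if "x \<in> K" for x
  proof (rule uniform_bound_near[OF \<Omega> f u _ le[OF that], of t])
    fix N M assume "open N" "x \<in> N" "\<And>y. y \<in> N \<Longrightarrow> \<exists>r \<Phi>. t * cmod (f y) < r \<and> is_phi A \<omega> y r \<Phi> \<and> \<Phi> ` polydisc r \<subseteq> \<Omega> \<and>
      (\<forall>\<xi>. supnorm \<xi> \<le> t * cmod (f y) \<longrightarrow> cmod (u (\<Phi> \<xi>)) \<le> M)"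
    then show ?thesis unfolding P_def by blast
  qed (use that K t in auto)
  then obtain N M where NM: "\<And>x. x \<in> K \<Longrightarrow> open (N x)" "\<And>x. x \<in> K \<Longrightarrow> x \<in> N x" "\<And>x y. x \<in> K \<Longrightarrow> y \<in> N x \<Longrightarrow> P (M x) y"
    by metis
  have "K \<subseteq> (\<Union>x\<in>K. N x)" using NM(2) by blast
  then obtain D where D: "D \<subseteq> K" "finite D" "K \<subseteq> (\<Union>x\<in>D. N x)"
    using compactE_image[OF K(1), of K N] NM(1) by metis
  \<comment> \<open>Inserting 0 gives the maximum a meaning when the finite cover is empty.\<close>
  define B where "B = Max (insert 0 (M ` D))"
  have bound: "(t * cmod (f y)) ^ k * cmod (taylor u k \<zeta> y) \<le> B" if y: "y \<in> K" and \<zeta>: "supnorm \<zeta> \<le> 1" for y k \<zeta>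
  proof -
    obtain x where x: "x \<in> D" "y \<in> N x" using D y by blast
    then have "P (M x) y" using NM(3) D by blast
    then obtain r \<Phi> where r: "t * cmod (f y) < r" and \<Phi>: "is_phi A \<omega> y r \<Phi>" "\<Phi> ` polydisc r \<subseteq> \<Omega>"
      and M: "\<And>\<xi>. supnorm \<xi> \<le> t * cmod (f y) \<Longrightarrow> cmod (u (\<Phi> \<xi>)) \<le> M x" unfolding P_def by blast
    have "(t * cmod (f y)) ^ k * cmod (taylor u k \<zeta> y) \<le> M x"
      by (rule taylor_bound[OF \<Omega> u \<Phi> _ r M \<zeta>]) (use t in simp)
    also have "M x \<le> B" unfolding B_def using D x by (intro Max_ge) auto
    finally show ?thesis .
  qed
  show ?thesis
  proof (rule that[of B])
    fix k and \<zeta> :: "complex^'n" assume \<zeta>: "supnorm \<zeta> \<le> 1"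
    \<comment> \<open>The constant factor \<open>t ^ k\<close> is left out of \<open>g\<close> and
      returns as the divisor in \<open>B / t ^ k\<close>.\<close>
    define g where "g x = f x ^ k * taylor u k \<zeta> x" for x
    have "g \<in> hol_functions A \<Omega>"
      unfolding g_def by (intro hol_functions_mult hol_functions_power f taylor_hol_functions \<Omega> u)
    then have "ereal (cmod (g a)) \<le> (SUP y\<in>K. ereal (cmod (g y)))"
      using a by (simp add: hol_hull_def)
    also have "\<dots> \<le> ereal (B / t ^ k)"
    proof (rule SUP_least)
      fix y assume "y \<in> K"
      from bound[OF this \<zeta>, of k] show "ereal (cmod (g y)) \<le> ereal (B / t ^ k)"
        using t by (simp add: g_def norm_mult norm_power power_mult_distrib field_simps)
    qed
    finally show "(t * cmod (f a)) ^ k * cmod (taylor u k \<zeta> a) \<le> B"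
      using t by (simp add: g_def norm_mult norm_power power_mult_distrib field_simps)
  qed
qed

text \<open>By homogeneity, the bound for \<open>supnorm \<zeta> \<le> 1\<close> becomes a geometric
  majorant with ratio \<open>r / (t * \<rho>)\<close> on the polydisc of radius \<open>r\<close>.
  For every \<open>r < \<rho>\<close> this ratio is below 1 once \<open>t\<close> is close enough to
  1.\<close>

lemma hol_on_taylor_series:
  assumes \<Omega>: "open \<Omega>" and u: "u \<in> hol_functions A \<Omega>" and a: "a \<in> \<Omega>"
    and bd: "\<And>t. 0 < t \<Longrightarrow> t < 1 \<Longrightarrow> \<exists>M. \<forall>k \<zeta>. supnorm \<zeta> \<le> 1 \<longrightarrow> (t * \<rho>) ^ k * cmod (taylor u k \<zeta> a) \<le> M"
  shows "hol_on (\<lambda>\<zeta>. \<Sum>k. taylor u k \<zeta> a) (polydisc \<rho>)"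
proof (rule hol_on_suminf)
  show "hol_on (\<lambda>\<zeta>. taylor u k \<zeta> a) (polydisc \<rho>)" for k
    by (rule hol_on_subset[OF hol_on_taylor[OF \<Omega> u a]]) simp
  fix z :: "complex^'n" assume "z \<in> polydisc \<rho>"
  then have z: "supnorm z < \<rho>" by (simp add: polydisc_iff)
  then obtain r where r: "supnorm z < r" "r < \<rho>" using dense by blast
  have "0 < r" "0 < \<rho>" using r z supnorm_nonneg[of z] by auto
  then have "r / \<rho> < 1" "0 < r / \<rho>" using r by auto
  then obtain t where t: "r / \<rho> < t" "t < 1" "0 < t" using dense by (meson less_trans)
  obtain M where M: "\<And>k \<zeta>. supnorm \<zeta> \<le> 1 \<Longrightarrow> (t * \<rho>) ^ k * cmod (taylor u k \<zeta> a) \<le> M"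
    using bd[OF t(3,2)] by blast
  have tr: "0 < t * \<rho>" "r < t * \<rho>" using t \<open>0 < \<rho>\<close> by (auto simp: field_simps)
  have sub: "supnorm w < r" if "w \<in> ball z (r - supnorm z)" for w
    using that supnorm_triangle[of z "w - z"] supnorm_le_norm[of "w - z"]
    by (simp add: dist_norm norm_minus_commute)
  have bound: "cmod (taylor u k w a) \<le> M * (r / (t * \<rho>)) ^ k" if w: "supnorm w < r" for w k
  proof -
    have "supnorm ((1 / complex_of_real r) *s w) \<le> 1"
      using w \<open>0 < r\<close> by (simp add: supnorm_cscale norm_divide)
    from M[OF this, of k] have "(t * \<rho>) ^ k * (cmod (taylor u k w a) / r ^ k) \<le> M"
      using \<open>0 < r\<close> by (simp add: taylor_homogeneous[OF \<Omega> u a] norm_mult norm_power norm_divide power_divide)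
    moreover have "x \<le> M * (r / s) ^ k" if "s ^ k * (x / r ^ k) \<le> M" "0 < s" for x s
      using that \<open>0 < r\<close> by (simp add: power_divide field_simps)
    ultimately show ?thesis using tr(1) by blast
  qed
  have ball: "0 < r - supnorm z" "ball z (r - supnorm z) \<subseteq> polydisc \<rho>"
    "\<forall>w\<in>ball z (r - supnorm z). \<forall>i. cmod (taylor u i w a) \<le> M * (r / (t * \<rho>)) ^ i"
  proof -
    show "ball z (r - supnorm z) \<subseteq> polydisc \<rho>"
    proof
      fix w assume "w \<in> ball z (r - supnorm z)"
      from sub[OF this] show "w \<in> polydisc \<rho>" using r(2) by (simp add: polydisc_iff)
    qed
    show "\<forall>w\<in>ball z (r - supnorm z). \<forall>i. cmod (taylor u i w a) \<le> M * (r / (t * \<rho>)) ^ i"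
      using bound sub by blast
  qed (use r in simp)
  have q: "0 \<le> r / (t * \<rho>)" "r / (t * \<rho>) < 1" using tr \<open>0 < r\<close> by auto
  show "\<exists>R>0. \<exists>M q. ball z R \<subseteq> polydisc \<rho> \<and> 0 \<le> q \<and> q < 1 \<and>
      (\<forall>w\<in>ball z R. \<forall>i. cmod (taylor u i w a) \<le> M * q ^ i)"
    by (rule exI[of _ "r - supnorm z"], rule conjI[OF ball(1)], rule exI[of _ M],
        rule exI[of _ "r / (t * \<rho>)"], intro conjI ball q)
qed

section \<open>Reaching the boundary and continuing functions across it\<close>

text \<open>\<open>\<zeta>\<close> is the radial limit of points that are mapped into
  \<open>\<Omega>\<close>, so its image lies in the closure but, by assumption, not in the open set
  \<open>\<Omega>\<close>.\<close>

lemma frontier_phi: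
  assumes "open \<Omega>" "is_phi A \<omega> a R \<Phi>" "0 < supnorm \<zeta>" "supnorm \<zeta> < R"
    and "\<Phi> ` polydisc (supnorm \<zeta>) \<subseteq> \<Omega>" "\<Phi> \<zeta> \<notin> \<Omega>"
  shows "\<Phi> \<zeta> \<in> frontier \<Omega>"
proof -
  have cont: "continuous_on (polydisc R) \<Phi>"
    using assms(2) by (simp add: is_phi_iff_developing developing_continuous_on)
  have cl: "closure (polydisc (supnorm \<zeta>)) \<subseteq> {z :: complex^'n. supnorm z \<le> supnorm \<zeta>}"
    by (rule closure_minimal) (auto simp: polydisc_iff intro!: closed_Collect_le continuous_intros)
  have "(\<lambda>n. (1 - inverse (real (Suc n))) *\<^sub>R \<zeta>) \<longlonglongrightarrow> (1 - 0) *\<^sub>R \<zeta>"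
    by (intro tendsto_intros LIMSEQ_inverse_real_of_nat)
  moreover have "(1 - inverse (real (Suc n))) *\<^sub>R \<zeta> \<in> polydisc (supnorm \<zeta>)" for n
  proof -
    have "0 \<le> 1 - inverse (real (Suc n))" "1 - inverse (real (Suc n)) < 1"
      by (simp_all add: field_simps)
    then have "\<bar>1 - inverse (real (Suc n))\<bar> * supnorm \<zeta> < 1 * supnorm \<zeta>"
      using assms(3) by (intro mult_strict_right_mono) auto
    then show ?thesis unfolding polydisc_iff supnorm_scaleR by simp
  qed
  ultimately have "\<zeta> \<in> closure (polydisc (supnorm \<zeta>))"
    unfolding closure_sequential by (intro exI[of _ "\<lambda>n. (1 - inverse (real (Suc n))) *\<^sub>R \<zeta>"]) auto
  moreover have "\<Phi> ` closure (polydisc (supnorm \<zeta>)) \<subseteq> closure \<Omega>"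
  proof (rule image_closure_subset)
    show "continuous_on (closure (polydisc (supnorm \<zeta>))) \<Phi>"
      by (rule continuous_on_subset[OF cont]) (use cl assms(4) in \<open>auto simp: polydisc_iff\<close>)
    show "\<Phi> ` polydisc (supnorm \<zeta>) \<subseteq> closure \<Omega>" using assms(5) closure_subset by blast
  qed simp
  ultimately show ?thesis using assms(1,6) by (auto simp: frontier_def interior_open)
qed

text \<open>In the coordinates around \<open>\<Phi> \<zeta>\<close> the manifold is parametrised by
  \<open>\<Phi> (\<xi> + \<zeta>)\<close>, so the Taylor series at \<open>\<xi> + \<zeta>\<close>
  defines the continuation of \<open>u\<close>. On \<open>V\<close> the argument lies in the
  polydisc mapped into \<open>\<Omega>\<close>, where the series sums to \<open>u\<close>.\<close>

lemma extension_across: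
  assumes \<Omega>: "open \<Omega>" and \<Phi>: "is_phi A \<omega> a R \<Phi>" and "0 < supnorm \<zeta>" "supnorm \<zeta> < R" "supnorm \<zeta> < \<rho>"
    and im: "\<Phi> ` polydisc (supnorm \<zeta>) \<subseteq> \<Omega>"
    and F: "\<And>u. u \<in> hol_functions A \<Omega> \<Longrightarrow> hol_on (\<lambda>\<zeta>. \<Sum>k. taylor u k \<zeta> a) (polydisc \<rho>)"
  obtains U V where "open U" "connected U" "\<Phi> \<zeta> \<in> U" "open V" "V \<noteq> {}" "V \<subseteq> U \<inter> \<Omega>"
    "\<And>u. u \<in> hol_functions A \<Omega> \<Longrightarrow> \<exists>g\<in>hol_functions A U. \<forall>x\<in>V. u x = g x"
proof -
  obtain r0 N \<alpha> \<Theta> where r0: "0 < r0"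
    and N: "\<And>r'. 0 < r' \<Longrightarrow> r' \<le> r0 \<Longrightarrow> open (N r') \<and> \<Phi> \<zeta> \<in> N r' \<and> N r' \<subseteq> UNIV \<and> homeomorphism (N r') (polydisc r') \<alpha> \<Theta>"
    and \<Theta>0: "\<Theta> 0 = \<Phi> \<zeta>" "developing A \<omega> (polydisc r0) \<Theta>"
    and \<alpha>: "\<And>j. (\<lambda>y. \<alpha> y $ j) \<in> hol_functions A (N r0)"
    by (rule local_coordinates[OF open_UNIV UNIV_I, of "\<Phi> \<zeta>"]) blast
  \<comment> \<open>Small enough that a shift by \<open>\<zeta>\<close> stays both in the domain of
    \<open>\<Phi>\<close> and in the polydisc where the series is holomorphic.\<close>
  define r where "r = min r0 (min R \<rho> - supnorm \<zeta>)"
  have r: "0 < r" "r \<le> r0" "r \<le> R - supnorm \<zeta>" "r \<le> \<rho> - supnorm \<zeta>" using r0 assms by (auto simp: r_def)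
  define U where "U = N r"
  have U: "open U" "\<Phi> \<zeta> \<in> U" and hom: "homeomorphism U (polydisc r) \<alpha> \<Theta>"
    using N[OF r(1,2)] by (auto simp: U_def)
  have U_eq: "U = \<Theta> ` polydisc r" using hom by (simp add: homeomorphism_def)
  have shift: "\<xi> + \<zeta> \<in> polydisc R" "\<xi> + \<zeta> \<in> polydisc \<rho>" if "\<xi> \<in> polydisc r" for \<xi>
    using that r supnorm_triangle[of \<xi> \<zeta>] by (auto simp: polydisc_iff)
  have agree: "\<Theta> \<xi> = \<Phi> (\<xi> + \<zeta>)" if "\<xi> \<in> polydisc r" for \<xi>
  proof -
    have "is_phi A \<omega> (\<Phi> \<zeta>) r0 \<Theta>" using \<Theta>0 by (simp add: is_phi_iff_developing)
    moreover have "is_phi A \<omega> (\<Phi> \<zeta>) r (\<lambda>\<xi>. \<Phi> (\<xi> + \<zeta>))" by (rule phi_translate[OF \<Phi>]) (use r in simp)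
    ultimately show ?thesis by (rule phi_agree) (use that r in \<open>auto simp: polydisc_iff\<close>)
  qed
  define P where "P = polydisc r \<inter> {\<xi>. \<xi> + \<zeta> \<in> polydisc (supnorm \<zeta>)}"
  define V where "V = \<Theta> ` P"
  have "open V"
  proof -
    have "open P" unfolding P_def polydisc_iff
      by (intro open_Int open_polydisc open_Collect_less continuous_intros)
    then have "openin (top_of_set (polydisc r)) P" by (auto simp: openin_open P_def)
    then have "openin (top_of_set U) V"
      unfolding V_def by (rule homeomorphism_imp_open_map[OF homeomorphism_symD[OF hom]])
    then show ?thesis using U(1) by (simp add: openin_open_eq)
  qed
  moreover have "V \<noteq> {}"
  proof -
    \<comment> \<open>The witness in \<open>P\<close> lies a little way from \<open>\<zeta>\<close>
      along the ray towards 0; \<open>d\<close> is below 1 and makes the displacement shorter than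
      \<open>r\<close>.\<close>
    define d where "d = min (1/2) (r / (2 * supnorm \<zeta>))"
    have d: "0 < d" "d < 1" "d * supnorm \<zeta> < r"
      using r(1) assms(3) by (auto simp: d_def min_def field_simps)
    have "- d *\<^sub>R \<zeta> + \<zeta> = (1 - d) *\<^sub>R \<zeta>" by (simp add: scaleR_diff_left)
    then have "- d *\<^sub>R \<zeta> \<in> P"
      unfolding P_def using d assms(3) by (simp add: polydisc_iff supnorm_scaleR supnorm_minus)
    then show ?thesis by (auto simp: V_def)
  qed
  moreover have "connected U"
    unfolding U_eq using hom
    by (intro connected_continuous_image convex_connected convex_polydisc) (simp add: homeomorphism_def)
  moreover have "V \<subseteq> U \<inter> \<Omega>" using im agree by (auto simp: V_def U_eq P_def)
  moreover have "\<exists>g\<in>hol_functions A U. \<forall>x\<in>V. u x = g x" if u: "u \<in> hol_functions A \<Omega>" for u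
  proof -
    define G where "G \<xi> = (\<Sum>k. taylor u k (1 *s \<xi> + \<zeta>) a)" for \<xi>
    have holG: "hol_on G (polydisc r)"
      unfolding G_def by (rule hol_on_compose[OF hol_on_affine F[OF u]]) (use shift in auto)
    have \<alpha>U: "(\<lambda>y. \<alpha> y $ j) \<in> hol_functions A U" for j
    proof (rule hol_functions_subset[OF \<alpha>])
      have "N r0 = \<Theta> ` polydisc r0" using N[OF r0] by (simp add: homeomorphism_def)
      then show "U \<subseteq> N r0" unfolding U_eq using r(2) by (auto simp: polydisc_iff)
    qed
    have "\<alpha> ` U \<subseteq> polydisc r" using hom by (simp add: homeomorphism_def)
    then have "(\<lambda>x. G (\<alpha> x)) \<in> hol_functions A U"
      by (rule hol_functions_compose[OF atlas \<alpha>U holG])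
    moreover have "u x = G (\<alpha> x)" if "x \<in> V" for x
    proof -
      obtain \<xi> where \<xi>: "\<xi> \<in> P" "x = \<Theta> \<xi>" using \<open>x \<in> V\<close> by (auto simp: V_def)
      then have "\<alpha> x = \<xi>" using hom by (auto simp: P_def homeomorphism_def)
      have "(\<lambda>k. taylor u k (\<xi> + \<zeta>) a) sums u (\<Phi> (\<xi> + \<zeta>))"
        by (rule taylor_sums[OF \<Omega> u is_phi_mono[OF \<Phi>] im]) (use \<xi> assms(4) in \<open>auto simp: P_def polydisc_iff\<close>)
      then show ?thesis using \<xi> agree[of \<xi>] \<open>\<alpha> x = \<xi>\<close> by (simp add: G_def sums_iff P_def)
    qed
    ultimately show ?thesis by (intro bexI[of _ "\<lambda>x. G (\<alpha> x)"] ballI)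
  qed
  ultimately show ?thesis by (intro that[of U V] U)
qed

lemma rho_hull:
  assumes \<Omega>: "relcompact_subdomain \<Omega>" "domain_of_holomorphy A \<Omega>" and K: "compact K" "K \<subseteq> \<Omega>"
    and f: "f \<in> hol_functions A \<Omega>" and le: "\<And>x. x \<in> K \<Longrightarrow> ereal (cmod (f x)) \<le> rho A \<omega> x \<Omega>"
    and a: "a \<in> hol_hull A \<Omega> K"
  shows "ereal (cmod (f a)) \<le> rho A \<omega> a \<Omega>"
proof (rule ccontr)
  assume "\<not> ereal (cmod (f a)) \<le> rho A \<omega> a \<Omega>"
  then have less: "rho A \<omega> a \<Omega> < ereal (cmod (f a))" by simp
  have op: "open \<Omega>" and comp: "compact (closure \<Omega>)" using \<Omega>(1) by (auto simp: relcompact_subdomain_def)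
  have a\<Omega>: "a \<in> \<Omega>" using a by (simp add: hol_hull_def)
  have pos: "0 < rho A \<omega> a \<Omega>" by (rule rho_pos[OF op a\<Omega>])
  \<comment> \<open>Being positive and below a real number, the radius is itself real.\<close>
  obtain R where R: "rho A \<omega> a \<Omega> = ereal R"
    using less pos by (cases "rho A \<omega> a \<Omega>") auto
  have "0 < R" "R < cmod (f a)" using less pos R by auto
  obtain e where e: "0 < e" "\<And>x. x \<in> closure \<Omega> \<Longrightarrow> \<exists>\<Phi>. is_phi A \<omega> x e \<Phi>"
    by (rule uniform_phi[OF comp]) blast
  \<comment> \<open>A map whose radius is within \<open>e\<close> of the supremum is extended by
    \<open>e\<close> and so passes the radius \<open>R\<close>.\<close>
  have "ereal (R - e) < rho A \<omega> a \<Omega>" using R e by simp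
  then obtain r \<Phi> where r: "R - e < r" "0 < r" and \<Phi>: "is_phi A \<omega> a r \<Phi>" "\<Phi> ` polydisc r \<subseteq> \<Omega>"
    by (rule less_rhoD)
  obtain \<Psi> where \<Psi>: "is_phi A \<omega> a (r + e) \<Psi>"
  proof (rule phi_extend[OF \<Phi>(1) r(2) e(1)])
    show "\<exists>\<Psi>. is_phi A \<omega> x e \<Psi>" if "x \<in> \<Phi> ` polydisc r" for x
      using that \<Phi>(2) closure_subset e(2) by blast
  qed
  \<comment> \<open>Capped at \<open>cmod (f a)\<close>, the radius up to which the Taylor series
    are controlled. It still exceeds \<open>R\<close>, so \<open>\<Psi>\<close> must leave
    \<open>\<Omega>\<close> on this polydisc.\<close>
  define R' where "R' = min (r + e) (cmod (f a))"
  have R': "R < R'" using r \<open>R < cmod (f a)\<close> by (simp add: R'_def)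
  have "\<not> \<Psi> ` polydisc R' \<subseteq> \<Omega>"
  proof
    assume "\<Psi> ` polydisc R' \<subseteq> \<Omega>"
    then have "ereal R' \<le> rho A \<omega> a \<Omega>"
      using R' \<open>0 < R\<close> by (intro le_rho[OF is_phi_mono[OF \<Psi>]]) (auto simp: R'_def)
    then show False using R R' by simp
  qed
  then obtain \<zeta>1 where "\<zeta>1 \<in> polydisc R'" "\<Psi> \<zeta>1 \<notin> \<Omega>" by blast
  then have \<zeta>1: "supnorm \<zeta>1 < R'" "\<Psi> \<zeta>1 \<notin> \<Omega>" by (simp_all add: polydisc_iff)
  \<comment> \<open>The exit points of norm at most that of \<open>\<zeta>1\<close>, a compact set
    because \<open>\<Omega>\<close> is open. An exit point \<open>\<zeta>\<close> of minimal norm is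
    such that the open polydisc of radius \<open>supnorm \<zeta>\<close> is still mapped into
    \<open>\<Omega>\<close>.\<close>
  define C where "C = {\<zeta>. supnorm \<zeta> \<le> supnorm \<zeta>1} \<inter> \<Psi> -` (- \<Omega>)"
  have cont: "continuous_on (polydisc (r + e)) \<Psi>"
    using \<Psi> by (simp add: is_phi_iff_developing developing_continuous_on)
  have "closed C"
    unfolding C_def
  proof (rule continuous_closed_preimage)
    show "continuous_on {\<zeta>. supnorm \<zeta> \<le> supnorm \<zeta>1} \<Psi>"
      by (rule continuous_on_subset[OF cont]) (use \<zeta>1 in \<open>auto simp: polydisc_iff R'_def\<close>)
  qed (use op compact_imp_closed[OF compact_supnorm_le] in auto)
  then have "compact C"
    using compact_Int_closed[OF compact_supnorm_le] by (metis C_def inf.absorb_iff2 inf_le1)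
  moreover have "\<zeta>1 \<in> C" using \<zeta>1 by (simp add: C_def)
  moreover have "continuous_on C supnorm" by (intro continuous_intros)
  ultimately obtain \<zeta> where \<zeta>: "\<zeta> \<in> C" and min: "\<And>\<xi>. \<xi> \<in> C \<Longrightarrow> supnorm \<zeta> \<le> supnorm \<xi>"
    using continuous_attains_inf[of C supnorm] by blast
  have "\<Psi> 0 \<in> \<Omega>" using \<Psi> a\<Omega> by (simp add: is_phi_def)
  then have "\<zeta> \<noteq> 0" using \<zeta> by (auto simp: C_def)
  then have \<zeta>0: "0 < supnorm \<zeta>" using supnorm_nonneg[of \<zeta>] supnorm_eq_0[of \<zeta>] by linarith
  have \<zeta>R: "supnorm \<zeta> < r + e" "supnorm \<zeta> < cmod (f a)" using \<zeta> \<zeta>1 by (auto simp: C_def R'_def)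
  have out: "\<Psi> \<zeta> \<notin> \<Omega>" using \<zeta> by (simp add: C_def)
  have im: "\<Psi> ` polydisc (supnorm \<zeta>) \<subseteq> \<Omega>"
  proof (rule image_subsetI, rule ccontr)
    fix \<xi> assume "\<xi> \<in> polydisc (supnorm \<zeta>)" "\<Psi> \<xi> \<notin> \<Omega>"
    moreover from this have "\<xi> \<in> C" using \<zeta> by (auto simp: C_def polydisc_iff)
    ultimately show False using min[of \<xi>] by (simp add: polydisc_iff)
  qed
  have F: "hol_on (\<lambda>\<zeta>. \<Sum>k. taylor u k \<zeta> a) (polydisc (cmod (f a)))" if u: "u \<in> hol_functions A \<Omega>" for u
  proof (rule hol_on_taylor_series[OF op u a\<Omega>])
    fix t :: real assume t: "0 < t" "t < 1"
    show "\<exists>M. \<forall>k \<zeta>. supnorm \<zeta> \<le> 1 \<longrightarrow> (t * cmod (f a)) ^ k * cmod (taylor u k \<zeta> a) \<le> M"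
      by (rule taylor_bound_hull[OF op f u K le a t]) blast+
  qed
  obtain U V where "open U" "connected U" "\<Psi> \<zeta> \<in> U" "open V" "V \<noteq> {}" "V \<subseteq> U \<inter> \<Omega>"
    "\<forall>u\<in>hol_functions A \<Omega>. \<exists>g\<in>hol_functions A U. \<forall>x\<in>V. u x = g x"
  proof (rule extension_across[OF op \<Psi> \<zeta>0 \<zeta>R im F])
    fix U V assume UV: "open U" "connected U" "\<Psi> \<zeta> \<in> U" "open V" "V \<noteq> {}" "V \<subseteq> U \<inter> \<Omega>"
      "\<And>u. u \<in> hol_functions A \<Omega> \<Longrightarrow> \<exists>g\<in>hol_functions A U. \<forall>x\<in>V. u x = g x"
    show thesis by (rule that[OF UV(1-6)]) (use UV(7) in blast)
  qed
  moreover have "\<Psi> \<zeta> \<in> frontier \<Omega>" by (rule frontier_phi[OF op \<Psi> \<zeta>0 \<zeta>R(1) im out])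
  ultimately show False using \<Omega>(2) unfolding domain_of_holomorphy_def by blast
qed

end

section \<open>From the pointwise bound to equality of the radii of \<open>K\<close> and its
  hull\<close>

lemma subset_hol_hull:
  assumes "K \<subseteq> \<Omega>"
  shows "K \<subseteq> hol_hull A \<Omega> K"
  using assms by (auto simp: hol_hull_def intro!: SUP_upper)

theorem theorem1p8:
  fixes A :: "('a::{t2_space, second_countable_topology}, 'n::finite) chart set"
    and \<omega> :: "'n \<Rightarrow> ('a, 'n) form"
    and \<Omega> K :: "'a set"
  assumes "cond_A A \<omega>"
    and "relcompact_subdomain \<Omega>"
    and "domain_of_holomorphy A \<Omega>"
    and "compact K" and "K \<subseteq> \<Omega>"
  shows "(\<forall>f\<in>hol_functions A \<Omega>.
            (\<forall>a\<in>K. ereal (cmod (f a)) \<le> rho A \<omega> a \<Omega>) \<longrightarrow>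
            (\<forall>a\<in>hol_hull A \<Omega> K. ereal (cmod (f a)) \<le> rho A \<omega> a \<Omega>)) \<and>
         rho_set A \<omega> K \<Omega> = rho_set A \<omega> (hol_hull A \<Omega> K) \<Omega>"
proof
  interpret closed_coframe A \<omega> by standard fact
  show *: "\<forall>f\<in>hol_functions A \<Omega>.
            (\<forall>a\<in>K. ereal (cmod (f a)) \<le> rho A \<omega> a \<Omega>) \<longrightarrow>
            (\<forall>a\<in>hol_hull A \<Omega> K. ereal (cmod (f a)) \<le> rho A \<omega> a \<Omega>)"
    using rho_hull[OF assms(2-5)] by blast
  show "rho_set A \<omega> K \<Omega> = rho_set A \<omega> (hol_hull A \<Omega> K) \<Omega>"
    unfolding rho_set_def
  proof (rule antisym)
    show "(INF a\<in>hol_hull A \<Omega> K. rho A \<omega> a \<Omega>) \<le> (INF a\<in>K. rho A \<omega> a \<Omega>)"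
      by (rule INF_superset_mono[OF subset_hol_hull[OF assms(5)]]) simp
    show "(INF a\<in>K. rho A \<omega> a \<Omega>) \<le> (INF a\<in>hol_hull A \<Omega> K. rho A \<omega> a \<Omega>)"
    proof (rule INF_greatest)
      fix a assume a: "a \<in> hol_hull A \<Omega> K"
      show "(INF a\<in>K. rho A \<omega> a \<Omega>) \<le> rho A \<omega> a \<Omega>"
      proof (rule ccontr)
        assume "\<not> ?thesis"
        then have "rho A \<omega> a \<Omega> < (INF a\<in>K. rho A \<omega> a \<Omega>)" by simp
        \<comment> \<open>The constant function \<open>c\<close> takes the role of \<open>f\<close>.
          A real number strictly in between exists even if the infimum over \<open>K\<close> is
          infinite, and it is positive, so \<open>cmod\<close> does not change it.\<close>
        then obtain c where c: "rho A \<omega> a \<Omega> < ereal c" "ereal c < (INF a\<in>K. rho A \<omega> a \<Omega>)"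
          using ereal_dense2 by blast
        have "0 < rho A \<omega> a \<Omega>"
          using assms(2) a by (intro rho_pos) (auto simp: relcompact_subdomain_def hol_hull_def)
        then have "0 < ereal c" using c(1) by (rule less_trans)
        then have abs: "cmod (complex_of_real c) = c" by simp
        have "ereal c \<le> rho A \<omega> x \<Omega>" if "x \<in> K" for x
          using c(2) INF_lower[OF that, of "\<lambda>a. rho A \<omega> a \<Omega>"] by (meson less_imp_le order_trans)
        then have "\<forall>x\<in>K. ereal (cmod (complex_of_real c)) \<le> rho A \<omega> x \<Omega>"
          unfolding abs by blast
        then have "ereal (cmod (complex_of_real c)) \<le> rho A \<omega> a \<Omega>"
          using *[THEN bspec, OF hol_functions_const[of "complex_of_real c"]] a by blast
        then have "ereal c \<le> rho A \<omega> a \<Omega>" unfolding abs .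
        with c(1) show False by simp
      qed
    qed
  qed
qed

end
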